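(* Let $N,n\ge1$ be integers, $1\le p\le\infty$, and let $\phi>0$ be a continuous increasing function on $(0,1]$. If the function $x\mapsto\phi(x)/x^\alpha$ increases on $(0,1]$ for some $0<\alpha<n$, then $$\Lambda^p_{n,\phi}(\mathbb B_N)\subset\mathrm{Lip}^p_{n,\phi}(\mathbb B_N)\quad\text{and}\quad\lambda^p_{n,\phi}(\mathbb B_N)\subset\mathrm{lip}^p_{n,\phi}(\mathbb B_N).$$
   Context: $\mathbb B_N$ is the unit ball of $\mathbb C^N$, $\mathbb S_N=\partial\mathbb B_N$, $\sigma$ is the normalized Lebesgue measure on $\mathbb S_N$, and $H(\mathbb B_N)$ is the space of holomorphic functions on $\mathbb B_N$. For $0<r<1$, $M_p(r,g)=\left(\int_{\mathbb S_N}|g(r\zeta)|^p\,d\sigma(\zeta)\right)^{1/p}$ for $p<\infty$ and $M_\infty(r,g)=\operatorname{ess\,sup}_{\zeta\in\mathbb S_N}|g(r\zeta)|$. $H^p(\mathbb B_N)$ is the space of $f\in H(\mathbb B_N)$ with $\|f\|_p:=\sup_{0<r<1}M_p(r,f)<\infty$. If $f=\sum_{k\ge0}f_k$ is the homogeneous expansion of $f$, then $\mathcal R^nf=\sum_{k\ge1}k^nf_k$. Let $\mathcal L$ be the semigroup of all linear operators from $\mathbb B_N$ to $\mathbb B_N$ and $I$ the identity. For $U\in\mathcal L$, $\Delta^1_Uf(z)=f(Uz)-f(z)$ and $\Delta^n_Uf=\Delta^1_U(\Delta^{n-1}_Uf)$ for $n\ge2$; $\omega_n^+(\delta,f)_p=\sup_{\|U-I\|<\delta,\,U\in\mathcal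 L}\|\Delta^n_Uf\|_p$. $\Lambda^p_{n,\phi}(\mathbb B_N)$ is the set of $f\in H(\mathbb B_N)$ with $M_p(r,\mathcal R^nf)=\mathcal O\big(\phi(1-r)/(1-r)^n\big)$ as $r\to1^-$. $\mathrm{Lip}^p_{n,\phi}(\mathbb B_N)$ is the set of $f\in H^p(\mathbb B_N)$ with $\omega_n^+(\delta,f)_p=\mathcal O(\phi(\delta))$ as $\delta\to0^+$. The spaces $\lambda^p_{n,\phi}(\mathbb B_N)$ and $\mathrm{lip}^p_{n,\phi}(\mathbb B_N)$ are defined in the same way, respectively, with $\mathcal O$ replaced by $o$. *)

theory Defs
  imports "HOL-Probability.Probability"
begin

text \<open>
  The space $C^N$ is \<^typ>\<open>complex ^ 'N\<close>, whose norm is the Euclidean one. Functions on the unit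
  ball are total functions on \<^typ>\<open>complex ^ 'N\<close>; their values outside \<^term>\<open>ball 0 1\<close> are never
  used.
\<close>

text \<open>
  Normalized Lebesgue measure on the unit sphere, as the cone measure: the measure of a Borel set
  \<open>A\<close> is the normalized volume of the set of all \<open>t *\<^sub>R \<zeta>\<close> with \<open>\<zeta> \<in> A\<close> and \<open>0 < t < 1\<close>
  (recall \<open>sgn z = z /\<^sub>R norm z\<close>; the origin, which \<open>sgn\<close> does not send to the sphere,
  is a null set).
\<close>

definition sphere_measure :: "(complex ^ 'N::finite) measure" where
  "sphere_measure =
     restrict_space (distr (uniform_measure lborel (ball 0 1)) borel sgn) (sphere 0 1)"

definition holomorphic_ball :: "(complex ^ 'N::finite \<Rightarrow> complex) \<Rightarrow> bool" where
  "holomorphic_ball f \<longleftrightarrow>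
     (\<forall>z\<in>ball 0 1. \<exists>D. Vector_Spaces.linear (*s) (*) D \<and> (f has_derivative D) (at z))"


subsection \<open>Homogeneous expansion and radial derivatives\<close>

text \<open>The index \<open>a\<close> runs over the multi-indices of length \<open>k\<close>.\<close>

definition homogeneous_polynomial :: "nat \<Rightarrow> (complex ^ 'N::finite \<Rightarrow> complex) \<Rightarrow> bool" where
  "homogeneous_polynomial k P \<longleftrightarrow>
     (\<exists>c :: ('N \<Rightarrow> nat) \<Rightarrow> complex.
        \<forall>z. P z = (\<Sum>a | (\<Sum>j\<in>UNIV. a j) = k. c a * (\<Prod>j\<in>UNIV. (z $ j) ^ a j)))"

definition homogeneous_expansion ::
    "(complex ^ 'N::finite \<Rightarrow> complex) \<Rightarrow> (nat \<Rightarrow> complex ^ 'N \<Rightarrow> complex) \<Rightarrow> bool" where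
  "homogeneous_expansion f F \<longleftrightarrow>
     (\<forall>k. homogeneous_polynomial k (F k)) \<and> (\<forall>z\<in>ball 0 1. (\<lambda>k. F k z) sums f z)"

text \<open>A holomorphic function on the ball has exactly one homogeneous expansion.\<close>

definition hom_component ::
    "(complex ^ 'N::finite \<Rightarrow> complex) \<Rightarrow> nat \<Rightarrow> complex ^ 'N \<Rightarrow> complex" where
  "hom_component f = (THE F. homogeneous_expansion f F)"

definition radial_deriv ::
    "nat \<Rightarrow> (complex ^ 'N::finite \<Rightarrow> complex) \<Rightarrow> complex ^ 'N \<Rightarrow> complex" where
  "radial_deriv n f z = (\<Sum>k. of_nat (Suc k) ^ n * hom_component f (Suc k) z)"


subsection \<open>Integral means and Hardy spaces\<close>

definition ennreal_powr :: "ennreal \<Rightarrow> real \<Rightarrow> ennreal" where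
  "ennreal_powr x s = (if x = \<top> then \<top> else ennreal (enn2real x powr s))"

definition int_mean ::
    "ennreal \<Rightarrow> real \<Rightarrow> (complex ^ 'N::finite \<Rightarrow> complex) \<Rightarrow> ennreal" where
  "int_mean p r g =
     (if p = \<top> then esssup sphere_measure (\<lambda>\<zeta>. ennreal (norm (g (r *\<^sub>R \<zeta>))))
      else ennreal_powr
             (\<integral>\<^sup>+ \<zeta>. ennreal (norm (g (r *\<^sub>R \<zeta>)) powr enn2real p) \<partial>sphere_measure)
             (1 / enn2real p))"

definition hardy_norm :: "ennreal \<Rightarrow> (complex ^ 'N::finite \<Rightarrow> complex) \<Rightarrow> ennreal" where
  "hardy_norm p f = (SUP r\<in>{0<..<1}. int_mean p r f)"

definition hardy_space :: "ennreal \<Rightarrow> (complex ^ 'N::finite \<Rightarrow> complex) set" where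
  "hardy_space p = {f. holomorphic_ball f \<and> hardy_norm p f < \<top>}"


subsection \<open>Differences and moduli of smoothness\<close>

definition ball_operators :: "(complex ^ 'N::finite \<Rightarrow> complex ^ 'N) set" where
  "ball_operators = {U. Vector_Spaces.linear (*s) (*s) U \<and> U ` ball 0 1 \<subseteq> ball 0 1}"

definition difference ::
    "(complex ^ 'N::finite \<Rightarrow> complex ^ 'N) \<Rightarrow>
     (complex ^ 'N \<Rightarrow> complex) \<Rightarrow> complex ^ 'N \<Rightarrow> complex" where
  "difference U f z = f (U z) - f z"

definition modulus_plus ::
    "nat \<Rightarrow> ennreal \<Rightarrow> real \<Rightarrow> (complex ^ 'N::finite \<Rightarrow> complex) \<Rightarrow> ennreal" where
  "modulus_plus n p \<delta> f =
     (SUP U\<in>{U \<in> ball_operators. onorm (\<lambda>z. U z - z) < \<delta>}. hardy_norm p ((difference U ^^ n) f))"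


subsection \<open>The four function spaces\<close>

text \<open>
  Landau symbols for functions that may take the value \<open>\<top>\<close>; the comparison function
  \<open>h\<close> is real-valued and positive along the filter wherever they are used.
\<close>

definition ennreal_bigo :: "'b filter \<Rightarrow> ('b \<Rightarrow> ennreal) \<Rightarrow> ('b \<Rightarrow> real) \<Rightarrow> bool" where
  "ennreal_bigo F g h \<longleftrightarrow> (\<exists>c>0. \<forall>\<^sub>F x in F. g x \<le> ennreal (c * h x))"

definition ennreal_smallo :: "'b filter \<Rightarrow> ('b \<Rightarrow> ennreal) \<Rightarrow> ('b \<Rightarrow> real) \<Rightarrow> bool" where
  "ennreal_smallo F g h \<longleftrightarrow> (\<forall>c>0. \<forall>\<^sub>F x in F. g x \<le> ennreal (c * h x))"

definition Lambda_bigo ::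
    "ennreal \<Rightarrow> nat \<Rightarrow> (real \<Rightarrow> real) \<Rightarrow> (complex ^ 'N::finite \<Rightarrow> complex) set" where
  "Lambda_bigo p n \<phi> =
     {f. holomorphic_ball f \<and>
         ennreal_bigo (at_left 1) (\<lambda>r. int_mean p r (radial_deriv n f))
           (\<lambda>r. \<phi> (1 - r) / (1 - r) ^ n)}"

definition Lambda_smallo ::
    "ennreal \<Rightarrow> nat \<Rightarrow> (real \<Rightarrow> real) \<Rightarrow> (complex ^ 'N::finite \<Rightarrow> complex) set" where
  "Lambda_smallo p n \<phi> =
     {f. holomorphic_ball f \<and>
         ennreal_smallo (at_left 1) (\<lambda>r. int_mean p r (radial_deriv n f))
           (\<lambda>r. \<phi> (1 - r) / (1 - r) ^ n)}"

definition Lip_bigo ::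
    "ennreal \<Rightarrow> nat \<Rightarrow> (real \<Rightarrow> real) \<Rightarrow> (complex ^ 'N::finite \<Rightarrow> complex) set" where
  "Lip_bigo p n \<phi> =
     {f \<in> hardy_space p. ennreal_bigo (at_right 0) (\<lambda>\<delta>. modulus_plus n p \<delta> f) \<phi>}"

definition Lip_smallo ::
    "ennreal \<Rightarrow> nat \<Rightarrow> (real \<Rightarrow> real) \<Rightarrow> (complex ^ 'N::finite \<Rightarrow> complex) set" where
  "Lip_smallo p n \<phi> =
     {f \<in> hardy_space p. ennreal_smallo (at_right 0) (\<lambda>\<delta>. modulus_plus n p \<delta> f) \<phi>}"

end

theory Submission
  imports Defs "HOL-Complex_Analysis.Complex_Analysis"
begin

text \<open>
  The proof rests on one first order inequality: for a linear contraction \<open>U\<close> of \<open>C\<^sup>N\<close> with \<open>\<parallel>U -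
  I\<parallel> \<le> \<delta> \<le> 1 / 2\<close>, the difference \<open>f \<circ> U - f\<close> has norm at most \<open>K \<delta> \<parallel>Rf\<parallel>\<close> in \<open>H\<^sup>p\<close>, where \<open>R\<close> is
  the radial derivative and \<open>K\<close> depends on the dimension only (\<open>hardy_le_difference\<close>). As \<open>R\<close>
  commutes with composition with linear maps, this inequality iterates: an \<open>n\<close>-fold difference
  has norm at most \<open>(K \<delta>)\<^sup>n \<parallel>R\<^sup>n f\<parallel>\<close> (\<open>hardy_le_differences\<close>).

  For the first order inequality, join \<open>z\<close> to \<open>U z\<close> by a segment. It consists of the images of
  \<open>z\<close> under the contractions \<open>U\<^sub>s = (1 - s) I + s U\<close>, and along it \<open>f\<close> is differentiated in the
  direction \<open>A y\<close> with a small linear map \<open>A\<close>. So two facts are needed. First, composition with a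
  linear contraction does not increase the means of order \<open>p\<close> over a sphere
  (\<open>nn_integral_contraction_le\<close>): \<open>|f|\<^sup>p\<close> has the sub-mean value property, the unitary maps are
  the complex extreme points of the contractions, and they preserve the measure \<open>\<sigma>\<close>. Second, the
  derivative along \<open>A \<zeta>\<close> is dominated by the radial derivative alone (\<open>mean_le_dirderiv_field\<close>).
  Its component along \<open>\<zeta>\<close> is a multiple of \<open>Rf\<close>. For \<open>w\<close> orthogonal to \<open>\<zeta>\<close>, one has \<open>\<partial>\<^sub>w f (\<zeta>) =
  \<integral> \<partial>\<^sub>w(Rf) (t \<zeta>) dt\<close> over \<open>0 < t < 1\<close>, and Cauchy's estimate for the tangential derivative at \<open>t
  \<zeta>\<close> loses only \<open>(1 - t)\<^sup>-\<^sup>1\<^sup>/\<^sup>2\<close>, because a complex disc of radius of the order \<open>(1 - t)\<^sup>1\<^sup>/\<^sup>2\<close>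
  in the direction \<open>w\<close> stays in the ball. This singularity is integrable. To obtain an estimate
  in the mean, values of \<open>Rf\<close> are replaced by averages over unitarily invariant neighbourhoods,
  and such averages do not increase the norm (\<open>nn_integral_tent_average_le\<close>).

  To sum up these estimates, let \<open>\<Delta>\<^sub>L\<close> be the difference along the dilation by \<open>e\<^sup>-\<^sup>L\<close>.
  Since \<open>\<Delta>\<^sub>2\<^sub>L g = \<Delta>\<^sub>L g + (\<Delta>\<^sub>L g)(e\<^sup>-\<^sup>L \<cdot>)\<close>, replacing \<open>2 L\<close> by \<open>L\<close> in
  \<open>\<Delta>\<^sub>2\<^sub>L\<^sup>n f\<close> costs terms at the radius \<open>e\<^sup>-\<^sup>L\<close>, which are of the order \<open>L\<^sup>n M\<^sub>p(e\<^sup>-\<^sup>L,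
  R\<^sup>n f)\<close>, hence \<open>\<phi>(L)\<close> under the growth hypothesis. As \<open>\<phi>(x) / x\<^sup>\<alpha>\<close> increases, \<open>\<phi>(L / 2) \<le> 2\<^sup>-\<^sup>\<alpha>
  \<phi>(L)\<close>, and halving repeatedly gives a convergent geometric series: \<open>\<Delta>\<^sub>L\<^sup>n f\<close> has norm of
  the order \<open>\<phi>(L)\<close> (\<open>hardy_le_radial_differences\<close>). Finally, \<open>f\<close> is \<open>\<plusminus>\<Delta>\<^sub>L\<^sup>n f\<close> plus a
  combination of dilates of \<open>f\<close> by \<open>e\<^sup>-\<^sup>L\<close> and its higher powers. With \<open>L = \<delta>\<close>, the \<open>n\<close>-fold
  difference along \<open>U\<close> at most multiplies the norm of the first part by \<open>2\<^sup>n\<close>, and on the dilates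
  it is again of the order \<open>L\<^sup>n M\<^sub>p(e\<^sup>-\<^sup>L, R\<^sup>n f)\<close> (\<open>hardy_le_differences_of_radial\<close>). All bounds
  are linear in the constant of the growth hypothesis and local at the boundary, so they give the
  statements for \<open>O\<close> and for \<open>o\<close> at once (\<open>modulus_plus_le\<close>). The constants do not depend on \<open>p\<close>,
  and \<open>p = \<top>\<close> is obtained by letting \<open>p\<close> tend to infinity.

  The radial derivative of the statement is defined by the homogeneous expansion. That every
  holomorphic function on the ball has exactly one such expansion, and that \<open>R\<^sup>n\<close> is the \<open>n\<close>-th
  iterate of the differential operator \<open>R f (z) = d/dt f(t z)\<close> at \<open>t = 1\<close>, is shown in
  \<open>radial_deriv_eq\<close> and the lemmas before it.
\<close>


section \<open>The complex inner product and unitary maps\<close>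

definition cin :: "complex ^ 'N::finite \<Rightarrow> complex ^ 'N \<Rightarrow> complex" where
  "cin x y = (\<Sum>j\<in>UNIV. x $ j * cnj (y $ j))"

lemma cin_add_left: "cin (x + y) z = cin x z + cin y z"
  and cin_add_right: "cin z (x + y) = cin z x + cin z y"
  and cin_diff_left: "cin (x - y) z = cin x z - cin y z"
  and cin_diff_right: "cin z (x - y) = cin z x - cin z y"
  and cin_scale_left: "cin (c *s x) y = c * cin x y"
  and cin_scale_right: "cin x (c *s y) = cnj c * cin x y"
  and cin_minus_left: "cin (- x) y = - cin x y"
  and cin_minus_right: "cin x (- y) = - cin x y"
  and cin_zero_left [simp]: "cin 0 y = 0"
  and cin_zero_right [simp]: "cin x 0 = 0"
  and cin_commute: "cin y x = cnj (cin x y)"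
  by (simp_all add: cin_def algebra_simps sum.distrib sum_subtractf sum_distrib_left sum_negf)

lemma Re_cin: "Re (cin x y) = x \<bullet> y"
  by (simp add: cin_def inner_vec_def inner_complex_def)

lemma cin_self: "cin x x = of_real ((norm x)\<^sup>2)"
proof (rule complex_eqI)
  show "Re (cin x x) = Re (of_real ((norm x)\<^sup>2))"
    by (simp add: Re_cin dot_square_norm)
  show "Im (cin x x) = Im (of_real ((norm x)\<^sup>2))"
    by (simp add: cin_def algebra_simps)
qed

lemma norm_add_cin: "(norm (x + y))\<^sup>2 = (norm x)\<^sup>2 + 2 * Re (cin x y) + (norm y)\<^sup>2"
  by (simp add: Re_cin power2_norm_eq_inner inner_add_left inner_add_right inner_commute)

lemma norm_cscale: "norm (c *s x :: complex ^ 'N::finite) = norm c * norm x"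
proof -
  have "(norm (c *s x))\<^sup>2 = (norm c * norm x)\<^sup>2"
    by (simp add: norm_vec_def L2_set_def sum_nonneg norm_mult power_mult_distrib
        sum_distrib_left)
  thus ?thesis by (rule power2_eq_imp_eq) auto
qed

lemma scaleR_cscale: "r *\<^sub>R x = complex_of_real r *s (x :: complex ^ 'N::finite)"
  by (subst vec_eq_iff) (simp only: simp_thms vector_scaleR_component vector_smult_component, simp add: scaleR_conv_of_real)

lemma norm_cin_le: "norm (cin x y) \<le> norm x * norm y"
proof -
  define c where "c = (if cin x y = 0 then 1 else cnj (cin x y) / norm (cin x y))"
  have c: "norm c = 1" by (simp add: c_def norm_divide)
  have "cin (c *s x) y = of_real (norm (cin x y))"
    by (simp add: cin_scale_left c_def complex_norm_square[symmetric] mult.commute power2_eq_square)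
  hence "norm (cin x y) = (c *s x) \<bullet> y" by (metis Re_cin Re_complex_of_real)
  also have "\<dots> \<le> norm (c *s x) * norm y" by (rule norm_cauchy_schwarz)
  finally show ?thesis by (simp add: norm_cscale c)
qed

lemma norm_perp_add:
  assumes "cin w z = 0"
  shows "(norm (c *s z + w))\<^sup>2 = (norm c * norm z)\<^sup>2 + (norm w)\<^sup>2"
  using assms by (simp add: norm_add_cin cin_scale_left norm_cscale cin_commute[of z w])

lemma clinear_imp_linear:
  assumes "Vector_Spaces.linear (*s) (*s) (U :: complex ^ 'N::finite \<Rightarrow> complex ^ 'N)"
  shows "linear U"
proof -
  interpret U: Vector_Spaces.linear "(*s)" "(*s)" U by fact
  show ?thesis
    by (rule linearI) (auto simp: U.add U.scale scaleR_cscale)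
qed

definition unitary_op :: "(complex ^ 'N::finite \<Rightarrow> complex ^ 'N) \<Rightarrow> bool" where
  "unitary_op V \<longleftrightarrow> Vector_Spaces.linear (*s) (*s) V \<and> (\<forall>x. norm (V x) = norm x)"

lemma unitary_cin:
  assumes "unitary_op V" shows "cin (V x) (V y) = cin x y"
proof -
  interpret V: Vector_Spaces.linear "(*s)" "(*s)" V using assms by (simp add: unitary_op_def)
  have n: "norm (V x) = norm x" for x using assms by (simp add: unitary_op_def)
  have re: "Re (cin (V x) (V y)) = Re (cin x y)" for x y
    using norm_add_cin[of "V x" "V y"] norm_add_cin[of x y] by (simp add: n flip: V.add)
  have "Re (cin (V (\<i> *s x)) (V y)) = Re (cin (\<i> *s x) y)" by (rule re)
  thus ?thesis using re[of x y] by (intro complex_eqI) (simp_all add: V.scale cin_scale_left)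
qed

text \<open>A multiple of modulus one makes the inner product of \<open>x\<close> and \<open>y\<close> real; then the complex
  Householder reflection along their difference exchanges them.\<close>

lemma unitary_transitive:
  fixes x y :: "complex ^ 'N::finite"
  assumes "norm x = norm y"
  obtains V where "unitary_op V" "V x = y"
proof -
  define c where "c = (if cin x y = 0 then 1 else cnj (cin x y) / norm (cin x y))"
  have c: "norm c = 1" by (simp add: c_def norm_divide)
  have r: "cin (c *s x) y = of_real (norm (cin x y))"
    by (simp add: cin_scale_left c_def complex_norm_square[symmetric] mult.commute power2_eq_square)
  define u where "u = c *s x - y"
  have nu: "(norm u)\<^sup>2 = 2 * ((norm x)\<^sup>2 - norm (cin x y))"
    using norm_add_cin[of "c *s x" "- y"] r assms
    by (simp add: u_def norm_cscale c cin_minus_right)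
  have cu: "cin (c *s x) u = of_real ((norm x)\<^sup>2 - norm (cin x y))"
    by (simp add: u_def cin_diff_right r cin_self norm_cscale c)
  define V where "V z = c *s z - (2 * cin (c *s z) u / of_real ((norm u)\<^sup>2)) *s u" for z
  have lin: "Vector_Spaces.linear (*s) (*s) V"
    by unfold_locales
      (simp_all add: V_def vector_add_ldistrib cin_add_left cin_scale_left vec_eq_iff
        algebra_simps add_divide_distrib)
  have "norm (V z) = norm z" for z
  proof (cases "u = 0")
    case True thus ?thesis by (simp add: V_def norm_cscale c)
  next
    case False
    define h where "h = cin (c *s z) u"
    have "(norm (V z))\<^sup>2 = (norm z)\<^sup>2 + 2 * Re (cin (c *s z) ((- (2 * h / of_real ((norm u)\<^sup>2))) *s u))
       + (norm ((2 * h / of_real ((norm u)\<^sup>2)) *s u))\<^sup>2"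
      using norm_add_cin[of "c *s z" "(- (2 * h / of_real ((norm u)\<^sup>2))) *s u"]
      by (simp add: V_def h_def norm_cscale c vec.scale_minus_left)
    also have "cin (c *s z) ((- (2 * h / of_real ((norm u)\<^sup>2))) *s u) = - (2 * (h * cnj h) / of_real ((norm u)\<^sup>2))"
      unfolding cin_scale_right h_def by (simp add: algebra_simps)
    also have "h * cnj h = of_real ((norm h)\<^sup>2)" by (rule complex_norm_square[symmetric])
    also have "- (2 * complex_of_real ((norm h)\<^sup>2) / of_real ((norm u)\<^sup>2)) = of_real (- (2 * (norm h)\<^sup>2 / (norm u)\<^sup>2))"
      by simp
    also have "norm ((2 * h / of_real ((norm u)\<^sup>2)) *s u) = 2 * norm h / norm u"
      using False by (simp add: norm_cscale norm_divide norm_mult norm_power power2_eq_square)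
    finally have "(norm (V z))\<^sup>2 = (norm z)\<^sup>2"
      using False by (simp add: power_divide power_mult_distrib)
    thus ?thesis by simp
  qed
  moreover have "V x = y"
  proof (cases "u = 0")
    case True thus ?thesis by (simp add: V_def u_def)
  next
    case False
    hence "(norm u)\<^sup>2 \<noteq> 0" by simp
    define d where "d = (norm x)\<^sup>2 - norm (cin x y)"
    have "d \<noteq> 0" using \<open>(norm u)\<^sup>2 \<noteq> 0\<close> nu by (auto simp: d_def)
    have "2 * cin (c *s x) u / of_real ((norm u)\<^sup>2) = of_real (2 * d / (2 * d))"
      unfolding cu nu d_def[symmetric] by (simp only: of_real_divide of_real_mult of_real_numeral)
    hence "2 * cin (c *s x) u / of_real ((norm u)\<^sup>2) = 1"
      using \<open>d \<noteq> 0\<close> by simp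
    thus ?thesis by (simp add: V_def u_def)
  qed
  ultimately show ?thesis using lin that by (auto simp: unitary_op_def)
qed


section \<open>Rotation invariant integration\<close>

lemma nn_integral_lborel_plus:
  fixes f :: "'a::euclidean_space \<Rightarrow> ennreal"
  assumes [measurable]: "f \<in> borel_measurable borel"
  shows "(\<integral>\<^sup>+x. f (c + x) \<partial>lborel) = (\<integral>\<^sup>+x. f x \<partial>lborel)"
  by (subst (2) lborel_distr_plus[of c, symmetric]) (simp add: nn_integral_distr)

lemma nn_integral_lborel_minus:
  fixes f :: "'a::euclidean_space \<Rightarrow> ennreal"
  assumes [measurable]: "f \<in> borel_measurable borel"
  shows "(\<integral>\<^sup>+x. f (c - x) \<partial>lborel) = (\<integral>\<^sup>+x. f x \<partial>lborel)"
  by (subst (2) lborel_affine[of "-1" c]) (simp_all add: nn_integral_density nn_integral_distr)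

text \<open>Lebesgue measure and its image under an isometry are both translation invariant, so Fubini
  makes them proportional; comparing the unit ball gives the factor one.\<close>

lemma nn_integral_lborel_isometry:
  fixes V :: "'a::euclidean_space \<Rightarrow> 'a"
  assumes lin: "linear V" and iso: "\<And>x. norm (V x) = norm x"
    and [measurable]: "f \<in> borel_measurable borel"
  shows "(\<integral>\<^sup>+x. f (V x) \<partial>lborel) = (\<integral>\<^sup>+x. f x \<partial>lborel)"
proof -
  have [measurable]: "V \<in> borel \<rightarrow>\<^sub>M borel"
    using lin by (intro borel_measurable_continuous_onI linear_continuous_on)
      (simp add: linear_conv_bounded_linear)
  have "inj V" using lin iso by (metis linear_injective_0 norm_eq_zero)
  hence surj: "surj V" using lin linear_injective_imp_surjective by blast
  define k :: "'a \<Rightarrow> ennreal" where "k = indicator (ball 0 1)"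
  have [measurable]: "k \<in> borel_measurable borel" unfolding k_def by (intro borel_measurable_indicator) simp
  have "(\<integral>\<^sup>+x. f (V x) \<partial>lborel) * (\<integral>\<^sup>+y. k y \<partial>lborel)
      = (\<integral>\<^sup>+x. f (V x) * (\<integral>\<^sup>+y. k (V x + y) \<partial>lborel) \<partial>lborel)"
    by (simp add: nn_integral_lborel_plus nn_integral_multc)
  also have "\<dots> = (\<integral>\<^sup>+x. \<integral>\<^sup>+y. f (V x) * k (V x + y) \<partial>lborel \<partial>lborel)"
    by (simp add: nn_integral_cmult)
  also have "\<dots> = (\<integral>\<^sup>+y. \<integral>\<^sup>+x. f (V x) * k (V x + y) \<partial>lborel \<partial>lborel)"
    by (rule lborel_pair.Fubini') measurable
  also have "\<dots> = (\<integral>\<^sup>+y. \<integral>\<^sup>+x. f (V x - y) * k (V x) \<partial>lborel \<partial>lborel)"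
  proof (rule nn_integral_cong)
    fix y :: 'a
    obtain w where w: "V w = y" using surj by (metis surjD)
    have "(\<integral>\<^sup>+x. f (V x) * k (V x + y) \<partial>lborel)
        = (\<integral>\<^sup>+x. f (V (- w + x)) * k (V (- w + x) + y) \<partial>lborel)"
      by (rule nn_integral_lborel_plus[symmetric]) measurable
    also have "\<dots> = (\<integral>\<^sup>+x. f (V x - y) * k (V x) \<partial>lborel)"
      by (simp add: linear_diff[OF lin] w)
    finally show "(\<integral>\<^sup>+x. f (V x) * k (V x + y) \<partial>lborel) = (\<integral>\<^sup>+x. f (V x - y) * k (V x) \<partial>lborel)" .
  qed
  also have "\<dots> = (\<integral>\<^sup>+x. \<integral>\<^sup>+y. f (V x - y) * k (V x) \<partial>lborel \<partial>lborel)"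
    by (rule lborel_pair.Fubini') measurable
  also have "\<dots> = (\<integral>\<^sup>+x. (\<integral>\<^sup>+y. f y \<partial>lborel) * k (V x) \<partial>lborel)"
    by (simp add: nn_integral_multc nn_integral_lborel_minus)
  also have "\<dots> = (\<integral>\<^sup>+y. f y \<partial>lborel) * (\<integral>\<^sup>+y. k y \<partial>lborel)"
    using iso by (simp add: nn_integral_cmult k_def indicator_def)
  finally have eq: "(\<integral>\<^sup>+x. f (V x) \<partial>lborel) * (\<integral>\<^sup>+y. k y \<partial>lborel)
      = (\<integral>\<^sup>+y. f y \<partial>lborel) * (\<integral>\<^sup>+y. k y \<partial>lborel)" .
  have "(\<integral>\<^sup>+y. k y \<partial>lborel) = emeasure lborel (ball (0::'a) 1)" by (simp add: k_def)
  moreover have "emeasure lborel (ball (0::'a) 1) < \<infinity>" by (rule emeasure_lborel_ball_finite)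
  moreover have "emeasure lborel (ball (0::'a) 1) \<noteq> 0"
    using unit_ball_vol_pos[of "real DIM('a)"] by (simp add: emeasure_ball del: unit_ball_vol_pos)
  ultimately show ?thesis
    using eq by (auto simp: mult.commute[of _ "emeasure _ _"] ennreal_mult_cancel_left)
qed


lemma emeasure_lborel_affine:
  fixes B :: "'a::euclidean_space set"
  assumes "c \<noteq> 0" and [measurable]: "B \<in> sets borel"
  shows "emeasure lborel B = ennreal (\<bar>c\<bar> ^ DIM('a)) * emeasure lborel {x. t + c *\<^sub>R x \<in> B}"
proof -
  have "emeasure lborel B = emeasure (density (distr lborel borel (\<lambda>x. t + c *\<^sub>R x)) (\<lambda>_. \<bar>c\<bar>^DIM('a))) B"
    using lborel_affine[of c t] assms by simp
  also have "\<dots> = ennreal (\<bar>c\<bar> ^ DIM('a)) * emeasure lborel {x. t + c *\<^sub>R x \<in> B}"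
    by (simp add: emeasure_density nn_integral_cmult emeasure_distr vimage_def)
  finally show ?thesis .
qed

subsection \<open>Integration over the sphere\<close>

abbreviation (input) ball_measure :: "(complex ^ 'N::finite) measure" where
  "ball_measure \<equiv> uniform_measure lborel (ball 0 1)"

lemma emeasure_unit_ball:
  "emeasure lborel (ball (0::'a::euclidean_space) 1) \<noteq> 0"
  "emeasure lborel (ball (0::'a::euclidean_space) 1) \<noteq> \<infinity>"
  "emeasure lborel (ball (0::'a::euclidean_space) 1) \<noteq> \<top>"
proof -
  show "emeasure lborel (ball (0::'a::euclidean_space) 1) \<noteq> 0"
    using unit_ball_vol_pos[of "real DIM('a)"] by (simp add: emeasure_ball del: unit_ball_vol_pos)
  show 1: "emeasure lborel (ball (0::'a::euclidean_space) 1) \<noteq> \<infinity>" by (simp add: emeasure_ball)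
  thus "emeasure lborel (ball (0::'a::euclidean_space) 1) \<noteq> \<top>" by simp
qed

lemma prob_space_ball_measure: "prob_space (ball_measure :: (complex ^ 'N::finite) measure)"
  using emeasure_unit_ball by (intro prob_space_uniform_measure) auto

lemma measurable_sgn_vec [measurable]: "(sgn :: complex ^ 'N::finite \<Rightarrow> _) \<in> borel \<rightarrow>\<^sub>M borel"
  unfolding sgn_div_norm by measurable

lemma space_sphere_measure [simp]: "space (sphere_measure :: (complex ^ 'N::finite) measure) = sphere 0 1"
  by (simp add: sphere_measure_def space_restrict_space)

lemma sets_sphere_measure: "sets (sphere_measure :: (complex ^ 'N::finite) measure) = sets (restrict_space borel (sphere 0 1))"
  by (simp add: sphere_measure_def sets_restrict_space)

lemma measurable_from_borel_sphere:
  assumes "f \<in> borel \<rightarrow>\<^sub>M M"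
  shows "f \<in> (sphere_measure :: (complex ^ 'N::finite) measure) \<rightarrow>\<^sub>M M"
  using measurable_restrict_space1[OF assms, of "sphere 0 1"]
  by (simp cong: measurable_cong_sets add: sets_sphere_measure)

lemma measurable_id_sphere: "(\<lambda>x. x) \<in> (sphere_measure :: (complex ^ 'N::finite) measure) \<rightarrow>\<^sub>M borel"
  by (rule measurable_from_borel_sphere) simp

lemma measurable_continuous_on_sphere:
  fixes f :: "complex ^ 'N::finite \<Rightarrow> 'b::topological_space"
  assumes "continuous_on (sphere 0 1) f"
  shows "f \<in> borel_measurable sphere_measure"
  using borel_measurable_continuous_on_restrict[OF assms]
  by (simp cong: measurable_cong_sets add: sets_sphere_measure)

lemma measurable_ball_measure:
  "f \<in> borel \<rightarrow>\<^sub>M M \<Longrightarrow> f \<in> (ball_measure :: (complex ^ 'N::finite) measure) \<rightarrow>\<^sub>M M"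
  by (simp cong: measurable_cong_sets)

lemma AE_ball_measure_nonzero: "AE x in (ball_measure :: (complex ^ 'N::finite) measure). x \<noteq> 0"
proof (rule AE_uniform_measureI)
  show "AE x in lborel. x \<in> ball (0::complex ^ 'N) 1 \<longrightarrow> x \<noteq> 0"
    by (rule AE_I[where N="{0}"]) auto
qed simp

lemma nn_integral_sphere_measure:
  fixes h :: "complex ^ 'N::finite \<Rightarrow> ennreal"
  assumes [measurable]: "h \<in> borel_measurable borel"
  shows "(\<integral>\<^sup>+\<zeta>. h \<zeta> \<partial>sphere_measure) = (\<integral>\<^sup>+x. h (sgn x) \<partial>ball_measure)"
proof -
  have [measurable]: "sphere (0::complex ^ 'N) 1 \<in> sets borel" by (intro borel_closed) simp
  have "(\<integral>\<^sup>+\<zeta>. h \<zeta> \<partial>sphere_measure) = (\<integral>\<^sup>+x. h (sgn x) * indicator (sphere 0 1) (sgn x) \<partial>ball_measure)"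
    unfolding sphere_measure_def
    by (subst nn_integral_restrict_space, simp) (rule nn_integral_distr; measurable)
  also have "\<dots> = (\<integral>\<^sup>+x. h (sgn x) \<partial>ball_measure)"
    using AE_ball_measure_nonzero
    by (intro nn_integral_cong_AE, eventually_elim) (simp add: norm_sgn)
  finally show ?thesis .
qed

lemma prob_space_sphere_measure: "prob_space (sphere_measure :: (complex ^ 'N::finite) measure)"
proof
  interpret prob_space "ball_measure :: (complex ^ 'N) measure" by (rule prob_space_ball_measure)
  have "emeasure sphere_measure (space sphere_measure :: (complex ^ 'N) set) = (\<integral>\<^sup>+\<zeta>. 1 \<partial>(sphere_measure :: (complex ^ 'N) measure))"
    by simp
  also have "\<dots> = 1" by (subst nn_integral_sphere_measure) (simp_all add: emeasure_space_1[simplified])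
  finally show "emeasure sphere_measure (space sphere_measure :: (complex ^ 'N) set) = 1" .
qed

lemma nn_integral_sphere_unitary:
  fixes h :: "complex ^ 'N::finite \<Rightarrow> ennreal"
  assumes V: "unitary_op V" and h [measurable]: "h \<in> borel_measurable borel"
  shows "(\<integral>\<^sup>+\<zeta>. h (V \<zeta>) \<partial>sphere_measure) = (\<integral>\<^sup>+\<zeta>. h \<zeta> \<partial>sphere_measure)"
proof -
  have lin: "linear V" and iso: "norm (V x) = norm x" for x
    using V by (auto simp: unitary_op_def clinear_imp_linear)
  have [measurable]: "V \<in> borel \<rightarrow>\<^sub>M borel"
    using lin by (intro borel_measurable_continuous_onI linear_continuous_on)
      (simp add: linear_conv_bounded_linear)
  have [measurable]: "ball (0::complex ^ 'N) 1 \<in> sets borel" by simp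
  have sgnV: "V (sgn x) = sgn (V x)" for x
    by (simp add: sgn_div_norm linear_scale[OF lin] iso)
  have "(\<integral>\<^sup>+\<zeta>. h (V \<zeta>) \<partial>sphere_measure) = (\<integral>\<^sup>+x. h (sgn (V x)) \<partial>ball_measure)"
    by (subst nn_integral_sphere_measure) (simp_all add: sgnV)
  also have "\<dots> = (\<integral>\<^sup>+x. h (sgn (V x)) * indicator (ball 0 1) (V x) \<partial>lborel) / emeasure lborel (ball (0::complex ^ 'N) 1)"
    by (subst nn_integral_uniform_measure) (simp_all add: indicator_def iso)
  also have "(\<integral>\<^sup>+x. h (sgn (V x)) * indicator (ball 0 1) (V x) \<partial>lborel) = (\<integral>\<^sup>+x. h (sgn x) * indicator (ball 0 1) x \<partial>lborel)"
    by (rule nn_integral_lborel_isometry[OF lin iso]) measurable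
  also have "\<dots> / emeasure lborel (ball (0::complex ^ 'N) 1) = (\<integral>\<^sup>+x. h (sgn x) \<partial>ball_measure)"
    by (subst nn_integral_uniform_measure) simp_all
  finally show ?thesis by (simp add: nn_integral_sphere_measure)
qed

lemma emeasure_cone_ball:
  fixes A :: "(complex ^ 'N::finite) set"
  assumes [measurable]: "A \<in> sets borel" and r: "0 < r"
  shows "emeasure lborel {a. norm a < r \<and> sgn a \<in> A}
    = ennreal (r ^ DIM(complex ^ 'N)) * emeasure lborel {a. norm a < 1 \<and> sgn a \<in> A}"
proof -
  have "{x. (0::complex ^ 'N) + r *\<^sub>R x \<in> {a. norm a < r \<and> sgn a \<in> A}} = {a. norm a < 1 \<and> sgn a \<in> A}"
    using r by (auto simp: sgn_scaleR)
  moreover have "{a::complex ^ 'N. norm a < r \<and> sgn a \<in> A} \<in> sets borel" by measurable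
  ultimately show ?thesis
    using emeasure_lborel_affine[of r "{a. norm a < r \<and> sgn a \<in> A}" 0] r by simp
qed

text \<open>Modulus and direction of a uniformly distributed point of the ball are independent, because the
  volume of a truncated cone depends on the truncation radius \<open>r\<close> only through the factor \<open>r ^ DIM\<close>.\<close>

lemma modulus_direction_product:
  "distr ball_measure (borel \<Otimes>\<^sub>M borel) (\<lambda>a::complex ^ 'N::finite. (norm a, sgn a))
     = distr ball_measure borel (norm :: complex ^ 'N \<Rightarrow> real) \<Otimes>\<^sub>M distr ball_measure borel sgn"
proof (rule pair_measure_eqI[symmetric])
  interpret B: prob_space "ball_measure :: (complex ^ 'N) measure" by (rule prob_space_ball_measure)
  let ?b = "emeasure lborel (ball (0::complex ^ 'N) 1)"
  have "prob_space (distr ball_measure borel (norm :: complex ^ 'N \<Rightarrow> real))"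
    by (intro B.prob_space_distr measurable_ball_measure) measurable
  thus "sigma_finite_measure (distr ball_measure borel (norm :: complex ^ 'N \<Rightarrow> real))"
    by (rule prob_space_imp_sigma_finite)
  have "prob_space (distr ball_measure borel (sgn :: complex ^ 'N \<Rightarrow> complex ^ 'N))"
    by (intro B.prob_space_distr measurable_ball_measure) measurable
  thus "sigma_finite_measure (distr ball_measure borel (sgn :: complex ^ 'N \<Rightarrow> complex ^ 'N))"
    by (rule prob_space_imp_sigma_finite)
  show "sets (distr ball_measure borel (norm :: complex ^ 'N \<Rightarrow> real) \<Otimes>\<^sub>M distr ball_measure borel (sgn :: complex ^ 'N \<Rightarrow> _))
    = sets (distr ball_measure (borel \<Otimes>\<^sub>M borel) (\<lambda>a::complex ^ 'N. (norm a, sgn a)))"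
    by (simp cong: sets_pair_measure_cong)
  fix R :: "real set" and A :: "(complex ^ 'N) set"
  assume "R \<in> sets (distr ball_measure borel (norm :: complex ^ 'N \<Rightarrow> real))"
    and "A \<in> sets (distr ball_measure borel (sgn :: complex ^ 'N \<Rightarrow> _))"
  hence [measurable]: "R \<in> sets borel" "A \<in> sets borel" by simp_all
  define \<mu> :: "(complex ^ 'N) measure" where "\<mu> = ball_measure"
  have [simp]: "sets \<mu> = sets borel" "space \<mu> = UNIV" by (simp_all add: \<mu>_def)
  have [measurable_cong]: "sets \<mu> = sets borel" by simp
  define p where "p = emeasure \<mu> {a. sgn a \<in> A}"
  have \<mu>: "emeasure \<mu> X = emeasure lborel {a. norm a < 1 \<and> a \<in> X} / ?b" if "X \<in> sets borel" for X
    using that by (simp add: \<mu>_def emeasure_uniform_measure) (simp add: Int_def)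
  have cone: "emeasure \<mu> {a. norm a < r \<and> sgn a \<in> B} = ennreal (max 0 (min r 1) ^ DIM(complex ^ 'N)) * emeasure \<mu> {a. sgn a \<in> B}"
    if [measurable]: "B \<in> sets borel" for r B
  proof (cases "r \<le> 0")
    case True
    hence "{a::complex ^ 'N. norm a < r \<and> sgn a \<in> B} = {}"
      using norm_ge_zero by (fastforce dest: less_le_trans)
    moreover have "max 0 (min r 1) = 0" using True by simp
    ultimately show ?thesis by (simp only: emeasure_empty) (simp add: zero_power)
  next
    case False
    define s where "s = min r 1"
    have s: "0 < s" "max 0 (min r 1) = s" using False by (auto simp: s_def)
    have "emeasure \<mu> {a. norm a < r \<and> sgn a \<in> B} = emeasure lborel {a. norm a < s \<and> sgn a \<in> B} / ?b"
      by (subst \<mu>) (auto simp: s_def intro!: arg_cong2[where f="(/)"] arg_cong2[where f=emeasure])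
    also have "\<dots> = ennreal (s ^ DIM(complex ^ 'N)) * (emeasure lborel {a. norm a < 1 \<and> sgn a \<in> B} / ?b)"
      by (simp only: emeasure_cone_ball[OF that s(1)] ennreal_times_divide)
    also have "emeasure lborel {a. norm a < 1 \<and> sgn a \<in> B} / ?b = emeasure \<mu> {a. sgn a \<in> B}"
      by (subst \<mu>) simp_all
    finally show ?thesis using s by simp
  qed
  \<comment> \<open>For fixed \<open>A\<close>, both sides of the product formula are finite measures of \<open>R\<close>; they agree on
    half-lines.\<close>
  define M1 where "M1 = distr (density \<mu> (indicator {a. sgn a \<in> A})) borel norm"
  define M2 where "M2 = scale_measure p (distr \<mu> borel norm)"
  have M1: "emeasure M1 Y = emeasure \<mu> {a. norm a \<in> Y \<and> sgn a \<in> A}" if [measurable]: "Y \<in> sets borel" for Y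
  proof -
    have "emeasure M1 Y = emeasure (density \<mu> (indicator {a. sgn a \<in> A})) {a. norm a \<in> Y}"
      by (simp add: M1_def emeasure_distr vimage_def)
    also have "\<dots> = (\<integral>\<^sup>+a. indicator {a. sgn a \<in> A} a * indicator {a. norm a \<in> Y} a \<partial>\<mu>)"
      by (rule emeasure_density) measurable
    also have "\<dots> = (\<integral>\<^sup>+a. indicator {a. norm a \<in> Y \<and> sgn a \<in> A} a \<partial>\<mu>)"
      by (intro nn_integral_cong) (auto simp: indicator_def)
    finally have "emeasure M1 Y = (\<integral>\<^sup>+a. indicator {a. norm a \<in> Y \<and> sgn a \<in> A} a \<partial>\<mu>)" .
    moreover have "{a. norm a \<in> Y \<and> sgn a \<in> A} \<in> sets \<mu>" by measurable
    ultimately show ?thesis by simp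
  qed
  have M2: "emeasure M2 Y = p * emeasure \<mu> {a. norm a \<in> Y}" if [measurable]: "Y \<in> sets borel" for Y
    by (simp add: M2_def emeasure_distr vimage_def)
  have "M1 = M2"
  proof (rule measure_eqI_generator_eq)
    show "Int_stable (range (lessThan :: real \<Rightarrow> _))"
    proof (rule Int_stableI)
      fix A B :: "real set" assume "A \<in> range lessThan" "B \<in> range lessThan"
      then obtain a b where "A = {..<a}" "B = {..<b}" by blast
      hence "A \<inter> B = {..<min a b}" by auto
      thus "A \<inter> B \<in> range lessThan" by simp
    qed
    show "range (lessThan :: real \<Rightarrow> _) \<subseteq> Pow UNIV" by simp
    show "sets M1 = sigma_sets UNIV (range lessThan)" "sets M2 = sigma_sets UNIV (range lessThan)"
      by (simp_all add: M1_def M2_def borel_Iio)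
    show "range (\<lambda>n::nat. {..<real n}) \<subseteq> range lessThan" by auto
    show "(\<Union>n::nat. {..<real n}) = UNIV" by (auto intro: reals_Archimedean2)
    show "emeasure M1 {..<real n} \<noteq> \<infinity>" for n
      by (subst M1) (simp_all add: \<mu>_def B.emeasure_eq_measure)
    show "emeasure M1 X = emeasure M2 X" if "X \<in> range lessThan" for X
    proof -
      obtain r where X: "X = {..<r}" using \<open>X \<in> range lessThan\<close> by auto
      have "emeasure \<mu> UNIV = 1" using B.emeasure_space_1 by (simp add: \<mu>_def)
      thus ?thesis using cone[of A r] cone[of UNIV r]
        by (simp add: X M1 M2 p_def mult.commute)
    qed
  qed
  hence "emeasure M1 R = emeasure M2 R" by simp
  thus "emeasure (distr ball_measure borel (norm :: complex ^ 'N \<Rightarrow> real)) R * emeasure (distr ball_measure borel sgn) A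
    = emeasure (distr ball_measure (borel \<Otimes>\<^sub>M borel) (\<lambda>a::complex ^ 'N. (norm a, sgn a))) (R \<times> A)"
    by (simp add: M1 M2 p_def emeasure_distr \<mu>_def[symmetric] vimage_def mult.commute)
qed

text \<open>Integration in polar coordinates, in the form in which it is used: against a radial weight,
  the mean of \<open>G\<close> over the ball is at most the largest of its means over the spheres.\<close>

lemma nn_integral_radial_weight_le:
  fixes m G :: "complex ^ 'N::finite \<Rightarrow> ennreal"
  assumes [measurable]: "m \<in> borel_measurable borel" "G \<in> borel_measurable borel"
    and radial: "\<And>a b. norm a = norm b \<Longrightarrow> m a = m b"
    and G: "\<And>r. 0 < r \<Longrightarrow> r < 1 \<Longrightarrow> (\<integral>\<^sup>+\<zeta>. G (r *\<^sub>R \<zeta>) \<partial>sphere_measure) \<le> C"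
  shows "(\<integral>\<^sup>+a\<in>ball 0 1. m a * G a \<partial>lborel) \<le> C * (\<integral>\<^sup>+a\<in>ball 0 1. m a \<partial>lborel)"
proof -
  interpret B: prob_space "ball_measure :: (complex ^ 'N) measure" by (rule prob_space_ball_measure)
  interpret N: prob_space "distr ball_measure borel (norm :: complex ^ 'N \<Rightarrow> real)"
    by (intro B.prob_space_distr measurable_ball_measure) measurable
  interpret S: prob_space "distr ball_measure borel (sgn :: complex ^ 'N \<Rightarrow> _)"
    by (intro B.prob_space_distr measurable_ball_measure measurable_sgn_vec)
  have [measurable]: "ball (0::complex ^ 'N) 1 \<in> sets borel" by simp
  let ?b = "emeasure lborel (ball (0::complex ^ 'N) 1)"
  obtain e :: "complex ^ 'N" where e: "norm e = 1"
    using vector_choose_size[of 1] by auto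
  have mb: "m b = m (norm b *\<^sub>R e)" for b by (rule radial) (simp add: e)
  have "(\<integral>\<^sup>+a. m a * G a \<partial>ball_measure)
     = (\<integral>\<^sup>+a. (\<lambda>(r, \<zeta>). m (r *\<^sub>R e) * G (r *\<^sub>R \<zeta>)) (norm a, sgn a) \<partial>ball_measure)"
  proof (intro nn_integral_cong)
    fix a :: "complex ^ 'N"
    have "norm a *\<^sub>R sgn a = a" by (cases "a = 0") (simp_all add: sgn_div_norm)
    thus "m a * G a = (\<lambda>(r, \<zeta>). m (r *\<^sub>R e) * G (r *\<^sub>R \<zeta>)) (norm a, sgn a)"
      by (simp flip: mb)
  qed
  also have "\<dots> = (\<integral>\<^sup>+x. (\<lambda>(r, \<zeta>). m (r *\<^sub>R e) * G (r *\<^sub>R \<zeta>)) x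
       \<partial>distr ball_measure (borel \<Otimes>\<^sub>M borel) (\<lambda>a. (norm a, sgn a)))"
    by (subst nn_integral_distr) simp_all
  also have "\<dots> = (\<integral>\<^sup>+r. \<integral>\<^sup>+\<zeta>. m (r *\<^sub>R e) * G (r *\<^sub>R \<zeta>) \<partial>distr ball_measure borel sgn \<partial>distr ball_measure borel (norm :: complex ^ 'N \<Rightarrow> real))"
    unfolding modulus_direction_product
    by (subst S.nn_integral_fst[symmetric]) (simp_all cong: measurable_cong_sets sets_pair_measure_cong)
  also have "\<dots> = (\<integral>\<^sup>+b. \<integral>\<^sup>+\<zeta>. m b * G (norm b *\<^sub>R \<zeta>) \<partial>sphere_measure \<partial>ball_measure)"
    by (subst nn_integral_distr) (simp_all add: nn_integral_distr nn_integral_sphere_measure flip: mb)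
  also have "\<dots> = (\<integral>\<^sup>+b. m b * (\<integral>\<^sup>+\<zeta>. G (norm b *\<^sub>R \<zeta>) \<partial>sphere_measure) \<partial>ball_measure)"
    by (intro nn_integral_cong nn_integral_cmult measurable_from_borel_sphere) measurable
  also have "\<dots> \<le> (\<integral>\<^sup>+b. m b * C \<partial>ball_measure)"
  proof (rule nn_integral_mono_AE)
    have "AE b in (ball_measure :: (complex ^ 'N) measure). b \<in> ball 0 1"
      by (rule AE_uniform_measureI) simp_all
    thus "AE b in ball_measure. m b * (\<integral>\<^sup>+\<zeta>. G (norm b *\<^sub>R \<zeta>) \<partial>sphere_measure) \<le> m b * C"
      using AE_ball_measure_nonzero
      by eventually_elim (auto intro!: mult_left_mono G)
  qed
  also have "\<dots> = C * (\<integral>\<^sup>+b. m b \<partial>ball_measure)"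
    by (subst nn_integral_multc) (simp_all add: mult.commute)
  finally have "(\<integral>\<^sup>+a\<in>ball 0 1. m a * G a \<partial>lborel) / ?b \<le> C * (\<integral>\<^sup>+a\<in>ball 0 1. m a \<partial>lborel) / ?b"
    by (simp add: nn_integral_uniform_measure ennreal_times_divide)
  hence "(\<integral>\<^sup>+a\<in>ball 0 1. m a * G a \<partial>lborel) / ?b * ?b \<le> C * (\<integral>\<^sup>+a\<in>ball 0 1. m a \<partial>lborel) / ?b * ?b"
    by (rule mult_right_mono) simp
  moreover have "x / ?b * ?b = x" for x
    using emeasure_unit_ball(1,3)[where 'a="complex ^ 'N"]
    by (metis ennreal_mult_divide_eq ennreal_times_divide mult.commute)
  ultimately show ?thesis by simp
qed


section \<open>Jensen and Minkowski inequalities for means over the sphere\<close>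

text \<open>The graph of \<open>x \<mapsto> x\<^sup>p\<close> lies above its tangent at \<open>h\<close>. Integrated, this is Jensen's inequality, also
  for integrals that are infinite.\<close>

lemma powr_tangent_le:
  fixes x h p :: real
  assumes "1 \<le> p" "0 \<le> x" "0 \<le> h"
  shows "p * h powr (p - 1) * x \<le> x powr p + (p - 1) * h powr p"
proof (cases "x = 0 \<or> h = 0")
  case False
  hence "(x powr p) powr (1 / p) * (h powr p) powr (1 - 1 / p) \<le> 1 / p * x powr p + (1 - 1 / p) * h powr p"
    using assms by (intro Youngs_inequality_0) auto
  moreover have "(x powr p) powr (1 / p) = x" "(h powr p) powr (1 - 1 / p) = h powr (p - 1)"
    using assms False by (simp_all add: powr_powr right_diff_distrib)
  ultimately have "p * (x * h powr (p - 1)) \<le> p * (1 / p * x powr p + (1 - 1 / p) * h powr p)"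
    using assms by (intro mult_left_mono) auto
  also have "\<dots> = x powr p + (p - 1) * h powr p"
    using assms by (simp add: field_simps)
  finally show ?thesis by (simp add: mult_ac)
qed (use assms in auto)

lemma powr_nn_integral_le:
  fixes u :: "'k \<Rightarrow> real"
  assumes "prob_space P" and [measurable]: "u \<in> borel_measurable P"
    and u: "\<And>k. 0 \<le> u k" and h: "0 \<le> h" "ennreal h \<le> (\<integral>\<^sup>+k. u k \<partial>P)" and p: "1 \<le> p"
  shows "ennreal (h powr p) \<le> (\<integral>\<^sup>+k. ennreal (u k powr p) \<partial>P)"
proof -
  interpret prob_space P by fact
  define c where "c = p * h powr (p - 1)"
  have c: "0 \<le> c" using p by (simp add: c_def)
  have ch: "c * h = (p - 1) * h powr p + h powr p"
  proof (cases "h = 0")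
    case False
    hence "h powr (p - 1) * h = h powr p"
      using h by (simp add: powr_diff)
    thus ?thesis by (simp add: c_def algebra_simps)
  qed (use p in simp)
  have "ennreal ((p - 1) * h powr p) + ennreal (h powr p) = ennreal c * ennreal h"
    using p c h by (simp add: ch flip: ennreal_mult ennreal_plus)
  also have "\<dots> \<le> ennreal c * (\<integral>\<^sup>+k. u k \<partial>P)"
    by (intro mult_left_mono h) simp
  also have "\<dots> = (\<integral>\<^sup>+k. ennreal (c * u k) \<partial>P)"
    using c u by (simp add: ennreal_mult nn_integral_cmult)
  also have "\<dots> \<le> (\<integral>\<^sup>+k. ennreal ((p - 1) * h powr p) + ennreal (u k powr p) \<partial>P)"
  proof (rule nn_integral_mono)
    fix k
    have "c * u k \<le> (p - 1) * h powr p + u k powr p"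
      using powr_tangent_le[OF p u h(1), of k] by (simp add: c_def)
    thus "ennreal (c * u k) \<le> ennreal ((p - 1) * h powr p) + ennreal (u k powr p)"
      using p by (simp flip: ennreal_plus add: ennreal_leI)
  qed
  also have "\<dots> = ennreal ((p - 1) * h powr p) + (\<integral>\<^sup>+k. ennreal (u k powr p) \<partial>P)"
    by (simp add: nn_integral_add emeasure_space_1)
  finally show ?thesis by (simp add: ennreal_add_left_cancel_le)
qed

text \<open>The norm in \<open>L\<^sup>p(\<sigma>)\<close> is at most \<open>c\<close>, written without a root.\<close>

definition mean_le :: "real \<Rightarrow> (complex ^ 'N::finite \<Rightarrow> complex) \<Rightarrow> real \<Rightarrow> bool" where
  "mean_le p h c \<longleftrightarrow> 0 \<le> c \<and>
     (\<integral>\<^sup>+\<zeta>. ennreal (norm (h \<zeta>) powr p) \<partial>sphere_measure) \<le> ennreal (c powr p)"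

lemma mean_le_mono:
  assumes "mean_le p g c" "c \<le> d" "0 \<le> p" "\<And>\<zeta>. norm \<zeta> = 1 \<Longrightarrow> norm (h \<zeta>) \<le> norm (g \<zeta>)"
  shows "mean_le p h d"
proof -
  have "(\<integral>\<^sup>+\<zeta>. ennreal (norm (h \<zeta>) powr p) \<partial>sphere_measure)
      \<le> (\<integral>\<^sup>+\<zeta>. ennreal (norm (g \<zeta>) powr p) \<partial>sphere_measure)"
    using assms by (intro nn_integral_mono ennreal_leI powr_mono2) auto
  also have "\<dots> \<le> ennreal (c powr p)" using assms by (simp add: mean_le_def)
  also have "\<dots> \<le> ennreal (d powr p)"
    using assms by (intro ennreal_leI powr_mono2) (auto simp: mean_le_def)
  finally show ?thesis using assms by (auto simp: mean_le_def)
qed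

lemma mean_le_cong:
  assumes "\<And>\<zeta>. norm \<zeta> = 1 \<Longrightarrow> norm (h \<zeta>) = norm (g \<zeta>)"
  shows "mean_le p h c \<longleftrightarrow> mean_le p g c"
proof -
  have "(\<integral>\<^sup>+\<zeta>. ennreal (norm (h \<zeta>) powr p) \<partial>sphere_measure)
      = (\<integral>\<^sup>+\<zeta>. ennreal (norm (g \<zeta>) powr p) \<partial>sphere_measure)"
    using assms by (intro nn_integral_cong) auto
  thus ?thesis by (simp add: mean_le_def)
qed

lemma mean_le_bounded:
  assumes "0 \<le> c" "0 \<le> p" "\<And>\<zeta>. norm \<zeta> = 1 \<Longrightarrow> norm (h \<zeta>) \<le> c"
  shows "mean_le p h c"
proof -
  interpret prob_space "sphere_measure :: (complex ^ 'a) measure" by (rule prob_space_sphere_measure)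
  have "(\<integral>\<^sup>+\<zeta>. ennreal (norm (h \<zeta>) powr p) \<partial>sphere_measure)
      \<le> (\<integral>\<^sup>+\<zeta>. ennreal (c powr p) \<partial>(sphere_measure :: (complex ^ 'a) measure))"
    using assms by (intro nn_integral_mono ennreal_leI powr_mono2) auto
  also have "\<dots> = ennreal (c powr p)" using emeasure_space_1 by simp
  finally show ?thesis using assms by (simp add: mean_le_def)
qed

lemma mean_le_limit:
  assumes "\<And>e. 0 < e \<Longrightarrow> mean_le p h (c + e)" "0 \<le> c" "0 < p"
  shows "mean_le p h c"
proof -
  let ?I = "\<integral>\<^sup>+\<zeta>. ennreal (norm (h \<zeta>) powr p) \<partial>sphere_measure"
  have "(\<lambda>n. ennreal ((c + inverse (real (Suc n))) powr p)) \<longlonglongrightarrow> ennreal ((c + 0) powr p)"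
    using assms(2,3) LIMSEQ_inverse_real_of_nat
    by (intro tendsto_ennrealI tendsto_powr2 tendsto_add tendsto_const) auto
  moreover have "?I \<le> ennreal ((c + inverse (real (Suc n))) powr p)" for n
    using assms(1)[of "inverse (real (Suc n))"] by (simp add: mean_le_def)
  ultimately have "?I \<le> ennreal ((c + 0) powr p)"
    by (intro LIMSEQ_le_const[of "\<lambda>n. ennreal ((c + inverse (real (Suc n))) powr p)"]) blast+
  thus ?thesis using assms by (simp add: mean_le_def)
qed

text \<open>Minkowski's integral inequality. For a probability measure as weight, it follows from Jensen's
  inequality and Fubini.\<close>

lemma mean_le_integral:
  fixes u :: "'k \<Rightarrow> complex ^ 'N::finite \<Rightarrow> real"
  assumes P: "prob_space P" and p: "1 \<le> p" and C: "0 \<le> C" "0 \<le> c"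
    and u [measurable]: "(\<lambda>(k, \<zeta>). u k \<zeta>) \<in> borel_measurable (P \<Otimes>\<^sub>M sphere_measure)"
    and u0: "\<And>k \<zeta>. 0 \<le> u k \<zeta>"
    and uc: "\<And>k. k \<in> space P \<Longrightarrow> (\<integral>\<^sup>+\<zeta>. ennreal (u k \<zeta> powr p) \<partial>sphere_measure) \<le> ennreal (c powr p)"
    and h: "\<And>\<zeta>. norm \<zeta> = 1 \<Longrightarrow> ennreal (norm (h \<zeta>)) \<le> ennreal C * (\<integral>\<^sup>+k. u k \<zeta> \<partial>P)"
  shows "mean_le p h (C * c)"
proof -
  interpret P: prob_space P by fact
  interpret S: prob_space "sphere_measure :: (complex ^ 'N) measure" by (rule prob_space_sphere_measure)
  interpret pair_sigma_finite P "sphere_measure :: (complex ^ 'N) measure" ..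
  have sec [measurable]: "(\<lambda>k. u k \<zeta>) \<in> borel_measurable P" if "norm \<zeta> = 1" for \<zeta>
    using measurable_compose[OF measurable_Pair2' u, of \<zeta>] that by simp
  have "(\<integral>\<^sup>+\<zeta>. ennreal (norm (h \<zeta>) powr p) \<partial>sphere_measure)
      \<le> (\<integral>\<^sup>+\<zeta>. (\<integral>\<^sup>+k. ennreal ((C * u k \<zeta>) powr p) \<partial>P) \<partial>sphere_measure)"
  proof (rule nn_integral_mono)
    fix \<zeta> :: "complex ^ 'N" assume "\<zeta> \<in> space sphere_measure"
    hence z: "norm \<zeta> = 1" by simp
    note [measurable] = sec[OF z]
    have "ennreal (norm (h \<zeta>)) \<le> (\<integral>\<^sup>+k. ennreal (C * u k \<zeta>) \<partial>P)"
      using h[OF z] C u0 by (simp add: ennreal_mult nn_integral_cmult)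
    thus "ennreal (norm (h \<zeta>) powr p) \<le> (\<integral>\<^sup>+k. ennreal ((C * u k \<zeta>) powr p) \<partial>P)"
      using C u0 p by (intro powr_nn_integral_le P) auto
  qed
  also have "\<dots> = (\<integral>\<^sup>+k. (\<integral>\<^sup>+\<zeta>. ennreal ((C * u k \<zeta>) powr p) \<partial>sphere_measure) \<partial>P)"
    by (rule Fubini') measurable
  also have "\<dots> \<le> (\<integral>\<^sup>+k. ennreal ((C * c) powr p) \<partial>P)"
  proof (rule nn_integral_mono)
    fix k assume k: "k \<in> space P"
    have [measurable]: "u k \<in> borel_measurable sphere_measure"
      using measurable_compose[OF measurable_Pair1' u, of k] k by simp
    have "(\<integral>\<^sup>+\<zeta>. ennreal ((C * u k \<zeta>) powr p) \<partial>sphere_measure)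
        = ennreal (C powr p) * (\<integral>\<^sup>+\<zeta>. ennreal (u k \<zeta> powr p) \<partial>sphere_measure)"
      using C u0 by (simp add: powr_mult ennreal_mult nn_integral_cmult)
    also have "\<dots> \<le> ennreal (C powr p) * ennreal (c powr p)"
      by (intro mult_left_mono uc k) simp
    also have "\<dots> = ennreal ((C * c) powr p)"
      using C by (simp add: powr_mult ennreal_mult)
    finally show "(\<integral>\<^sup>+\<zeta>. ennreal ((C * u k \<zeta>) powr p) \<partial>sphere_measure) \<le> ennreal ((C * c) powr p)" .
  qed
  also have "\<dots> = ennreal ((C * c) powr p)" using P.emeasure_space_1 by simp
  finally show ?thesis using C by (simp add: mean_le_def)
qed

text \<open>Minkowski's inequality is the case of a two-point weight, with masses proportional to \<open>b\<close> and \<open>c\<close>;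
  these are first made positive.\<close>

lemma mean_le_add:
  fixes g h :: "complex ^ 'N::finite \<Rightarrow> complex"
  assumes g: "mean_le p g b" and h: "mean_le p h c" and p: "1 \<le> p"
    and [measurable]: "g \<in> borel_measurable sphere_measure" "h \<in> borel_measurable sphere_measure"
    and f: "\<And>\<zeta>. norm \<zeta> = 1 \<Longrightarrow> norm (f \<zeta>) \<le> norm (g \<zeta>) + norm (h \<zeta>)"
  shows "mean_le p f (b + c)"
proof (rule mean_le_limit)
  fix e :: real assume e: "0 < e"
  define b' c' where "b' = b + e / 2" and "c' = c + e / 2"
  have bc: "0 \<le> b" "0 \<le> c" using g h by (auto simp: mean_le_def)
  have b': "mean_le p g b'" "0 < b'"
    using e p bc by (auto simp: b'_def intro: mean_le_mono[OF g])
  have c': "mean_le p h c'" "0 < c'"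
    using e p bc by (auto simp: c'_def intro: mean_le_mono[OF h])
  define \<theta> where "\<theta> = b' / (b' + c')"
  have \<theta>: "0 \<le> \<theta>" "\<theta> \<le> 1" "(b' + c') * \<theta> = b'" "(b' + c') * (1 - \<theta>) = c'"
    using b' c' by (auto simp: \<theta>_def field_simps)
  define u where "u t \<zeta> = (if t then norm (g \<zeta>) / b' else norm (h \<zeta>) / c')" for t \<zeta>
  have scaled: "(\<integral>\<^sup>+\<zeta>. ennreal ((norm (k \<zeta>) / d) powr p) \<partial>sphere_measure) \<le> ennreal (1 powr p)"
    if k [measurable]: "k \<in> borel_measurable sphere_measure" and kd: "mean_le p k d" "0 < d"
    for k :: "complex ^ 'N \<Rightarrow> complex" and d
  proof -
    have "(\<integral>\<^sup>+\<zeta>. ennreal ((norm (k \<zeta>) / d) powr p) \<partial>sphere_measure)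
        = (\<integral>\<^sup>+\<zeta>. ennreal (inverse d powr p) * ennreal (norm (k \<zeta>) powr p) \<partial>sphere_measure)"
      using kd by (simp add: divide_inverse powr_mult ennreal_mult mult.commute)
    also have "\<dots> = ennreal (inverse d powr p) * (\<integral>\<^sup>+\<zeta>. ennreal (norm (k \<zeta>) powr p) \<partial>sphere_measure)"
      by (rule nn_integral_cmult) measurable
    also have "\<dots> \<le> ennreal (inverse d powr p) * ennreal (d powr p)"
      using kd by (intro mult_left_mono) (auto simp: mean_le_def)
    also have "\<dots> = ennreal (1 powr p)"
      using kd by (simp flip: ennreal_mult powr_mult)
    finally show ?thesis .
  qed
  have "mean_le p f ((b' + c') * 1)"
  proof (rule mean_le_integral[where P="measure_pmf (bernoulli_pmf \<theta>)" and u=u])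
    show "prob_space (measure_pmf (bernoulli_pmf \<theta>))" by (rule prob_space_measure_pmf)
    show "(\<lambda>(k, \<zeta>). u k \<zeta>) \<in> borel_measurable (measure_pmf (bernoulli_pmf \<theta>) \<Otimes>\<^sub>M sphere_measure)"
      unfolding u_def by measurable
    show "(\<integral>\<^sup>+\<zeta>. ennreal (u k \<zeta> powr p) \<partial>sphere_measure) \<le> ennreal (1 powr p)" for k
      using scaled[of g b'] scaled[of h c'] b' c' by (cases k) (simp_all add: u_def)
    show "ennreal (norm (f \<zeta>)) \<le> ennreal (b' + c') * (\<integral>\<^sup>+k. u k \<zeta> \<partial>measure_pmf (bernoulli_pmf \<theta>))"
      if z: "norm \<zeta> = 1" for \<zeta>
    proof -
      have distr: "r * (x * s + y * t) = x * (r * s) + y * (r * t)" for r x s y t :: real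
        by (simp add: algebra_simps)
      have "(\<integral>\<^sup>+k. u k \<zeta> \<partial>measure_pmf (bernoulli_pmf \<theta>))
          = ennreal (norm (g \<zeta>) / b' * \<theta> + norm (h \<zeta>) / c' * (1 - \<theta>))"
        using \<theta>(1,2) b'(2) c'(2)
        by (simp add: nn_integral_bernoulli_pmf u_def ennreal_plus del: times_divide_eq_left flip: ennreal_mult)
      also have "ennreal (b' + c') * \<dots> = ennreal ((b' + c') * (norm (g \<zeta>) / b' * \<theta> + norm (h \<zeta>) / c' * (1 - \<theta>)))"
        using \<theta> b' c' by (intro ennreal_mult[symmetric]) auto
      also have "(b' + c') * (norm (g \<zeta>) / b' * \<theta> + norm (h \<zeta>) / c' * (1 - \<theta>))
          = norm (g \<zeta>) / b' * ((b' + c') * \<theta>) + norm (h \<zeta>) / c' * ((b' + c') * (1 - \<theta>))"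
        by (rule distr)
      also have "\<dots> = norm (g \<zeta>) + norm (h \<zeta>)" using b' c' by (simp add: \<theta>)
      finally show ?thesis using ennreal_leI[OF f[OF z]] by simp
    qed
  qed (use b' c' p in \<open>auto simp: u_def\<close>)
  thus "mean_le p f (b + c + e)" by (simp add: b'_def c'_def algebra_simps)
qed (use g h p in \<open>auto simp: mean_le_def\<close>)


section \<open>One complex variable\<close>

text \<open>Integrals over \<open>[0, 1]\<close>, and over circles parametrized by it, are averages over a probability
  measure, so that the integral inequality above applies to them.\<close>

abbreviation unit_interval :: "real measure" where
  "unit_interval \<equiv> restrict_space lborel {0..1}"

lemma prob_space_unit_interval: "prob_space unit_interval"
  by (rule prob_spaceI) (simp add: emeasure_restrict_space space_restrict_space)

lemma norm_integral_le_nn_integral: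
  fixes F :: "real \<Rightarrow> complex"
  assumes "continuous_on {0..1} F"
  shows "ennreal (norm (integral {0..1} F)) \<le> (\<integral>\<^sup>+t. norm (F t) \<partial>unit_interval)"
proof -
  have int: "F integrable_on {0..1}" "(\<lambda>t. norm (F t)) integrable_on {0..1}"
    using assms by (auto intro!: integrable_continuous_real continuous_intros)
  have "norm (integral {0..1} F) \<le> integral {0..1} (\<lambda>t. norm (F t))"
    using int by (intro integral_norm_bound_integral) auto
  moreover have "(\<integral>\<^sup>+t. norm (F t) \<partial>unit_interval) = ennreal (integral {0..1} (\<lambda>t. norm (F t)))"
    using nn_integral_has_integral_lebesgue'[OF _ integrable_integral[OF int(2)]]
    by (simp add: nn_integral_restrict_space)
  ultimately show ?thesis by (simp add: ennreal_leI)
qed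

lemma norm_diff_le_nn_integral:
  fixes F F' :: "real \<Rightarrow> complex"
  assumes "\<And>t. t \<in> {0..1} \<Longrightarrow> (F has_vector_derivative F' t) (at t within {0..1})"
    and "continuous_on {0..1} F'"
  shows "ennreal (norm (F 1 - F 0)) \<le> (\<integral>\<^sup>+t. norm (F' t) \<partial>unit_interval)"
proof -
  have "(F' has_integral (F 1 - F 0)) {0..1}"
    using assms by (intro fundamental_theorem_of_calculus) auto
  thus ?thesis using norm_integral_le_nn_integral[OF assms(2)] by (simp add: integral_unique)
qed

definition circ :: "real \<Rightarrow> complex" where "circ t = exp (2 * of_real pi * \<i> * of_real t)"

lemma norm_circ [simp]: "norm (circ t) = 1"
  by (simp add: circ_def)

lemma circ_nonzero [simp]: "circ t \<noteq> 0" by (simp add: circ_def)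

lemma continuous_on_circ [continuous_intros]:
  "continuous_on A g \<Longrightarrow> continuous_on A (\<lambda>x. circ (g x))"
  unfolding circ_def by (intro continuous_intros)

lemma cauchy_circ:
  assumes "h holomorphic_on S" "open S" "cball 0 1 \<subseteq> S"
  shows "((\<lambda>t. h (circ t) / circ t ^ k) has_integral (deriv ^^ k) h 0 / fact k) {0..1}"
proof -
  have cont: "continuous_on (cball 0 1) h" and hol: "h holomorphic_on ball 0 1"
    using assms ball_subset_cball[of "0::complex" 1]
    by (meson continuous_on_subset holomorphic_on_imp_continuous_on holomorphic_on_subset order_trans)+
  have vd: "vector_derivative (circlepath 0 1) (at t) = 2 * of_real pi * \<i> * circ t" for t
    by (simp add: vector_derivative_circlepath circ_def mult_ac)
  have cp: "circlepath 0 1 t = circ t" for t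
    by (simp add: circlepath circ_def mult_ac)
  have "((\<lambda>u. h u / (u - 0) ^ Suc k) has_contour_integral (2 * pi * \<i>) / fact k * (deriv ^^ k) h 0) (circlepath 0 1)"
    by (rule Cauchy_has_contour_integral_higher_derivative_circlepath[OF cont hol]) simp
  hence "((\<lambda>t. h (circ t) / circ t ^ Suc k * (2 * of_real pi * \<i> * circ t)) has_integral
      (2 * pi * \<i>) / fact k * (deriv ^^ k) h 0) {0..1}"
    by (simp only: has_contour_integral vd cp diff_zero)
  from has_integral_mult_right[OF this, of "inverse (2 * pi * \<i>)"]
  show ?thesis by (simp add: field_simps)
qed


section \<open>Holomorphic functions of several variables\<close>

definition holo_on :: "(complex ^ 'N::finite \<Rightarrow> complex) \<Rightarrow> (complex ^ 'N) set \<Rightarrow> bool" where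
  "holo_on f S \<longleftrightarrow> (\<forall>z\<in>S. \<exists>D. Vector_Spaces.linear (*s) (*) D \<and> (f has_derivative D) (at z))"

text \<open>Derivatives are taken along complex lines, so that they come from one complex variable; for
  holomorphic \<open>f\<close> this is the value of the complex linear Frechet derivative at \<open>v\<close>.\<close>

definition dirderiv :: "(complex ^ 'N::finite \<Rightarrow> complex) \<Rightarrow> complex ^ 'N \<Rightarrow> complex ^ 'N \<Rightarrow> complex" where
  "dirderiv f v z = deriv (\<lambda>t. f (z + t *s v)) 0"

lemma clinear_functionalI:
  fixes D :: "complex ^ 'N::finite \<Rightarrow> complex"
  assumes "\<And>x y. D (x + y) = D x + D y" "\<And>c x. D (c *s x) = c * D x"
  shows "Vector_Spaces.linear (*s) (*) D"
  by unfold_locales (simp_all add: assms algebra_simps)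

lemma clinear_functionalD:
  fixes D :: "complex ^ 'N::finite \<Rightarrow> complex"
  assumes "Vector_Spaces.linear (*s) (*) D"
  shows "D (x + y) = D x + D y" "D (c *s x) = c * D x"
proof -
  interpret D: Vector_Spaces.linear "(*s)" "(*)" D by fact
  show "D (x + y) = D x + D y" "D (c *s x) = c * D x" by (rule D.add, rule D.scale)
qed

lemma clinearD:
  fixes U :: "complex ^ 'N::finite \<Rightarrow> complex ^ 'N"
  assumes "Vector_Spaces.linear (*s) (*s) U"
  shows "U (x + y) = U x + U y" "U (c *s x) = c *s U x" "U (x - y) = U x - U y" "U 0 = 0"
proof -
  interpret U: Vector_Spaces.linear "(*s)" "(*s)" U by fact
  show "U (x + y) = U x + U y" "U (c *s x) = c *s U x" "U (x - y) = U x - U y" "U 0 = 0"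
    by (rule U.add, rule U.scale, rule U.diff, rule U.zero)
qed

lemma clinear_bounded: "Vector_Spaces.linear (*s) (*s) (U :: complex ^ 'N::finite \<Rightarrow> complex ^ 'N) \<Longrightarrow> bounded_linear U"
  using clinear_imp_linear linear_conv_bounded_linear by blast

lemma bounded_linear_cscale: "bounded_linear (\<lambda>t. t *s (v :: complex ^ 'N::finite))"
proof -
  have "linear (\<lambda>t. t *s v)"
    by (rule linearI) (simp_all add: vec_eq_iff algebra_simps)
  thus ?thesis by (simp add: linear_conv_bounded_linear)
qed

lemma continuous_on_cscale [continuous_intros]:
  fixes g :: "'a::topological_space \<Rightarrow> complex ^ 'N::finite"
  assumes "continuous_on A c" "continuous_on A g"
  shows "continuous_on A (\<lambda>x. c x *s g x)"
  unfolding vector_scalar_mult_def using assms by (intro continuous_intros)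

lemma holo_on_line:
  assumes "holo_on f S" "a + t *s v \<in> S"
  shows "((\<lambda>t. f (a + t *s v)) has_field_derivative dirderiv f v (a + t *s v)) (at t)"
proof -
  obtain D where D: "Vector_Spaces.linear (*s) (*) D" "(f has_derivative D) (at (a + t *s v))"
    using assms by (auto simp: holo_on_def)
  have *: "((\<lambda>t. f (b + t *s v)) has_field_derivative D v) (at s)" if "b + s *s v = a + t *s v" for b s
  proof -
    have "((\<lambda>t. b + t *s v) has_derivative (\<lambda>h. h *s v)) (at s)"
      by (auto intro!: derivative_eq_intros bounded_linear_imp_has_derivative bounded_linear_cscale)
    from has_derivative_compose[OF this] D(2) that
    have "((\<lambda>t. f (b + t *s v)) has_derivative (\<lambda>h. D (h *s v))) (at s)" by simp
    thus ?thesis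
      by (rule has_derivative_imp_has_field_derivative) (simp add: clinear_functionalD[OF D(1)])
  qed
  have "D v = dirderiv f v (a + t *s v)"
    using *[of "a + t *s v" 0] by (simp add: dirderiv_def DERIV_imp_deriv)
  thus ?thesis using *[of a t] by simp
qed

lemma holo_on_has_derivative:
  assumes "holo_on f S" "z \<in> S"
  shows "(f has_derivative (\<lambda>v. dirderiv f v z)) (at z)"
    and "Vector_Spaces.linear (*s) (*) (\<lambda>v. dirderiv f v z)"
proof -
  obtain D where D: "Vector_Spaces.linear (*s) (*) D" "(f has_derivative D) (at z)"
    using assms by (auto simp: holo_on_def)
  have "D v = dirderiv f v z" for v
  proof -
    have "((\<lambda>t. z + t *s v) has_derivative (\<lambda>h. h *s v)) (at 0)"
      by (auto intro!: derivative_eq_intros bounded_linear_imp_has_derivative bounded_linear_cscale)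
    from has_derivative_compose[OF this] D(2)
    have "((\<lambda>t. f (z + t *s v)) has_derivative (\<lambda>h. D (h *s v))) (at 0)" by simp
    hence "((\<lambda>t. f (z + t *s v)) has_field_derivative D v) (at 0)"
      by (rule has_derivative_imp_has_field_derivative) (simp add: clinear_functionalD[OF D(1)])
    thus ?thesis by (simp add: dirderiv_def DERIV_imp_deriv)
  qed
  hence "D = (\<lambda>v. dirderiv f v z)" by auto
  with D show "(f has_derivative (\<lambda>v. dirderiv f v z)) (at z)"
    "Vector_Spaces.linear (*s) (*) (\<lambda>v. dirderiv f v z)" by auto
qed

text \<open>For a function with a real derivative, only complex homogeneity of the derivative remains to be
  shown.\<close>

lemma holo_on_dirderivI:
  assumes "\<And>z. z \<in> S \<Longrightarrow> \<exists>D. (f has_derivative D) (at z) \<and> (\<forall>c x. D (c *s x) = c * D x)"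
  shows "holo_on f S"
  unfolding holo_on_def
proof
  fix z assume "z \<in> S"
  then obtain D where D: "(f has_derivative D) (at z)" "\<And>c x. D (c *s x) = c * D x"
    using assms by blast
  interpret bounded_linear D using D(1) by (rule has_derivative_bounded_linear)
  show "\<exists>D. Vector_Spaces.linear (*s) (*) D \<and> (f has_derivative D) (at z)"
    using D by (intro exI[of _ D] conjI clinear_functionalI) (auto simp: add)
qed

lemma dirderiv_linear:
  assumes "holo_on f S" "z \<in> S"
  shows "dirderiv f (v + w) z = dirderiv f v z + dirderiv f w z"
    and "dirderiv f (c *s v) z = c * dirderiv f v z"
  using clinear_functionalD[OF holo_on_has_derivative(2)[OF assms]] by auto

lemma dirderiv_sum_axis:
  assumes "holo_on f S" "z \<in> S"
  shows "dirderiv f v z = (\<Sum>j\<in>UNIV. v $ j * dirderiv f (axis j 1) z)"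
proof -
  interpret D: Vector_Spaces.linear "(*s)" "(*)" "\<lambda>v. dirderiv f v z"
    by (rule holo_on_has_derivative(2)[OF assms])
  have "dirderiv f v z = dirderiv f (\<Sum>j\<in>UNIV. v $ j *s axis j 1) z"
    by (simp only: basis_expansion)
  thus ?thesis by (simp add: D.sum D.scale)
qed

lemma holo_on_continuous: "holo_on f S \<Longrightarrow> continuous_on S f"
  by (meson continuous_at_imp_continuous_on has_derivative_continuous holo_on_has_derivative(1))

lemma holo_on_subset: "holo_on f S \<Longrightarrow> T \<subseteq> S \<Longrightarrow> holo_on f T"
  by (auto simp: holo_on_def)

lemma holo_on_cong:
  assumes "open S" "\<And>z. z \<in> S \<Longrightarrow> f z = g z" "holo_on f S"
  shows "holo_on g S"
  unfolding holo_on_def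
proof
  fix z assume z: "z \<in> S"
  then obtain D where D: "Vector_Spaces.linear (*s) (*) D" "(f has_derivative D) (at z)"
    using assms by (auto simp: holo_on_def)
  thus "\<exists>D. Vector_Spaces.linear (*s) (*) D \<and> (g has_derivative D) (at z)"
    using has_derivative_transform_within_open[OF D(2) assms(1) z] assms(2) by blast
qed

lemma holo_on_coord: "holo_on (\<lambda>z. z $ j) S"
  by (intro holo_on_dirderivI exI[of _ "\<lambda>h. h $ j"] conjI bounded_linear_imp_has_derivative)
    (auto intro: bounded_linear_vec_nth)

lemma holo_on_mult:
  assumes "holo_on f S" "holo_on g S"
  shows "holo_on (\<lambda>z. f z * g z) S"
proof (rule holo_on_dirderivI)
  fix z assume z: "z \<in> S"
  have "((\<lambda>z. f z * g z) has_derivative (\<lambda>h. f z * dirderiv g h z + dirderiv f h z * g z)) (at z)"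
    using assms z by (intro has_derivative_mult holo_on_has_derivative)
  moreover have "f z * dirderiv g (c *s x) z + dirderiv f (c *s x) z * g z
      = c * (f z * dirderiv g x z + dirderiv f x z * g z)" for c x
    by (simp add: dirderiv_linear(2)[OF assms(1) z] dirderiv_linear(2)[OF assms(2) z] algebra_simps)
  ultimately show "\<exists>D. ((\<lambda>z. f z * g z) has_derivative D) (at z) \<and> (\<forall>c x. D (c *s x) = c * D x)"
    by blast
qed

lemma holo_on_diff:
  assumes "holo_on f S" "holo_on g S"
  shows "holo_on (\<lambda>z. f z - g z) S"
proof (rule holo_on_dirderivI)
  fix z assume z: "z \<in> S"
  have "((\<lambda>z. f z - g z) has_derivative (\<lambda>h. dirderiv f h z - dirderiv g h z)) (at z)"
    using assms z by (intro has_derivative_diff holo_on_has_derivative)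
  moreover have "dirderiv f (c *s x) z - dirderiv g (c *s x) z
      = c * (dirderiv f x z - dirderiv g x z)" for c x
    by (simp add: dirderiv_linear(2)[OF assms(1) z] dirderiv_linear(2)[OF assms(2) z] algebra_simps)
  ultimately show "\<exists>D. ((\<lambda>z. f z - g z) has_derivative D) (at z) \<and> (\<forall>c x. D (c *s x) = c * D x)"
    by blast
qed

lemma holo_on_sum:
  assumes "\<And>i. i \<in> I \<Longrightarrow> holo_on (f i) S"
  shows "holo_on (\<lambda>z. \<Sum>i\<in>I. f i z) S"
proof (rule holo_on_dirderivI)
  fix z assume z: "z \<in> S"
  have "((\<lambda>z. \<Sum>i\<in>I. f i z) has_derivative (\<lambda>h. \<Sum>i\<in>I. dirderiv (f i) h z)) (at z)"
    using assms z by (intro has_derivative_sum holo_on_has_derivative) auto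
  moreover have "(\<Sum>i\<in>I. dirderiv (f i) (c *s x) z) = c * (\<Sum>i\<in>I. dirderiv (f i) x z)" for c x
    unfolding sum_distrib_left
    by (intro sum.cong refl dirderiv_linear(2)[OF _ z]) (rule assms)
  ultimately show "\<exists>D. ((\<lambda>z. \<Sum>i\<in>I. f i z) has_derivative D) (at z) \<and> (\<forall>c x. D (c *s x) = c * D x)"
    by blast
qed

lemma holo_on_compose_linear:
  fixes U :: "complex ^ 'N::finite \<Rightarrow> complex ^ 'N"
  assumes f: "holo_on f S" and U: "Vector_Spaces.linear (*s) (*s) U" and "\<And>z. z \<in> T \<Longrightarrow> U z \<in> S"
  shows "holo_on (\<lambda>z. f (U z)) T"
proof (rule holo_on_dirderivI)
  fix z assume "z \<in> T"
  hence z: "U z \<in> S" using assms by auto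
  have "((\<lambda>z. f (U z)) has_derivative (\<lambda>h. dirderiv f (U h) (U z))) (at z)"
    by (rule has_derivative_compose[OF bounded_linear_imp_has_derivative[OF clinear_bounded[OF U]]
        holo_on_has_derivative(1)[OF f z]])
  moreover have "dirderiv f (U (c *s x)) (U z) = c * dirderiv f (U x) (U z)" for c x
    by (simp add: clinearD[OF U] dirderiv_linear(2)[OF f z])
  ultimately show "\<exists>D. ((\<lambda>z. f (U z)) has_derivative D) (at z) \<and> (\<forall>c x. D (c *s x) = c * D x)"
    by blast
qed

lemma continuous_cline: "continuous_on A (\<lambda>t. a + t *s (v :: complex ^ 'N::finite))"
  by (intro continuous_intros)

lemma holo_on_line_holomorphic:
  assumes "holo_on f S"
  shows "(\<lambda>t. f (a + t *s v)) holomorphic_on {t. a + t *s v \<in> S}"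
  unfolding holomorphic_on_def field_differentiable_def
  using holo_on_line[OF assms] by (blast intro: has_field_derivative_at_within)

lemma open_cline:
  assumes "open S" shows "open {t. a + t *s (v :: complex ^ 'N::finite) \<in> S}"
  using open_vimage[OF assms continuous_cline] by (simp add: vimage_def)

lemma mean_value_circle:
  assumes "holo_on f S" "open S" "\<And>t. norm t \<le> 1 \<Longrightarrow> a + t *s v \<in> S"
  shows "((\<lambda>\<theta>. f (a + circ \<theta> *s v)) has_integral f a) {0..1}"
    and "((\<lambda>\<theta>. f (a + circ \<theta> *s v) / circ \<theta>) has_integral dirderiv f v a) {0..1}"
  using cauchy_circ[OF holo_on_line_holomorphic[OF assms(1)] open_cline[OF assms(2)], of a v 0]
    cauchy_circ[OF holo_on_line_holomorphic[OF assms(1)] open_cline[OF assms(2)], of a v 1] assms(3)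
  by (auto simp: subset_eq dirderiv_def)

lemma cline_in_ball:
  fixes a :: "complex ^ 'N::finite"
  assumes "a \<in> S" "open S"
  obtains e r where "0 < e" "0 < r" "\<And>z t. z \<in> ball a e \<Longrightarrow> norm t \<le> 1 \<Longrightarrow> z + t *s (of_real r *s v) \<in> S"
proof -
  obtain d where d: "0 < d" "ball a d \<subseteq> S" using assms openE by blast
  define r where "r = d / 2 / (norm v + 1)"
  have r: "0 < r" using d norm_ge_zero[of v] by (simp add: r_def add_nonneg_pos)
  have rv: "r * norm v \<le> d / 2"
  proof -
    have "r * norm v \<le> r * (norm v + 1)" using r by simp
    also have "\<dots> = d / 2"
      using add_nonneg_pos[OF norm_ge_zero zero_less_one, of v] by (simp add: r_def del: divide_divide_eq_left)
    finally show ?thesis .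
  qed
  have "z + t *s (of_real r *s v) \<in> S" if "z \<in> ball a (d / 2)" "norm t \<le> 1" for z t
  proof -
    have "norm (z + t *s (of_real r *s v) - a) \<le> norm (z - a) + norm (t *s (of_real r *s v))"
      by (metis add_diff_eq diff_add_eq norm_triangle_ineq)
    also have "norm (t *s (of_real r *s v)) \<le> 1 * (r * norm v)"
    proof -
      have "norm (t *s (of_real r *s v)) = norm t * (r * norm v)"
        using r by (simp add: norm_cscale norm_mult)
      thus ?thesis using r that by (simp only:) (intro mult_right_mono; simp)
    qed
    also have "norm (z - a) < d / 2" using that by (simp add: dist_norm norm_minus_commute)
    finally show ?thesis using d rv by (auto simp: dist_norm norm_minus_commute subset_eq)
  qed
  thus ?thesis using that[of "d / 2" r] d r by auto
qed

lemma dirderiv_cauchy: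
  assumes "holo_on f S" "open S" "0 < r" "\<And>t. norm t \<le> 1 \<Longrightarrow> z + t *s (of_real r *s v) \<in> S"
  shows "dirderiv f v z = integral {0..1} (\<lambda>\<theta>. f (z + circ \<theta> *s (of_real r *s v)) / circ \<theta>) / of_real r"
proof -
  have "z \<in> S" using assms(4)[of 0] by simp
  have "integral {0..1} (\<lambda>\<theta>. f (z + circ \<theta> *s (of_real r *s v)) / circ \<theta>) = dirderiv f (of_real r *s v) z"
    by (intro integral_unique mean_value_circle(2)[OF assms(1,2)] assms(4))
  thus ?thesis using assms(3) by (simp add: dirderiv_linear(2)[OF assms(1) \<open>z \<in> S\<close>])
qed

lemma continuous_on_dirderiv:
  assumes f: "holo_on f S" and S: "open S"
  shows "continuous_on S (dirderiv f v)"
proof (rule continuous_at_imp_continuous_on, rule ballI)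
  fix a assume "a \<in> S"
  then obtain e r where er: "0 < e" "0 < r"
      "\<And>z t. z \<in> ball a e \<Longrightarrow> norm t \<le> 1 \<Longrightarrow> z + t *s (of_real r *s v) \<in> S"
    using cline_in_ball[OF _ S, of a v] by blast
  define w where "w = of_real r *s v"
  have inS: "z + circ \<theta> *s w \<in> S" if "dist a z < e" for z \<theta>
    using er(3)[of z "circ \<theta>"] that by (simp add: w_def)
  have "continuous_on (ball a e \<times> cbox (0::real) 1) (\<lambda>(z, \<theta>). f (z + circ \<theta> *s w) / circ \<theta>)"
    unfolding split_beta
    by (intro continuous_intros continuous_on_compose2[OF holo_on_continuous[OF f]])
      (auto intro!: inS)
  hence "continuous_on (ball a e) (\<lambda>z. integral (cbox 0 1) (\<lambda>\<theta>. f (z + circ \<theta> *s w) / circ \<theta>))"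
    by (rule integral_continuous_on_param)
  hence "continuous_on (ball a e) (\<lambda>z. integral {0..1} (\<lambda>\<theta>. f (z + circ \<theta> *s w) / circ \<theta>) / of_real r)"
    using er(2) by (intro continuous_intros) auto
  hence "continuous_on (ball a e) (dirderiv f v)"
    by (rule continuous_on_eq) (use dirderiv_cauchy[OF f S er(2) er(3)] in \<open>auto simp: w_def\<close>)
  thus "isCont (dirderiv f v) a" using er(1) by (simp add: continuous_on_eq_continuous_at)
qed

text \<open>Near a point, a directional derivative is a Cauchy integral over circles of one radius.
  Differentiating under this integral shows that it is holomorphic, and that directional derivatives
  commute.\<close>

lemma has_derivative_dirderiv:
  assumes f: "holo_on f S" and S: "open S" and a: "a \<in> S"
  shows "(dirderiv f v has_derivative (\<lambda>h. dirderiv (dirderiv f h) v a)) (at a)"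
    and "holo_on (dirderiv f v) S"
proof -
  have main: "\<exists>D. (dirderiv f v has_derivative D) (at a) \<and> (\<forall>c h. D (c *s h) = c * D h) \<and>
      (\<exists>r>0. (\<forall>t. norm t \<le> 1 \<longrightarrow> a + t *s (of_real r *s v) \<in> S) \<and>
        (\<forall>h. D h = integral {0..1} (\<lambda>\<theta>. dirderiv f h (a + circ \<theta> *s (of_real r *s v)) / circ \<theta>) / of_real r))"
    if a: "a \<in> S" for a v
  proof -
    obtain e r where er: "0 < e" "0 < r"
        "\<And>z t. z \<in> ball a e \<Longrightarrow> norm t \<le> 1 \<Longrightarrow> z + t *s (of_real r *s v) \<in> S"
      using cline_in_ball[OF a S, of v] by blast
    define w where "w = of_real r *s v"
    define F where "F z \<theta> = Blinfun (\<lambda>h. dirderiv f h (z + circ \<theta> *s w) / circ \<theta>)" for z and \<theta> :: real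
    have inS: "z + circ \<theta> *s w \<in> S" if "z \<in> ball a e" for z \<theta>
      using er(3)[OF that, of "circ \<theta>"] by (simp add: w_def)
    have inS': "z + circ \<theta> *s w \<in> S" if "dist a z < e" for z \<theta>
      using inS that by simp
    have bl: "bounded_linear (\<lambda>h. dirderiv f h (z + circ \<theta> *s w) / circ \<theta>)" if "z \<in> ball a e" for z \<theta>
      using has_derivative_bounded_linear[OF holo_on_has_derivative(1)[OF f inS[OF that]]]
      by (intro bounded_linear_compose[OF bounded_linear_divide]) auto
    have F: "blinfun_apply (F z \<theta>) h = dirderiv f h (z + circ \<theta> *s w) / circ \<theta>" if "z \<in> ball a e" for z \<theta> h
      unfolding F_def by (simp add: bounded_linear_Blinfun_apply[OF bl[OF that]])
    have contf: "continuous_on (ball a e \<times> cbox (0::real) 1) (\<lambda>(z, \<theta>). g (z + circ \<theta> *s w) / circ \<theta>)"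
      if "continuous_on S g" for g :: "complex ^ 'a \<Rightarrow> complex"
      unfolding split_beta
      by (intro continuous_intros continuous_on_compose2[OF that])
        (auto intro!: inS')
    have cont0: "continuous_on (cbox 0 1) (\<lambda>\<theta>. g (z + circ \<theta> *s w) / circ \<theta>)"
      if "continuous_on S g" "z \<in> ball a e" for g :: "complex ^ 'a \<Rightarrow> complex" and z
      using inS[OF that(2)]
      by (intro continuous_intros continuous_on_compose2[OF that(1)]) auto
    have contF: "continuous_on (ball a e \<times> cbox (0::real) 1) (\<lambda>(z, \<theta>). F z \<theta>)"
      unfolding split_beta
    proof (rule continuous_on_blinfun_componentwise)
      fix i :: "complex ^ 'a"
      show "continuous_on (ball a e \<times> cbox 0 1) (\<lambda>x. blinfun_apply (F (fst x) (snd x)) i)"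
        by (rule continuous_on_eq[OF contf[OF continuous_on_dirderiv[OF f S, of i]]])
          (auto simp: F split_beta)
    qed
    \<comment> \<open>Differentiation under the integral needs a derivative that is jointly continuous, as a bounded
      operator; in finite dimension it suffices to check this on a basis.\<close>
    have "((\<lambda>z. integral (cbox 0 1) (\<lambda>\<theta>. f (z + circ \<theta> *s w) / circ \<theta>))
        has_derivative blinfun_apply (integral (cbox 0 1) (F a))) (at a within ball a e)"
    proof (rule leibniz_rule[OF _ _ contF])
      fix z and \<theta> :: real assume z: "z \<in> ball a e"
      have "((\<lambda>z. f (z + circ \<theta> *s w)) has_derivative (\<lambda>h. dirderiv f h (z + circ \<theta> *s w))) (at z)"
      proof -
        have "((\<lambda>z. z + circ \<theta> *s w) has_derivative (\<lambda>h. h)) (at z)"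
          by (auto intro!: derivative_eq_intros)
        from has_derivative_compose[OF this holo_on_has_derivative(1)[OF f inS[OF z, of \<theta>]]]
        show ?thesis .
      qed
      from bounded_linear.has_derivative[OF bounded_linear_divide this, of "circ \<theta>"]
      have "((\<lambda>z. f (z + circ \<theta> *s w) / circ \<theta>) has_derivative blinfun_apply (F z \<theta>)) (at z)"
        by (simp add: F[OF z, abs_def])
      thus "((\<lambda>z. f (z + circ \<theta> *s w) / circ \<theta>) has_derivative blinfun_apply (F z \<theta>)) (at z within ball a e)"
        by (rule has_derivative_at_withinI)
    next
      fix z assume "z \<in> ball a e"
      thus "(\<lambda>\<theta>. f (z + circ \<theta> *s w) / circ \<theta>) integrable_on cbox 0 1"
        by (intro integrable_continuous cont0 holo_on_continuous[OF f])
    qed (use er in auto)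
    hence "((\<lambda>z. integral (cbox 0 1) (\<lambda>\<theta>. f (z + circ \<theta> *s w) / circ \<theta>) / of_real r)
        has_derivative (\<lambda>h. blinfun_apply (integral (cbox 0 1) (F a)) h / of_real r)) (at a within ball a e)"
      by (rule bounded_linear.has_derivative[OF bounded_linear_divide])
    moreover have "(\<lambda>h. blinfun_apply (integral (cbox 0 1) (F a)) h / of_real r) =
        (\<lambda>h. integral {0..1} (\<lambda>\<theta>. dirderiv f h (a + circ \<theta> *s w) / circ \<theta>) / of_real r)" (is "_ = ?D")
    proof
      fix h
      have ae: "a \<in> ball a e" using er by simp
      have "F a integrable_on cbox 0 1"
      proof (rule integrable_continuous)
        have "continuous_on (cbox 0 1) (Pair a :: real \<Rightarrow> _)" by (intro continuous_intros)
        moreover have "Pair a ` cbox 0 1 \<subseteq> ball a e \<times> cbox (0::real) 1" using ae by auto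
        ultimately show "continuous_on (cbox 0 1) (F a)"
          using continuous_on_compose2[OF contF, of "cbox 0 1" "\<lambda>\<theta>. (a, \<theta>)"] by simp
      qed
      hence "blinfun_apply (integral (cbox 0 1) (F a)) h = integral (cbox 0 1) (\<lambda>\<theta>. blinfun_apply (F a \<theta>) h)"
        by (rule blinfun_apply_integral)
      thus "blinfun_apply (integral (cbox 0 1) (F a)) h / of_real r = ?D h"
        by (simp add: F[OF ae])
    qed
    ultimately have "((\<lambda>z. integral (cbox 0 1) (\<lambda>\<theta>. f (z + circ \<theta> *s w) / circ \<theta>) / of_real r)
        has_derivative ?D) (at a)"
      using er(1) by (simp add: at_within_open[where S="ball a e"])
    hence "(dirderiv f v has_derivative ?D) (at a)"
      by (rule has_derivative_transform_within_open[OF _ open_ball[of a e]])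
        (use er dirderiv_cauchy[OF f S er(2) er(3)] in \<open>auto simp: w_def\<close>)
    moreover have "?D (c *s h) = c * ?D h" for c h
    proof -
      have "?D (c *s h) = integral {0..1} (\<lambda>\<theta>. c * (dirderiv f h (a + circ \<theta> *s w) / circ \<theta>)) / of_real r"
        using inS[of a] er by (simp add: dirderiv_linear(2)[OF f])
      also have "\<dots> = c * ?D h" by (subst integral_mult_right) (simp only: times_divide_eq_right)
      finally show ?thesis .
    qed
    moreover have "\<forall>t. norm t \<le> 1 \<longrightarrow> a + t *s (of_real r *s v) \<in> S"
      using er(1) er(3)[of a] by auto
    ultimately show ?thesis
      using er(2) unfolding w_def by (intro exI[of _ ?D] conjI exI[of _ r] allI refl)
        (simp_all add: w_def)
  qed
  show holo: "holo_on (dirderiv f v) S" for v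
  proof (rule holo_on_dirderivI)
    fix z assume "z \<in> S"
    from main[OF this, of v] show "\<exists>D. (dirderiv f v has_derivative D) (at z) \<and> (\<forall>c x. D (c *s x) = c * D x)"
      by (elim exE conjE) (intro exI conjI)
  qed
  from main[OF a, of v] obtain D r where D: "(dirderiv f v has_derivative D) (at a)" "r > 0"
      "\<And>t. norm t \<le> 1 \<Longrightarrow> a + t *s (of_real r *s v) \<in> S"
      "\<And>h. D h = integral {0..1} (\<lambda>\<theta>. dirderiv f h (a + circ \<theta> *s (of_real r *s v)) / circ \<theta>) / of_real r"
    by blast
  have "D h = dirderiv (dirderiv f h) v a" for h
    unfolding D(4) by (rule dirderiv_cauchy[OF holo S D(2,3), symmetric])
  hence "D = (\<lambda>h. dirderiv (dirderiv f h) v a)" by auto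
  thus "(dirderiv f v has_derivative (\<lambda>h. dirderiv (dirderiv f h) v a)) (at a)" using D by simp
qed

lemma holo_on_dirderiv: "holo_on f S \<Longrightarrow> open S \<Longrightarrow> holo_on (dirderiv f v) S"
  using has_derivative_dirderiv(2)[of f S] by (cases "S = {}") (auto simp: holo_on_def)


subsection \<open>The radial derivative\<close>

text \<open>The first order radial derivative. Being defined through \<open>t \<mapsto> f (t *s z)\<close> alone, it commutes with
  composition with any homogeneous map.\<close>

definition Rad :: "(complex ^ 'N::finite \<Rightarrow> complex) \<Rightarrow> complex ^ 'N \<Rightarrow> complex" where
  "Rad f z = deriv (\<lambda>t. f (t *s z)) 1"

lemma Rad_eq: "holo_on f S \<Longrightarrow> z \<in> S \<Longrightarrow> Rad f z = dirderiv f z z"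
  using holo_on_line[of f S 0 1 z] by (simp add: Rad_def DERIV_imp_deriv)

lemma holo_on_dirderiv_field:
  fixes A :: "complex ^ 'N::finite \<Rightarrow> complex ^ 'N"
  assumes f: "holo_on f S" and S: "open S" and A: "Vector_Spaces.linear (*s) (*s) A"
  shows "holo_on (\<lambda>z. dirderiv f (A z) z) S"
proof (rule holo_on_cong[OF S])
  show "(\<Sum>j\<in>UNIV. A z $ j * dirderiv f (axis j 1) z) = dirderiv f (A z) z" if "z \<in> S" for z
    by (rule dirderiv_sum_axis[OF f that, symmetric])
  show "holo_on (\<lambda>z. \<Sum>j\<in>UNIV. A z $ j * dirderiv f (axis j 1) z) S"
    by (intro holo_on_sum holo_on_mult holo_on_dirderiv[OF f S]
        holo_on_compose_linear[OF holo_on_coord[of _ UNIV] A]) auto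
qed

lemma holo_on_Rad:
  assumes f: "holo_on f S" and S: "open S"
  shows "holo_on (Rad f) S"
proof (rule holo_on_cong[OF S])
  show "holo_on (\<lambda>z. dirderiv f z z) S"
    using holo_on_dirderiv_field[OF f S vec.linear_ident] by simp
qed (simp add: Rad_eq[OF f])

lemma holo_on_Rad_funpow: "holo_on f S \<Longrightarrow> open S \<Longrightarrow> holo_on ((Rad ^^ n) f) S"
  by (induction n) (auto intro: holo_on_Rad)

lemma Rad_compose: "(\<And>t. U (t *s z) = t *s U z) \<Longrightarrow> Rad (\<lambda>z. f (U z)) z = Rad f (U z)"
  by (simp add: Rad_def)

lemma Rad_funpow_scale: "(Rad ^^ n) (\<lambda>z. f (c *s z)) = (\<lambda>z. (Rad ^^ n) f (c *s z))"
proof (induction n)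
  case (Suc n)
  thus ?case by (auto intro!: Rad_compose simp: mult.commute)
qed simp

lemma Rad_diff:
  assumes "holo_on f S" "holo_on g S" "z \<in> S"
  shows "Rad (\<lambda>z. f z - g z) z = Rad f z - Rad g z"
proof -
  have "((\<lambda>t. f (0 + t *s z)) has_field_derivative dirderiv f z (0 + 1 *s z)) (at 1)"
    "((\<lambda>t. g (0 + t *s z)) has_field_derivative dirderiv g z (0 + 1 *s z)) (at 1)"
    using assms by (intro holo_on_line[of _ S]; simp)+
  from DERIV_diff[OF this] this show ?thesis by (simp add: Rad_def DERIV_imp_deriv)
qed


subsection \<open>Homogeneous expansions\<close>

lemma finite_multiindices: "finite {a :: 'N::finite \<Rightarrow> nat. (\<Sum>j\<in>UNIV. a j) = k}"
proof (rule finite_subset)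
  show "{a :: 'N \<Rightarrow> nat. (\<Sum>j\<in>UNIV. a j) = k} \<subseteq> PiE UNIV (\<lambda>_. {..k})"
    by (auto simp: PiE_def intro: member_le_sum)
  show "finite (PiE UNIV (\<lambda>_::'N. {..k}))" by (intro finite_PiE) auto
qed

lemma homogeneous_polynomial_sum:
  assumes "\<And>i. i \<in> I \<Longrightarrow> homogeneous_polynomial k (P i)"
  shows "homogeneous_polynomial k (\<lambda>z. \<Sum>i\<in>I. P i z)"
proof -
  have "\<forall>i\<in>I. \<exists>c. \<forall>z. P i z = (\<Sum>a | (\<Sum>j\<in>UNIV. a j) = k. c a * (\<Prod>j\<in>UNIV. (z $ j) ^ a j))"
    using assms by (auto simp: homogeneous_polynomial_def)
  then obtain c where c: "\<And>i z. i \<in> I \<Longrightarrow> P i z = (\<Sum>a | (\<Sum>j\<in>UNIV. a j) = k. c i a * (\<Prod>j\<in>UNIV. (z $ j) ^ a j))"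
    by (auto dest!: bchoice)
  have "(\<Sum>i\<in>I. P i z) = (\<Sum>a | (\<Sum>j\<in>UNIV. a j) = k. (\<Sum>i\<in>I. c i a) * (\<Prod>j\<in>UNIV. (z $ j) ^ a j))" for z
    unfolding sum_distrib_right by (subst sum.swap) (simp add: c)
  thus ?thesis unfolding homogeneous_polynomial_def by (intro exI allI)
qed

lemma homogeneous_polynomial_cmult:
  assumes "homogeneous_polynomial k P"
  shows "homogeneous_polynomial k (\<lambda>z. b * P z)"
proof -
  obtain c where c: "\<And>z. P z = (\<Sum>a | (\<Sum>j\<in>UNIV. a j) = k. c a * (\<Prod>j\<in>UNIV. (z $ j) ^ a j))"
    using assms by (auto simp: homogeneous_polynomial_def)
  have "b * P z = (\<Sum>a | (\<Sum>j\<in>UNIV. a j) = k. (b * c a) * (\<Prod>j\<in>UNIV. (z $ j) ^ a j))" for z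
    by (simp add: c sum_distrib_left mult.assoc)
  thus ?thesis unfolding homogeneous_polynomial_def by (intro exI allI)
qed

lemma homogeneous_polynomial_coord_mult:
  fixes P :: "complex ^ 'N::finite \<Rightarrow> complex"
  assumes "homogeneous_polynomial k P"
  shows "homogeneous_polynomial (Suc k) (\<lambda>z. z $ i * P z)"
proof -
  obtain c where c: "\<And>z. P z = (\<Sum>a | (\<Sum>j\<in>UNIV. a j) = k. c a * (\<Prod>j\<in>UNIV. (z $ j) ^ a j))"
    using assms by (auto simp: homogeneous_polynomial_def)
  define up :: "('N \<Rightarrow> nat) \<Rightarrow> 'N \<Rightarrow> nat" where "up a = a(i := Suc (a i))" for a
  define dn :: "('N \<Rightarrow> nat) \<Rightarrow> 'N \<Rightarrow> nat" where "dn b = b(i := b i - 1)" for b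
  have sum_upd: "(\<Sum>j\<in>UNIV. (a(i := x)) j) = x + (\<Sum>j\<in>UNIV-{i}. a j)" for a :: "'N \<Rightarrow> nat" and x
    by (subst sum.remove[of UNIV i]) (auto intro!: sum.cong)
  have sum_up: "(\<Sum>j\<in>UNIV. up a j) = Suc (\<Sum>j\<in>UNIV. a j)" for a
    by (simp only: up_def sum_upd) (simp add: sum.remove[of UNIV i])
  have prod_up: "(\<Prod>j\<in>UNIV. (z $ j) ^ up a j) = z $ i * (\<Prod>j\<in>UNIV. (z $ j) ^ a j)" for z :: "complex ^ 'N" and a
  proof -
    have "(\<Prod>j\<in>UNIV-{i}. (z $ j) ^ up a j) = (\<Prod>j\<in>UNIV-{i}. (z $ j) ^ a j)"
      by (intro prod.cong) (auto simp: up_def)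
    thus ?thesis by (subst (1 2) prod.remove[of UNIV i]) (auto simp: up_def mult.assoc)
  qed
  have dnup: "dn (up a) = a" for a by (auto simp: up_def dn_def)
  have updn: "up (dn b) = b" if "b i > 0" for b using that by (auto simp: up_def dn_def)
  have "z $ i * P z = (\<Sum>b | (\<Sum>j\<in>UNIV. b j) = Suc k. (if b i > 0 then c (dn b) else 0) * (\<Prod>j\<in>UNIV. (z $ j) ^ b j))" for z
  proof -
    have "z $ i * P z = (\<Sum>a | (\<Sum>j\<in>UNIV. a j) = k. c a * (\<Prod>j\<in>UNIV. (z $ j) ^ up a j))"
      by (simp add: c sum_distrib_left prod_up mult_ac)
    also have "\<dots> = (\<Sum>b | (\<Sum>j\<in>UNIV. b j) = Suc k \<and> b i > 0. c (dn b) * (\<Prod>j\<in>UNIV. (z $ j) ^ b j))"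
    proof (rule sum.reindex_bij_witness[where i=dn and j=up])
      fix b assume "b \<in> {b. (\<Sum>j\<in>UNIV. b j) = Suc k \<and> 0 < b i}"
      thus "up (dn b) = b" "dn b \<in> {a. (\<Sum>j\<in>UNIV. a j) = k}"
        using sum_up[of "dn b"] by (auto simp: updn)
    qed (auto simp: dnup sum_up, simp add: up_def)
    also have "\<dots> = (\<Sum>b | (\<Sum>j\<in>UNIV. b j) = Suc k. (if b i > 0 then c (dn b) else 0) * (\<Prod>j\<in>UNIV. (z $ j) ^ b j))"
      by (rule sum.mono_neutral_cong_left) (auto simp: finite_multiindices)
    finally show ?thesis .
  qed
  thus ?thesis unfolding homogeneous_polynomial_def
    by (intro exI[of _ "\<lambda>b. if b i > 0 then c (dn b) else 0"] allI)
qed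

lemma homogeneous_polynomial_scale:
  assumes "homogeneous_polynomial k P"
  shows "P (t *s z) = t ^ k * P z"
proof -
  obtain c where c: "\<And>z. P z = (\<Sum>a | (\<Sum>j\<in>UNIV. a j) = k. c a * (\<Prod>j\<in>UNIV. (z $ j) ^ a j))"
    using assms by (auto simp: homogeneous_polynomial_def)
  have "(\<Prod>j\<in>UNIV. ((t *s z) $ j) ^ a j) = t ^ (\<Sum>j\<in>UNIV. a j) * (\<Prod>j\<in>UNIV. (z $ j) ^ a j)" for a
    by (simp add: power_mult_distrib prod.distrib power_sum)
  thus ?thesis unfolding c sum_distrib_left by (intro sum.cong) auto
qed

text \<open>By the chain rule, each derivative of \<open>t \<mapsto> f (t *s z)\<close> at the origin is a sum of derivatives of
  the partial derivatives of \<open>f\<close>, each multiplied by a coordinate of \<open>z\<close>. Hence it is a homogeneous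
  polynomial.\<close>

lemma higher_deriv_line_homogeneous:
  fixes f :: "complex ^ 'N::finite \<Rightarrow> complex"
  assumes "holo_on f S" and S: "open S" and S0: "0 \<in> S"
  shows "homogeneous_polynomial k (\<lambda>z. (deriv ^^ k) (\<lambda>t. f (t *s z)) 0)"
  using assms(1)
proof (induction k arbitrary: f)
  case 0
  have "{a :: 'N \<Rightarrow> nat. (\<Sum>j\<in>UNIV. a j) = 0} = {\<lambda>_. 0}" by auto
  thus ?case by (auto simp: homogeneous_polynomial_def intro!: exI[of _ "\<lambda>_. f 0"])
next
  case (Suc k)
  have *: "(deriv ^^ Suc k) (\<lambda>t. f (t *s z)) 0 = (\<Sum>j\<in>UNIV. z $ j * (deriv ^^ k) (\<lambda>t. dirderiv f (axis j 1) (t *s z)) 0)" for z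
  proof -
    define T where "T = {t. 0 + t *s z \<in> S}"
    have T: "open T" "0 \<in> T" using open_cline[OF S, of 0 z] S0 by (auto simp: T_def)
    have hol: "(\<lambda>t. dirderiv f (axis j 1) (t *s z)) holomorphic_on T" for j
      using holo_on_line_holomorphic[OF holo_on_dirderiv[OF Suc.prems S, of "axis j 1"], of 0 z] by (simp add: T_def)
    have ev: "\<forall>\<^sub>F t in nhds 0. deriv (\<lambda>t. f (t *s z)) t = (\<Sum>j\<in>UNIV. z $ j * dirderiv f (axis j 1) (t *s z))"
    proof (rule eventually_mono[OF eventually_nhds_in_open[OF T]])
      fix t assume "t \<in> T"
      hence t: "0 + t *s z \<in> S" by (simp add: T_def)
      from holo_on_line[OF Suc.prems t] have "deriv (\<lambda>t. f (t *s z)) t = dirderiv f z (t *s z)"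
        by (simp add: DERIV_imp_deriv)
      also have "\<dots> = (\<Sum>j\<in>UNIV. z $ j * dirderiv f (axis j 1) (t *s z))"
        using t by (intro dirderiv_sum_axis[OF Suc.prems]) simp
      finally show "deriv (\<lambda>t. f (t *s z)) t = (\<Sum>j\<in>UNIV. z $ j * dirderiv f (axis j 1) (t *s z))" .
    qed
    have "(deriv ^^ Suc k) (\<lambda>t. f (t *s z)) 0 = (deriv ^^ k) (deriv (\<lambda>t. f (t *s z))) 0"
      by (simp add: funpow_swap1)
    also have "\<dots> = (deriv ^^ k) (\<lambda>t. \<Sum>j\<in>UNIV. z $ j * dirderiv f (axis j 1) (t *s z)) 0"
      by (rule higher_deriv_cong_ev[OF ev]) simp
    also have "\<dots> = (\<Sum>j\<in>J. (deriv ^^ k) (\<lambda>t. z $ j * dirderiv f (axis j 1) (t *s z)) 0)"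
      if "J = UNIV" for J
      unfolding that[symmetric]
    proof (induction J rule: infinite_finite_induct)
      case (insert j J)
      have "(deriv ^^ k) (\<lambda>t. z $ j * dirderiv f (axis j 1) (t *s z) + (\<Sum>j\<in>J. z $ j * dirderiv f (axis j 1) (t *s z))) 0
        = (deriv ^^ k) (\<lambda>t. z $ j * dirderiv f (axis j 1) (t *s z)) 0 + (deriv ^^ k) (\<lambda>t. \<Sum>j\<in>J. z $ j * dirderiv f (axis j 1) (t *s z)) 0"
        by (intro higher_deriv_add[of _ T] holomorphic_intros hol T)
      thus ?case using insert by simp
    qed simp_all
    also have "(\<Sum>j\<in>UNIV. (deriv ^^ k) (\<lambda>t. z $ j * dirderiv f (axis j 1) (t *s z)) 0)
       = (\<Sum>j\<in>UNIV. z $ j * (deriv ^^ k) (\<lambda>t. dirderiv f (axis j 1) (t *s z)) 0)"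
      by (intro sum.cong refl higher_deriv_cmult[of _ T] hol T)
    finally show ?thesis by simp
  qed
  have "homogeneous_polynomial (Suc k) (\<lambda>z. \<Sum>j\<in>UNIV. z $ j * (deriv ^^ k) (\<lambda>t. dirderiv f (axis j 1) (t *s z)) 0)"
    by (intro homogeneous_polynomial_sum homogeneous_polynomial_coord_mult Suc.IH
        holo_on_dirderiv[OF Suc.prems S])
  thus ?case by (simp only: *)
qed

lemma holomorphic_ball_iff: "holomorphic_ball f \<longleftrightarrow> holo_on f (ball 0 1)"
  by (simp add: holomorphic_ball_def holo_on_def)

lemma homogeneous_expansion_power_series:
  assumes F: "homogeneous_expansion f F" and "norm (t *s z) < 1"
  shows "(\<lambda>k. F k z * t ^ k) sums f (t *s z)"
proof -
  have "(\<lambda>k. F k (t *s z)) sums f (t *s z)"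
    using assms by (auto simp: homogeneous_expansion_def)
  moreover have "F k (t *s z) = F k z * t ^ k" for k
    using homogeneous_polynomial_scale[of k "F k" t z] F
    by (simp add: homogeneous_expansion_def mult.commute)
  ultimately show ?thesis by simp
qed

lemma ex_radius_gt_1:
  assumes "norm (z :: complex ^ 'N::finite) < 1"
  obtains r where "1 < r" "\<And>t. norm t < r \<Longrightarrow> norm (t *s z) < 1"
proof
  let ?r = "2 / (1 + norm z)"
  have pos: "0 < 1 + norm z" using norm_ge_zero[of z] by linarith
  show "1 < ?r" using pos assms by (simp add: field_simps)
  fix t :: complex assume "norm t < ?r"
  hence "norm t * norm z \<le> ?r * norm z" by (intro mult_right_mono) auto
  also have "\<dots> < 1" using pos assms by (simp add: field_simps)
  finally show "norm (t *s z) < 1" by (simp add: norm_cscale)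
qed

text \<open>This is the Taylor expansion of \<open>t \<mapsto> f (t *s z)\<close> at the origin, evaluated at \<open>t = 1\<close>.\<close>

lemma homogeneous_expansion_exists:
  fixes f :: "complex ^ 'N::finite \<Rightarrow> complex"
  assumes f: "holo_on f (ball 0 1)"
  shows "homogeneous_expansion f (\<lambda>k z. inverse (fact k) * (deriv ^^ k) (\<lambda>t. f (t *s z)) 0)"
  unfolding homogeneous_expansion_def
proof (intro conjI allI ballI)
  show "homogeneous_polynomial k (\<lambda>z. inverse (fact k) * (deriv ^^ k) (\<lambda>t. f (t *s z)) 0)" for k
    by (intro homogeneous_polynomial_cmult higher_deriv_line_homogeneous[OF f]) auto
  fix z :: "complex ^ 'N" assume "z \<in> ball 0 1"
  then obtain r where r: "1 < r" "\<And>t. norm t < r \<Longrightarrow> norm (t *s z) < 1"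
    using ex_radius_gt_1[of z] by auto
  have "(\<lambda>t. f (0 + t *s z)) holomorphic_on ball 0 r"
    by (rule holomorphic_on_subset[OF holo_on_line_holomorphic[OF f]]) (use r in auto)
  from holomorphic_power_series[OF this, of 1] r
  show "(\<lambda>k. inverse (fact k) * (deriv ^^ k) (\<lambda>t. f (t *s z)) 0) sums f z"
    by (simp add: divide_inverse mult.commute)
qed

lemma power_series_zero_coeffs:
  fixes c :: "nat \<Rightarrow> complex"
  assumes "0 < r" "\<And>t. norm t < r \<Longrightarrow> (\<lambda>k. c k * t ^ k) sums 0"
  shows "c k = 0"
proof (rule ccontr)
  assume "c k \<noteq> 0"
  have "c 0 = 0" using assms(2)[of 0] assms(1) by (simp add: powser_sums_zero_iff)
  with \<open>c k \<noteq> 0\<close> have "0 < k" by (metis gr0I)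
  from powser_0_nonzero[where f="\<lambda>_. 0" and a=c and \<xi>=0, OF assms(1) _ _ \<open>c k \<noteq> 0\<close> this] assms(2)
  obtain s where s: "0 < s" "\<And>z::complex. z \<in> cball 0 s - {0} \<Longrightarrow> (0::complex) \<noteq> 0" by auto
  from s(2)[of "of_real s"] s(1) show False by simp
qed

text \<open>On each complex line through the origin, the expansion is a power series in one variable.\<close>

lemma homogeneous_expansion_unique:
  fixes F G :: "nat \<Rightarrow> complex ^ 'N::finite \<Rightarrow> complex"
  assumes F: "homogeneous_expansion f F" and G: "homogeneous_expansion f G"
  shows "F = G"
proof (intro ext)
  fix k and z :: "complex ^ 'N"
  define r where "r = 1 / (1 + norm z)"
  have pos: "0 < 1 + norm z" using norm_ge_zero[of z] by linarith
  have "F k z - G k z = 0"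
  proof (rule power_series_zero_coeffs)
    show "0 < r" using pos by (simp add: r_def)
    fix t :: complex assume "norm t < r"
    hence "norm t * (1 + norm z) < 1" using pos by (simp add: r_def field_simps)
    hence t: "norm (t *s z) < 1" by (simp add: norm_cscale algebra_simps) (smt (verit) norm_ge_zero)
    show "(\<lambda>k. (F k z - G k z) * t ^ k) sums 0"
      using sums_diff[OF homogeneous_expansion_power_series[OF F t] homogeneous_expansion_power_series[OF G t]]
      by (simp add: algebra_simps)
  qed
  thus "F k z = G k z" by simp
qed

lemma hom_component_eqI: "homogeneous_expansion f F \<Longrightarrow> hom_component f = F"
  unfolding hom_component_def by (blast intro: the_equality homogeneous_expansion_unique)

text \<open>Termwise differentiation of the power series in \<open>t\<close> at \<open>t = 1\<close>.\<close>

lemma homogeneous_expansion_Rad: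
  assumes f: "holo_on f (ball 0 1)" and F: "homogeneous_expansion f F"
  shows "homogeneous_expansion (Rad f) (\<lambda>k z. of_nat k * F k z)"
  unfolding homogeneous_expansion_def
proof (intro conjI allI ballI)
  show "homogeneous_polynomial k (\<lambda>z. of_nat k * F k z)" for k
    using F by (intro homogeneous_polynomial_cmult) (simp add: homogeneous_expansion_def)
  fix z :: "complex ^ 'a" assume z: "z \<in> ball 0 1"
  then obtain r where r: "1 < r" "\<And>t. norm t < r \<Longrightarrow> norm (t *s z) < 1"
    using ex_radius_gt_1[of z] by auto
  have "((\<lambda>t. f (0 + t *s z)) has_field_derivative dirderiv f z (0 + 1 *s z)) (at 1)"
    using z by (intro holo_on_line[OF f]) auto
  hence "((\<lambda>t. f (t *s z)) has_field_derivative Rad f z) (at 1)"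
    using z by (simp add: Rad_eq[OF f])
  from termdiffs_sums_strong[OF homogeneous_expansion_power_series[OF F r(2)] this] r(1)
  have "(\<lambda>k. of_nat (Suc k) * F (Suc k) z) sums Rad f z"
    by (simp add: diffs_def)
  thus "(\<lambda>k. of_nat k * F k z) sums Rad f z"
    by (subst (asm) sums_Suc_iff) simp
qed

text \<open>The series that starts at degree one is the full expansion of the iterated derivative, as the constant
  term is multiplied by \<open>0 ^ n = 0\<close>.\<close>

lemma radial_deriv_eq:
  fixes f :: "complex ^ 'N::finite \<Rightarrow> complex"
  assumes f: "holo_on f (ball 0 1)" and n: "1 \<le> n" and z: "z \<in> ball 0 1"
  shows "radial_deriv n f z = (Rad ^^ n) f z"
proof -
  define F where "F = hom_component f"
  have F: "homogeneous_expansion f F"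
    unfolding F_def hom_component_eqI[OF homogeneous_expansion_exists[OF f]]
    by (rule homogeneous_expansion_exists[OF f])
  have "homogeneous_expansion ((Rad ^^ m) f) (\<lambda>k z. of_nat k ^ m * F k z)" for m
  proof (induction m)
    case (Suc m)
    from homogeneous_expansion_Rad[OF holo_on_Rad_funpow[OF f open_ball] Suc.IH]
    show ?case by (simp add: mult.assoc)
  qed (simp add: F)
  hence "(\<lambda>k. of_nat k ^ n * F k z) sums (Rad ^^ n) f z"
    using z by (simp add: homogeneous_expansion_def)
  hence "(\<lambda>k. of_nat (Suc k) ^ n * F (Suc k) z) sums (Rad ^^ n) f z"
    using n by (subst sums_Suc_iff) (simp add: zero_power)
  thus ?thesis unfolding radial_deriv_def F_def[symmetric] by (rule sums_unique[symmetric])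
qed


section \<open>Composition with linear contractions\<close>

definition adjoint_matrix :: "complex ^ 'N ^ 'N::finite \<Rightarrow> complex ^ 'N ^ 'N" where
  "adjoint_matrix A = (\<chi> i j. cnj (A $ j $ i))"

lemma cin_adjoint: "cin (A *v x) y = cin x (adjoint_matrix A *v y)"
  unfolding cin_def matrix_vector_mult_def adjoint_matrix_def
  by (simp add: sum_distrib_left sum_distrib_right mult_ac) (rule sum.swap)

text \<open>The isometries are the extreme points, in the complex sense, of the set of contractions.
  With the defects \<open>D = 1 - A\<^sup>* A\<close> and \<open>D' = 1 - A A\<^sup>*\<close>, the perturbation is a small multiple of
  \<open>x \<mapsto> \<langle>x, D x\<^sub>0\<rangle> D' y\<^sub>1\<close>: as \<open>A\<^sup>* D' = D A\<^sup>*\<close>, both \<open>\<langle>x, D x\<^sub>0\<rangle>\<close> and \<open>\<langle>A x, D' y\<^sub>1\<rangle>\<close> are controlled by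
  the square root of \<open>|x|\<^sup>2 - |A x|\<^sup>2\<close>, which is the room that the contraction leaves.\<close>

lemma contraction_perturbation:
  fixes A :: "complex ^ 'N ^ 'N::finite"
  assumes contr: "\<And>x. norm (A *v x) \<le> norm x" and "norm (A *v x\<^sub>0) \<noteq> norm x\<^sub>0"
  obtains y e where "y \<noteq> 0" "e \<noteq> 0"
    "\<And>t x. norm t \<le> 1 \<Longrightarrow> norm (A *v x + t *s (cin x y *s e)) \<le> norm x"
proof -
  define B where "B = adjoint_matrix A"
  define D where "D x = x - B *v (A *v x)" for x
  define q where "q x = (norm x)\<^sup>2 - (norm (A *v x))\<^sup>2" for x
  have q0: "0 \<le> q x" for x using contr[of x] by (simp add: q_def power_mono)
  have D: "cin x (D y) = cin x y - cin (A *v x) (A *v y)" for x y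
    by (simp add: D_def cin_diff_right B_def cin_adjoint)
  have Dq: "cin x (D x) = of_real (q x)" for x
    by (simp add: D cin_self q_def)
  have cs: "(norm (cin x (D y)))\<^sup>2 \<le> q x * (norm y)\<^sup>2" for x y
  proof (cases "y = 0")
    case True thus ?thesis by (simp add: D_def)
  next
    case False
    define \<beta> where "\<beta> = cin x (D y)"
    define \<tau> where "\<tau> = 1 / (norm y)\<^sup>2"
    define w where "w = - (of_real \<tau> * \<beta>)"
    have "cin y (D x) = cnj \<beta>"
      by (simp add: \<beta>_def D cin_commute[of y x] cin_commute[of "A *v y" "A *v x"])
    moreover have "D (x + w *s y) = D x + w *s D y"
      by (simp add: D_def matrix_vector_right_distrib vector_scalar_commute vec.scale_right_diff_distrib)
    ultimately have "cin (x + w *s y) (D (x + w *s y))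
        = of_real (q x) + (cnj w * \<beta> + w * cnj \<beta>) + (w * cnj w) * of_real (q y)"
      by (simp add: cin_add_left cin_add_right cin_scale_left cin_scale_right \<beta>_def[symmetric] Dq
          distrib_left mult.assoc)
    moreover have "cnj w * \<beta> + w * cnj \<beta> = of_real (- 2 * \<tau>) * (\<beta> * cnj \<beta>)"
      "w * cnj w = of_real (\<tau>\<^sup>2) * (\<beta> * cnj \<beta>)"
      by (simp_all add: w_def power2_eq_square)
    ultimately have "complex_of_real (q (x + w *s y))
        = of_real (q x - 2 * \<tau> * (norm \<beta>)\<^sup>2 + \<tau>\<^sup>2 * (norm \<beta>)\<^sup>2 * q y)"
      unfolding Dq complex_norm_square[symmetric] by simp
    hence "q (x + w *s y) = q x - 2 * \<tau> * (norm \<beta>)\<^sup>2 + \<tau>\<^sup>2 * (norm \<beta>)\<^sup>2 * q y"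
      by (simp only: of_real_eq_iff)
    moreover have "\<tau>\<^sup>2 * (norm \<beta>)\<^sup>2 * q y \<le> \<tau>\<^sup>2 * (norm \<beta>)\<^sup>2 * (norm y)\<^sup>2"
      by (intro mult_left_mono) (auto simp: q_def)
    moreover have "\<tau>\<^sup>2 * (norm \<beta>)\<^sup>2 * (norm y)\<^sup>2 = \<tau> * (norm \<beta>)\<^sup>2"
      using False by (simp add: \<tau>_def power2_eq_square)
    ultimately have "\<tau> * (norm \<beta>)\<^sup>2 \<le> q x" using q0[of "x + w *s y"] by linarith
    thus ?thesis using False by (simp add: \<tau>_def \<beta>_def field_simps)
  qed
  have "norm (A *v x\<^sub>0) < norm x\<^sub>0" using assms contr[of x\<^sub>0] by linarith
  hence "q x\<^sub>0 > 0" by (simp add: q_def power_strict_mono)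
  hence y: "D x\<^sub>0 \<noteq> 0" using Dq[of x\<^sub>0] by auto
  have "\<exists>y\<^sub>1. A *v (B *v y\<^sub>1) \<noteq> y\<^sub>1"
  proof (rule ccontr)
    assume "\<not> ?thesis"
    hence "(A ** B) *v z = mat 1 *v z" for z by (simp add: matrix_vector_mul_assoc)
    hence "A ** B = mat 1" by (simp add: matrix_eq)
    hence "B ** A = mat 1" by (simp add: matrix_left_right_inverse)
    hence "D x\<^sub>0 = 0" by (simp add: D_def matrix_vector_mul_assoc)
    thus False using y by simp
  qed
  then obtain y\<^sub>1 where y\<^sub>1: "A *v (B *v y\<^sub>1) \<noteq> y\<^sub>1" by blast
  define e\<^sub>0 where "e\<^sub>0 = y\<^sub>1 - A *v (B *v y\<^sub>1)"
  define v where "v = B *v y\<^sub>1"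
  have e\<^sub>0: "cin (A *v x) e\<^sub>0 = cin x (D v)" for x
    by (simp add: e\<^sub>0_def v_def D cin_diff_right) (simp add: B_def cin_adjoint)
  define M where "M = 2 * norm x\<^sub>0 * norm v + (norm x\<^sub>0)\<^sup>2 * (norm e\<^sub>0)\<^sup>2"
  define \<epsilon> where "\<epsilon> = 1 / (1 + M)"
  have M: "0 \<le> M" by (simp add: M_def)
  have \<epsilon>: "0 < \<epsilon>" "\<epsilon> \<le> 1" "\<epsilon> * M \<le> 1" using M by (auto simp: \<epsilon>_def field_simps)
  have "norm (A *v x + t *s (cin x (D x\<^sub>0) *s (of_real \<epsilon> *s e\<^sub>0))) \<le> norm x" if t: "norm t \<le> 1" for t x
  proof -
    define s where "s = sqrt (q x)"
    have s: "0 \<le> s" "s\<^sup>2 = q x" using q0[of x] by (auto simp: s_def)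
    define a b where "a = norm (cin x (D x\<^sub>0))" and "b = norm (cin x (D v))"
    have "a\<^sup>2 \<le> (s * norm x\<^sub>0)\<^sup>2" "b\<^sup>2 \<le> (s * norm v)\<^sup>2"
      using cs[of x x\<^sub>0] cs[of x v] by (simp_all add: a_def b_def power_mult_distrib s)
    hence ab: "a \<le> s * norm x\<^sub>0" "b \<le> s * norm v"
      using s by (auto intro: power2_le_imp_le)
    have ab0: "0 \<le> a" "0 \<le> b" by (simp_all add: a_def b_def)
    define k where "k = t * cin x (D x\<^sub>0) * of_real \<epsilon>"
    have k: "norm k \<le> \<epsilon> * a"
      using t \<epsilon> by (simp add: k_def a_def norm_mult mult_left_le_one_le mult_ac)
    have "Re (cin (A *v x) (k *s e\<^sub>0)) \<le> norm (cin (A *v x) (k *s e\<^sub>0))" by (rule complex_Re_le_cmod)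
    also have "\<dots> = norm k * b" by (simp add: cin_scale_right norm_mult e\<^sub>0 b_def)
    also have "\<dots> \<le> \<epsilon> * a * b" using k ab0 by (intro mult_right_mono)
    also have "\<dots> \<le> \<epsilon> * ((s * norm x\<^sub>0) * (s * norm v))"
      using mult_mono[OF ab _ ab0(2)] ab0 s \<epsilon> by (simp add: mult.assoc)
    also have "\<dots> = \<epsilon> * (norm x\<^sub>0 * norm v) * q x"
      by (simp add: power2_eq_square mult_ac flip: s(2))
    finally have 1: "Re (cin (A *v x) (k *s e\<^sub>0)) \<le> \<epsilon> * (norm x\<^sub>0 * norm v) * q x" .
    have "norm (k *s e\<^sub>0) \<le> \<epsilon> * (s * norm x\<^sub>0) * norm e\<^sub>0"
      unfolding norm_cscale using k ab \<epsilon> by (intro mult_right_mono order_trans[OF k] mult_left_mono) auto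
    hence "(norm (k *s e\<^sub>0))\<^sup>2 \<le> (\<epsilon> * (s * norm x\<^sub>0) * norm e\<^sub>0)\<^sup>2" by (intro power_mono) auto
    also have "\<dots> = \<epsilon> * \<epsilon> * ((norm x\<^sub>0)\<^sup>2 * (norm e\<^sub>0)\<^sup>2 * q x)"
      by (simp add: power2_eq_square mult_ac flip: s(2))
    also have "\<dots> \<le> \<epsilon> * 1 * ((norm x\<^sub>0)\<^sup>2 * (norm e\<^sub>0)\<^sup>2 * q x)"
      using \<epsilon> q0 by (intro mult_right_mono mult_left_mono) auto
    finally have 2: "(norm (k *s e\<^sub>0))\<^sup>2 \<le> \<epsilon> * ((norm x\<^sub>0)\<^sup>2 * (norm e\<^sub>0)\<^sup>2) * q x" by (simp add: mult_ac)
    have "(norm (A *v x + k *s e\<^sub>0))\<^sup>2 \<le> (norm (A *v x))\<^sup>2 + \<epsilon> * M * q x"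
      using 1 2 by (simp add: norm_add_cin M_def algebra_simps)
    also have "\<dots> \<le> (norm (A *v x))\<^sup>2 + 1 * q x"
      using \<epsilon> q0 by (intro add_left_mono mult_right_mono) auto
    also have "\<dots> = (norm x)\<^sup>2" by (simp add: q_def)
    finally have "norm (A *v x + k *s e\<^sub>0) \<le> norm x" by (rule power2_le_imp_le) simp
    thus ?thesis by (simp add: k_def mult.assoc)
  qed
  moreover have "of_real \<epsilon> *s e\<^sub>0 \<noteq> 0"
    using y\<^sub>1 \<epsilon> by (simp add: e\<^sub>0_def vec.scale_eq_0_iff)
  ultimately show ?thesis using that[OF y] by blast
qed

lemma continuous_on_matrix_vector [continuous_intros]:
  fixes A :: "'a::topological_space \<Rightarrow> complex ^ 'N ^ 'N::finite"
  assumes "continuous_on S A" "continuous_on S x"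
  shows "continuous_on S (\<lambda>s. A s *v x s)"
  unfolding matrix_vector_mult_def using assms by (intro continuous_intros)

lemma compact_contractions:
  "compact {A :: complex ^ 'N ^ 'N::finite. \<forall>x. norm (A *v x) \<le> norm x}" (is "compact ?K")
proof (rule compact_eq_bounded_closed[THEN iffD2], rule conjI)
  have "closed {A :: complex ^ 'N ^ 'N. norm (A *v x) \<le> norm x}" for x
    by (intro closed_Collect_le continuous_intros)
  thus "closed ?K" by (intro closed_Collect_all) auto
  have "norm A \<le> (\<Sum>i\<in>(UNIV::'N set). \<Sum>j\<in>(UNIV::'N set). 1)" if A: "A \<in> ?K" for A
  proof -
    have "norm (A $ i $ j) \<le> 1" for i j
    proof -
      have "A $ i $ j = (A *v axis j 1) $ i"
        by (simp add: matrix_vector_mult_def axis_def if_distrib cong: if_cong)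
      also have "norm \<dots> \<le> norm (A *v axis j 1)" by (rule Finite_Cartesian_Product.norm_nth_le)
      also have "\<dots> \<le> norm (axis j (1::complex) :: complex ^ 'N)" using A by blast
      also have "\<dots> = 1" by simp
      finally show ?thesis .
    qed
    hence "(\<Sum>j\<in>UNIV. norm (A $ i $ j)) \<le> (\<Sum>j\<in>(UNIV::'N set). 1)" for i
      by (intro sum_mono)
    moreover have "norm (A $ i) \<le> (\<Sum>j\<in>UNIV. norm (A $ i $ j))" for i
      unfolding norm_vec_def[of "A $ i"] by (rule L2_set_le_sum) simp
    ultimately have "norm (A $ i) \<le> (\<Sum>j\<in>(UNIV::'N set). 1)" for i
      by (rule order_trans[rotated])
    moreover have "norm A \<le> (\<Sum>i\<in>UNIV. norm (A $ i))"
      unfolding norm_vec_def[of A] by (rule L2_set_le_sum) simp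
    ultimately show ?thesis by (meson order_trans sum_mono)
  qed
  thus "bounded ?K" by (meson boundedI)
qed

lemma measurable_continuous_on_unit_sphere:
  fixes h :: "real \<times> (complex ^ 'N::finite) \<Rightarrow> 'b::{banach, second_countable_topology}"
  assumes "continuous_on ({0..1} \<times> sphere 0 1) h"
  shows "h \<in> borel_measurable (unit_interval \<Otimes>\<^sub>M sphere_measure)"
proof -
  define T where "T = {0..1::real} \<times> sphere (0::complex ^ 'N) 1"
  have "(\<lambda>x. indicator T x *\<^sub>R h x) \<in> borel_measurable borel"
    using assms unfolding T_def
    by (intro borel_measurable_continuous_on_indicator borel_closed closed_Times) auto
  moreover have "(\<lambda>x. (fst x, snd x)) \<in> unit_interval \<Otimes>\<^sub>M sphere_measure \<rightarrow>\<^sub>M (borel :: real measure) \<Otimes>\<^sub>M (borel :: (complex ^ 'N) measure)"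
  proof (rule measurable_Pair)
    have "(\<lambda>x. x) \<in> unit_interval \<rightarrow>\<^sub>M (borel :: real measure)"
      by (rule measurable_restrict_space1) simp
    from measurable_compose[OF measurable_fst this]
    show "fst \<in> unit_interval \<Otimes>\<^sub>M sphere_measure \<rightarrow>\<^sub>M (borel :: real measure)" .
    from measurable_compose[OF measurable_snd measurable_id_sphere]
    show "snd \<in> unit_interval \<Otimes>\<^sub>M sphere_measure \<rightarrow>\<^sub>M (borel :: (complex ^ 'N) measure)" .
  qed
  ultimately have "(\<lambda>x. indicator T x *\<^sub>R h x) \<in> borel_measurable (unit_interval \<Otimes>\<^sub>M sphere_measure)"
    using measurable_compose[of "\<lambda>x. x" _ borel] by (simp add: borel_prod)
  thus ?thesis
    by (rule measurable_cong[THEN iffD1, rotated])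
      (auto simp: T_def space_pair_measure space_restrict_space)
qed

text \<open>The sub-mean value property of \<open>|F|\<^sup>p\<close> on the complex lines through \<open>A \<zeta>\<close> in the directions \<open>w \<zeta>\<close>, integrated over
  the sphere.\<close>

lemma nn_integral_rotation_le:
  fixes F :: "complex ^ 'N::finite \<Rightarrow> complex" and w :: "complex ^ 'N \<Rightarrow> complex ^ 'N"
  assumes F: "holo_on F (ball 0 R)" and R: "1 < R" and p: "1 \<le> p"
    and contr: "\<And>t x. norm t \<le> 1 \<Longrightarrow> norm (A *v x + t *s w x) \<le> norm x" and w: "continuous_on UNIV w"
  shows "(\<integral>\<^sup>+\<zeta>. ennreal (norm (F (A *v \<zeta>)) powr p) \<partial>sphere_measure)
      \<le> (\<integral>\<^sup>+\<theta>. (\<integral>\<^sup>+\<zeta>. ennreal (norm (F (A *v \<zeta> + circ \<theta> *s w \<zeta>)) powr p) \<partial>sphere_measure) \<partial>unit_interval)"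
proof -
  interpret S: prob_space "sphere_measure :: (complex ^ 'N) measure" by (rule prob_space_sphere_measure)
  interpret I: prob_space unit_interval by (rule prob_space_unit_interval)
  interpret IS: pair_sigma_finite unit_interval "sphere_measure :: (complex ^ 'N) measure" ..
  have contF: "continuous_on (cball 0 1) F"
    by (rule continuous_on_subset[OF holo_on_continuous[OF F]]) (use R in auto)
  have le1: "norm (A *v \<zeta> + t *s w \<zeta>) \<le> 1" if "norm \<zeta> = 1" "norm t \<le> 1" for \<zeta> t
    using contr[OF that(2), of \<zeta>] that(1) by simp
  have "(\<integral>\<^sup>+\<zeta>. ennreal (norm (F (A *v \<zeta>)) powr p) \<partial>sphere_measure)
      \<le> (\<integral>\<^sup>+\<zeta>. (\<integral>\<^sup>+\<theta>. ennreal (norm (F (A *v \<zeta> + circ \<theta> *s w \<zeta>)) powr p) \<partial>unit_interval) \<partial>sphere_measure)"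
  proof (rule nn_integral_mono)
    fix \<zeta> :: "complex ^ 'N" assume "\<zeta> \<in> space sphere_measure"
    hence z: "norm \<zeta> = 1" by simp
    have mv: "((\<lambda>\<theta>. F (A *v \<zeta> + circ \<theta> *s w \<zeta>)) has_integral F (A *v \<zeta>)) {0..1}"
      by (rule mean_value_circle(1)[OF F]) (use le1[OF z] R in \<open>auto intro: le_less_trans\<close>)
    have cont: "continuous_on {0..1} (\<lambda>\<theta>. F (A *v \<zeta> + circ \<theta> *s w \<zeta>))"
      by (intro continuous_on_compose2[OF contF] continuous_intros) (use le1[OF z] in auto)
    have "ennreal (norm (F (A *v \<zeta>))) \<le> (\<integral>\<^sup>+\<theta>. norm (F (A *v \<zeta> + circ \<theta> *s w \<zeta>)) \<partial>unit_interval)"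
      using norm_integral_le_nn_integral[OF cont] mv by (simp add: integral_unique)
    moreover have "(\<lambda>\<theta>. norm (F (A *v \<zeta> + circ \<theta> *s w \<zeta>))) \<in> borel_measurable unit_interval"
      using borel_measurable_continuous_on_restrict[OF continuous_on_norm[OF cont]]
      by (simp cong: measurable_cong_sets add: sets_restrict_space)
    ultimately show "ennreal (norm (F (A *v \<zeta>)) powr p)
        \<le> (\<integral>\<^sup>+\<theta>. ennreal (norm (F (A *v \<zeta> + circ \<theta> *s w \<zeta>)) powr p) \<partial>unit_interval)"
      by (intro powr_nn_integral_le prob_space_unit_interval p) auto
  qed
  also have "\<dots> = (\<integral>\<^sup>+\<theta>. (\<integral>\<^sup>+\<zeta>. ennreal (norm (F (A *v \<zeta> + circ \<theta> *s w \<zeta>)) powr p) \<partial>sphere_measure) \<partial>unit_interval)"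
  proof (rule IS.Fubini')
    have "continuous_on ({0..1} \<times> sphere 0 1) (\<lambda>(\<theta>, \<zeta>). F (A *v \<zeta> + circ \<theta> *s w \<zeta>))"
      unfolding split_beta
      by (intro continuous_on_compose2[OF contF] continuous_intros continuous_on_compose2[OF w])
        (use le1 in auto)
    from measurable_continuous_on_unit_sphere[OF this]
    show "(\<lambda>(\<theta>, \<zeta>). ennreal (norm (F (A *v \<zeta> + circ \<theta> *s w \<zeta>)) powr p)) \<in> borel_measurable (unit_interval \<Otimes>\<^sub>M sphere_measure)"
      by (simp add: split_beta)
  qed
  finally show ?thesis .
qed

text \<open>On the compact set of contractions \<open>A\<close>, the mean of \<open>|F (A \<zeta>)|\<^sup>p\<close> plus a small multiple of \<open>|A|\<^sup>2\<close>
  has a maximum. It cannot be at a non-isometric \<open>A\<close>: by the sub-mean value property, the average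
  over the complex circle of perturbations of \<open>A\<close> would be larger. So the maximum is at a unitary map, for
  which the mean is that of \<open>|F|\<^sup>p\<close>.\<close>

lemma nn_integral_contraction_le:
  fixes F :: "complex ^ 'N::finite \<Rightarrow> complex" and U :: "complex ^ 'N \<Rightarrow> complex ^ 'N"
  assumes F: "holo_on F (ball 0 R)" and R: "1 < R" and p: "1 \<le> p"
    and U: "Vector_Spaces.linear (*s) (*s) U" "\<And>z. norm (U z) \<le> norm z"
  shows "(\<integral>\<^sup>+\<zeta>. ennreal (norm (F (U \<zeta>)) powr p) \<partial>sphere_measure)
       \<le> (\<integral>\<^sup>+\<zeta>. ennreal (norm (F \<zeta>) powr p) \<partial>sphere_measure)"
proof -
  interpret S: prob_space "sphere_measure :: (complex ^ 'N) measure" by (rule prob_space_sphere_measure)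
  interpret I: prob_space unit_interval by (rule prob_space_unit_interval)
  define K where "K = {A :: complex ^ 'N ^ 'N. \<forall>x. norm (A *v x) \<le> norm x}"
  define g where "g z = norm (F z) powr p" for z
  define \<Phi> where "\<Phi> A = (\<integral>\<zeta>. g (A *v \<zeta>) \<partial>sphere_measure)" for A :: "complex ^ 'N ^ 'N"
  have contF: "continuous_on (cball 0 1) F"
    by (rule continuous_on_subset[OF holo_on_continuous[OF F]]) (use R in auto)
  have contg: "continuous_on (cball 0 1) g"
    unfolding g_def using p by (intro continuous_on_powr' continuous_intros contF) auto
  have g0: "0 \<le> g z" for z by (simp add: g_def)
  have "bounded (g ` cball 0 1)"
    by (intro compact_imp_bounded compact_continuous_image contg compact_cball)
  then obtain b where b: "\<And>z. norm z \<le> 1 \<Longrightarrow> g z \<le> b"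
    unfolding bounded_iff by (metis abs_le_D1 image_eqI mem_cball_0 real_norm_def)
  have K1: "norm (A *v \<zeta>) \<le> 1" if "A \<in> K" "norm \<zeta> = 1" for A \<zeta>
    using that by (auto simp: K_def) (metis)
  have meas: "(\<lambda>\<zeta>. g (A *v \<zeta>)) \<in> borel_measurable sphere_measure" if "A \<in> K" for A
    using K1[OF that]
    by (intro measurable_continuous_on_sphere continuous_on_compose2[OF contg] continuous_intros) auto
  have int: "integrable sphere_measure (\<lambda>\<zeta>. g (A *v \<zeta>))" if "A \<in> K" for A
    using K1[OF that] b g0 by (intro S.integrable_const_bound[where B=b] meas that AE_I2) auto
  have \<Phi>: "ennreal (\<Phi> A) = (\<integral>\<^sup>+\<zeta>. g (A *v \<zeta>) \<partial>sphere_measure)" if "A \<in> K" for A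
    unfolding \<Phi>_def by (rule nn_integral_eq_integral[symmetric]) (use int[OF that] g0 in auto)
  have \<Phi>0: "0 \<le> \<Phi> A" for A unfolding \<Phi>_def by (simp add: g0)
  have cont\<Phi>: "continuous_on K \<Phi>"
    unfolding continuous_on_sequentially
  proof (intro allI ballI impI, elim conjE)
    fix A and As :: "nat \<Rightarrow> complex ^ 'N ^ 'N"
    assume A: "A \<in> K" and As: "\<forall>n. As n \<in> K" "As \<longlonglongrightarrow> A"
    show "(\<Phi> \<circ> As) \<longlonglongrightarrow> \<Phi> A"
      unfolding \<Phi>_def comp_def
    proof (rule integral_dominated_convergence[where w="\<lambda>_. b"])
      show "AE \<zeta> in sphere_measure. (\<lambda>n. g (As n *v \<zeta>)) \<longlonglongrightarrow> g (A *v \<zeta>)"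
      proof (rule AE_I2)
        fix \<zeta> :: "complex ^ 'N" assume "\<zeta> \<in> space sphere_measure"
        hence z: "norm \<zeta> = 1" by simp
        have "continuous_on K (\<lambda>A. g (A *v \<zeta>))"
          using K1[OF _ z] by (intro continuous_on_compose2[OF contg] continuous_intros) auto
        thus "(\<lambda>n. g (As n *v \<zeta>)) \<longlonglongrightarrow> g (A *v \<zeta>)"
          unfolding continuous_on_sequentially comp_def using A As by blast
      qed
      show "AE \<zeta> in sphere_measure. norm (g (As n *v \<zeta>)) \<le> b" for n
        using K1 As b g0 by (intro AE_I2) auto
    qed (use meas A As in auto)
  qed
  \<comment> \<open>sub-mean value property of \<open>\<Phi>\<close> over a complex disc \<open>A + P t\<close> of contractions\<close>
  have rot: "ennreal (\<Phi> A) \<le> (\<integral>\<^sup>+\<theta>. ennreal (\<Phi> (A + P (circ \<theta>))) \<partial>unit_interval)"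
    if A: "A \<in> K" and AP: "\<And>t. norm t \<le> 1 \<Longrightarrow> A + P t \<in> K"
      and P: "\<And>t \<zeta>. P t *v \<zeta> = t *s w \<zeta>" and w: "continuous_on UNIV w" for A P w
    using nn_integral_rotation_le[OF F R p _ w, of A] AP
    by (simp add: \<Phi>[OF A] \<Phi>[OF AP] matrix_vector_mult_add_rdistrib P g_def K_def)
  have idK: "mat 1 \<in> K" by (simp add: K_def)
  have UK: "matrix U \<in> K" using U by (simp add: K_def matrix_works)
  have "bounded K" unfolding K_def by (intro compact_imp_bounded compact_contractions)
  then obtain k where k: "\<And>A. A \<in> K \<Longrightarrow> norm A \<le> k" unfolding bounded_iff by blast
  have main: "\<Phi> (matrix U) \<le> \<Phi> (mat 1) + \<eta> * k\<^sup>2" if \<eta>: "0 < \<eta>" for \<eta>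
  proof -
    define \<Psi> where "\<Psi> A = \<Phi> A + \<eta> * (norm A)\<^sup>2" for A
    have "continuous_on K \<Psi>" unfolding \<Psi>_def by (intro continuous_intros cont\<Phi>)
    moreover have "compact K" unfolding K_def by (rule compact_contractions)
    ultimately obtain V where V: "V \<in> K" "\<And>A. A \<in> K \<Longrightarrow> \<Psi> A \<le> \<Psi> V"
      using continuous_attains_sup[of K \<Psi>] idK by blast
    have iso: "norm (V *v x) = norm x" for x
    proof (rule ccontr)
      assume "norm (V *v x) \<noteq> norm x"
      then obtain y e where ye: "y \<noteq> 0" "e \<noteq> 0"
          "\<And>t x. norm t \<le> 1 \<Longrightarrow> norm (V *v x + t *s (cin x y *s e)) \<le> norm x"
        using contraction_perturbation[of V x] V(1) by (auto simp: K_def)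
      define P :: "complex \<Rightarrow> complex ^ 'N ^ 'N" where "P t = (\<chi> i j. t * (e $ i * cnj (y $ j)))" for t
      have P: "P t *v x = t *s (cin x y *s e)" for t x
        by (simp add: P_def matrix_vector_mult_def cin_def vec_eq_iff sum_distrib_left sum_distrib_right mult_ac)
      have PK: "V + P t \<in> K" if "norm t \<le> 1" for t
        using ye(3)[OF that] by (simp add: K_def matrix_vector_mult_add_rdistrib P)
      have Pm: "P (- t) = - P t" for t by (simp add: P_def vec_eq_iff)
      obtain i j where "e $ i \<noteq> 0" "y $ j \<noteq> 0" using ye by (auto simp: vec_eq_iff)
      hence "P 1 $ i $ j \<noteq> 0" by (simp add: P_def)
      hence "P 1 \<noteq> 0" by auto
      define \<nu> where "\<nu> = norm (P 1)"
      have \<nu>: "\<nu> > 0" using \<open>P 1 \<noteq> 0\<close> by (simp add: \<nu>_def)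
      have normP: "norm (P t) = \<nu>" if "norm t = 1" for t
        using that by (simp add: \<nu>_def P_def norm_vec_def norm_mult)
      \<comment> \<open>Adding the points \<open>t\<close> and \<open>- t\<close> removes the linear term of \<open>|V + P t|\<^sup>2\<close>.\<close>
      have le: "\<Phi> (V + P t) + \<Phi> (V + P (- t)) \<le> 2 * \<Phi> V - 2 * \<eta> * \<nu>\<^sup>2" if t: "norm t = 1" for t
      proof -
        have alg: "\<eta> * a + \<eta> * b = 2 * \<eta> * c + 2 * \<eta> * d" if "a + b = 2 * c + 2 * d" for a b c d
        proof -
          have "\<eta> * a + \<eta> * b = \<eta> * (a + b)" by (simp add: distrib_left)
          thus ?thesis unfolding that by (simp add: distrib_left)
        qed
        have "\<Psi> (V + P t) \<le> \<Psi> V" "\<Psi> (V + P (- t)) \<le> \<Psi> V"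
          using t by (auto intro!: V PK)
        moreover have "(norm (V + P t))\<^sup>2 + (norm (V + P (- t)))\<^sup>2 = 2 * (norm V)\<^sup>2 + 2 * \<nu>\<^sup>2"
        proof -
          have "(norm (V + P t))\<^sup>2 + (norm (V - P t))\<^sup>2 = 2 * (norm V)\<^sup>2 + 2 * (norm (P t))\<^sup>2"
            unfolding power2_norm_eq_inner
            by (simp add: inner_add_left inner_add_right inner_diff_left inner_diff_right)
          thus ?thesis using normP[OF t] by (simp add: Pm)
        qed
        hence "\<eta> * (norm (V + P t))\<^sup>2 + \<eta> * (norm (V + P (- t)))\<^sup>2 = 2 * \<eta> * (norm V)\<^sup>2 + 2 * \<eta> * \<nu>\<^sup>2"
          by (rule alg)
        ultimately show ?thesis by (simp add: \<Psi>_def)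
      qed
      have contw: "continuous_on UNIV (\<lambda>x. cin x y *s e)"
        unfolding cin_def by (intro continuous_intros)
      have contP: "continuous_on UNIV (\<lambda>\<theta>. V + P (s * circ \<theta>))" for s
        unfolding P_def by (intro continuous_intros)
      have meas\<Phi>: "(\<lambda>\<theta>. \<Phi> (V + P (s * circ \<theta>))) \<in> borel_measurable unit_interval" if "norm s = 1" for s
      proof -
        have "continuous_on UNIV (\<lambda>\<theta>. \<Phi> (V + P (s * circ \<theta>)))"
          by (rule continuous_on_compose2[OF cont\<Phi> contP]) (auto intro!: PK simp: norm_mult that)
        thus ?thesis by (intro measurable_restrict_space1) (simp add: borel_measurable_continuous_onI)
      qed
      have "ennreal (\<Phi> V) + ennreal (\<Phi> V) \<le> (\<integral>\<^sup>+\<theta>. ennreal (\<Phi> (V + P (circ \<theta>))) \<partial>unit_interval)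
          + (\<integral>\<^sup>+\<theta>. ennreal (\<Phi> (V + P (- circ \<theta>))) \<partial>unit_interval)"
      proof (rule add_mono)
        show "ennreal (\<Phi> V) \<le> (\<integral>\<^sup>+\<theta>. ennreal (\<Phi> (V + P (circ \<theta>))) \<partial>unit_interval)"
          by (rule rot[of V P "\<lambda>x. cin x y *s e"]) (use V PK P contw in auto)
        show "ennreal (\<Phi> V) \<le> (\<integral>\<^sup>+\<theta>. ennreal (\<Phi> (V + P (- circ \<theta>))) \<partial>unit_interval)"
          by (rule rot[of V "\<lambda>t. P (- t)" "\<lambda>x. - (cin x y *s e)"])
            (use V PK P contw in \<open>auto intro!: continuous_intros simp: vec_eq_iff\<close>)
      qed
      also have "\<dots> = (\<integral>\<^sup>+\<theta>. ennreal (\<Phi> (V + P (circ \<theta>)) + \<Phi> (V + P (- circ \<theta>))) \<partial>unit_interval)"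
        using meas\<Phi>[of 1] meas\<Phi>[of "- 1"] \<Phi>0
        by (subst nn_integral_add[symmetric]) (auto simp: ennreal_plus)
      also have "\<dots> \<le> (\<integral>\<^sup>+\<theta>. ennreal (2 * \<Phi> V - 2 * \<eta> * \<nu>\<^sup>2) \<partial>unit_interval)"
        by (intro nn_integral_mono ennreal_leI le) simp
      also have "\<dots> = ennreal (2 * \<Phi> V - 2 * \<eta> * \<nu>\<^sup>2)" using I.emeasure_space_1 by simp
      finally have "ennreal (2 * \<Phi> V) \<le> ennreal (2 * \<Phi> V - 2 * \<eta> * \<nu>\<^sup>2)"
        using \<Phi>0[of V] by (simp flip: ennreal_plus)
      moreover have "0 \<le> 2 * \<Phi> V - 2 * \<eta> * \<nu>\<^sup>2" using le[of 1] \<Phi>0[of "V + P 1"] \<Phi>0[of "V + P (- 1)"] by simp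
      ultimately have "2 * \<eta> * \<nu>\<^sup>2 \<le> 0" by (simp add: ennreal_le_iff)
      moreover have "0 < 2 * \<eta> * \<nu>\<^sup>2" using \<eta> \<nu> by simp
      ultimately show False by simp
    qed
    have "unitary_op (\<lambda>z. V *v z)" using iso by (simp add: unitary_op_def matrix_vector_mul_linear_gen)
    moreover have "(\<lambda>z. ennreal (indicator (cball 0 1) z *\<^sub>R g z)) \<in> borel_measurable borel"
      by (intro measurable_compose[OF borel_measurable_continuous_on_indicator[OF _ contg]]) auto
    ultimately have "(\<integral>\<^sup>+\<zeta>. ennreal (indicator (cball 0 1) (V *v \<zeta>) *\<^sub>R g (V *v \<zeta>)) \<partial>sphere_measure)
        = (\<integral>\<^sup>+\<zeta>. ennreal (indicator (cball 0 1) \<zeta> *\<^sub>R g \<zeta>) \<partial>sphere_measure)"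
      by (rule nn_integral_sphere_unitary)
    moreover have "(\<integral>\<^sup>+\<zeta>. ennreal (indicator (cball 0 1) (A *v \<zeta>) *\<^sub>R g (A *v \<zeta>)) \<partial>sphere_measure) = ennreal (\<Phi> A)"
      if "A \<in> K" for A
      unfolding \<Phi>[OF that] using K1[OF that] by (intro nn_integral_cong) auto
    from this[OF V(1)] this[OF idK]
    have "ennreal (\<Phi> V) = ennreal (\<Phi> (mat 1))" using calculation by simp
    hence "\<Phi> V = \<Phi> (mat 1)" using \<Phi>0 by simp
    moreover have "\<Psi> (matrix U) \<le> \<Psi> V" by (rule V(2)[OF UK])
    moreover have "\<eta> * (norm V)\<^sup>2 \<le> \<eta> * k\<^sup>2" using \<eta> k[OF V(1)] by (intro mult_left_mono power_mono) auto
    moreover have "0 \<le> \<eta> * (norm (matrix U))\<^sup>2" using \<eta> by simp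
    ultimately show ?thesis by (simp add: \<Psi>_def)
  qed
  have "\<Phi> (matrix U) \<le> \<Phi> (mat 1) + e" if "0 < e" for e
  proof -
    have "0 < e / (k\<^sup>2 + 1)" using that by (intro divide_pos_pos add_nonneg_pos) auto
    from main[OF this] have "\<Phi> (matrix U) \<le> \<Phi> (mat 1) + e / (k\<^sup>2 + 1) * k\<^sup>2" .
    also have "e / (k\<^sup>2 + 1) * k\<^sup>2 \<le> e / (k\<^sup>2 + 1) * (k\<^sup>2 + 1)"
      using that by (intro mult_left_mono divide_nonneg_pos add_nonneg_pos) auto
    also have "\<dots> = e" using add_nonneg_pos[of "k\<^sup>2" 1] by simp
    finally show ?thesis by simp
  qed
  hence "\<Phi> (matrix U) \<le> \<Phi> (mat 1)" by (rule field_le_epsilon)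
  hence "ennreal (\<Phi> (matrix U)) \<le> ennreal (\<Phi> (mat 1))" by (rule ennreal_leI)
  thus ?thesis by (simp add: \<Phi>[OF UK] \<Phi>[OF idK] g_def matrix_works[OF U(1)])
qed


section \<open>Averages over nonisotropic neighbourhoods\<close>

text \<open>The neighbourhood of \<open>(1 - u\<^sup>2) z\<close> has radius of the order \<open>u\<^sup>2\<close> in the complex direction \<open>z\<close>, but
  \<open>u\<close> in the directions orthogonal to \<open>z\<close>; up to constants, this is the largest size for which it
  stays in the ball.\<close>

definition tent :: "real \<Rightarrow> complex ^ 'N::finite \<Rightarrow> (complex ^ 'N) set" where
  "tent u z = {a. norm (cin a z - of_real (1 - u\<^sup>2)) < u\<^sup>2 / 2 \<and> norm (a - cin a z *s z) < u / 2}"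

text \<open>A tent of half the size, moved to the origin. It is circled, and its translate to a point near the centre of
  the tent stays in the tent.\<close>

definition tent_core :: "real \<Rightarrow> complex ^ 'N::finite \<Rightarrow> (complex ^ 'N) set" where
  "tent_core u z = {x. norm (cin x z) < u\<^sup>2 / 4 \<and> norm (x - cin x z *s z) < u / 4}"

lemma cin_perp: "norm z = 1 \<Longrightarrow> cin (a - cin a z *s z) z = 0"
  by (simp add: cin_diff_left cin_scale_left cin_self)

lemma norm_decompose:
  assumes "norm z = 1"
  shows "(norm a)\<^sup>2 = (norm (cin a z))\<^sup>2 + (norm (a - cin a z *s z))\<^sup>2"
  using norm_perp_add[OF cin_perp[OF assms, of a], of "cin a z"] assms by simp

lemma continuous_on_cin [continuous_intros]:
  "continuous_on S f \<Longrightarrow> continuous_on S g \<Longrightarrow> continuous_on S (\<lambda>x. cin (f x) (g x))"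
  unfolding cin_def by (intro continuous_intros)

lemma borel_measurable_cin [measurable]:
  fixes f g :: "'a \<Rightarrow> complex ^ 'N::finite"
  assumes "f \<in> borel_measurable M" "g \<in> borel_measurable M"
  shows "(\<lambda>x. cin (f x) (g x)) \<in> borel_measurable M"
  by (rule borel_measurable_continuous_Pair[OF assms]) (intro continuous_intros)

lemma borel_measurable_cscale [measurable]:
  fixes g :: "'a \<Rightarrow> complex ^ 'N::finite"
  assumes "f \<in> borel_measurable M" "g \<in> borel_measurable M"
  shows "(\<lambda>x. f x *s g x) \<in> borel_measurable M"
  by (rule borel_measurable_continuous_Pair[OF assms]) (intro continuous_intros)

lemma borel_measurable_circ [measurable]: "circ \<in> borel_measurable borel"
  by (intro borel_measurable_continuous_onI continuous_intros)

lemma tent_subset_ball: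
  assumes z: "norm z = 1" and u: "0 < u" "u \<le> 1"
  shows "tent u z \<subseteq> ball 0 1"
proof
  fix a assume a: "a \<in> tent u z"
  have a1: "norm (cin a z - of_real (1 - u\<^sup>2)) < u\<^sup>2 / 2"
    using a by (simp only: tent_def mem_Collect_eq)
  have u2: "u\<^sup>2 \<le> 1" "0 < u\<^sup>2" using u by (auto simp: power_le_one)
  have "norm (cin a z) \<le> norm (cin a z - of_real (1 - u\<^sup>2)) + norm (complex_of_real (1 - u\<^sup>2))"
    by (metis add.commute norm_triangle_sub)
  also have "norm (complex_of_real (1 - u\<^sup>2)) = 1 - u\<^sup>2" using u2 by (simp only: norm_of_real)
  finally have "norm (cin a z) < 1 - u\<^sup>2 / 2" using a1 by linarith
  hence "(norm (cin a z))\<^sup>2 < (1 - u\<^sup>2 / 2)\<^sup>2" by (intro power_strict_mono) auto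
  moreover have "(norm (a - cin a z *s z))\<^sup>2 < (u / 2)\<^sup>2"
    using a by (intro power_strict_mono) (auto simp: tent_def)
  ultimately have "(norm a)\<^sup>2 < (1 - u\<^sup>2 / 2)\<^sup>2 + (u / 2)\<^sup>2"
    using norm_decompose[OF z, of a] by linarith
  also have "\<dots> = 1 - u\<^sup>2 * (3 / 4 - u\<^sup>2 / 4)" by (simp add: power2_eq_square algebra_simps)
  also have "\<dots> \<le> 1" using u2 by simp
  finally show "a \<in> ball 0 1" by (simp add: power_less_one_iff)
qed

lemma tent_core_translate:
  assumes z: "norm z = 1" and v: "cin v z = 0" "norm v \<le> u / 4" and x: "x \<in> tent_core u z"
  shows "of_real (1 - u\<^sup>2) *s z + v + x \<in> tent u z"
proof -
  let ?b = "of_real (1 - u\<^sup>2) *s z + v"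
  have b: "cin (?b + x) z = of_real (1 - u\<^sup>2) + cin x z"
    using z v by (simp add: cin_add_left cin_diff_left cin_scale_left cin_self)
  have "?b + x - cin (?b + x) z *s z = v + (x - cin x z *s z)"
    unfolding b by (simp add: vec.scale_left_distrib)
  also have "norm \<dots> \<le> norm v + norm (x - cin x z *s z)" by (rule norm_triangle_ineq)
  finally have "norm (?b + x - cin (?b + x) z *s z) < u / 2" using v x by (simp add: tent_core_def)
  moreover have "norm (cin (?b + x) z - of_real (1 - u\<^sup>2)) < u\<^sup>2 / 2"
    using x unfolding b by (simp add: tent_core_def) (smt (verit) zero_le_power2)
  ultimately show ?thesis by (simp add: tent_def)
qed

lemma tent_core_circled:
  assumes "x \<in> tent_core u z" "norm t \<le> 1"
  shows "t *s x \<in> tent_core u z"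
proof -
  have "norm (cin (t *s x) z) \<le> norm (cin x z)"
    using assms(2) by (simp add: cin_scale_left norm_mult mult_left_le_one_le)
  moreover have "t *s x - cin (t *s x) z *s z = t *s (x - cin x z *s z)"
    by (simp add: cin_scale_left vec.scale_right_diff_distrib)
  hence "norm (t *s x - cin (t *s x) z *s z) \<le> norm (x - cin x z *s z)"
    using assms(2) by (simp only: norm_cscale) (rule mult_left_le_one_le; simp)
  ultimately show ?thesis using assms(1) by (auto simp: tent_core_def)
qed

lemma sets_tent [measurable]: "tent u z \<in> sets borel" "tent_core u z \<in> sets borel"
  unfolding tent_def tent_core_def by measurable

lemma emeasure_tent:
  fixes z :: "complex ^ 'N::finite"
  assumes z: "norm z = 1" and u: "0 < u" "u \<le> 1"
  shows "emeasure lborel (tent u z) = ennreal (2 ^ DIM(complex ^ 'N)) * emeasure lborel (tent_core u z)"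
    and "emeasure lborel (tent u z) \<noteq> 0" "emeasure lborel (tent u z) \<noteq> \<infinity>"
    and "emeasure lborel (tent_core u z) \<noteq> 0" "emeasure lborel (tent_core u z) \<noteq> \<infinity>"
proof -
  have "{x. of_real (1 - u\<^sup>2) *s z + 2 *\<^sub>R x \<in> tent u z} = tent_core u z"
  proof (rule set_eqI)
    fix x
    let ?a = "of_real (1 - u\<^sup>2) *s z + 2 *\<^sub>R x"
    have a: "cin ?a z = of_real (1 - u\<^sup>2) + 2 * cin x z"
      using z by (simp add: cin_add_left cin_diff_left cin_scale_left cin_self scaleR_cscale)
    have "?a - cin ?a z *s z = 2 *\<^sub>R (x - cin x z *s z)"
      unfolding a by (simp add: vec.scale_left_distrib vec.scale_right_diff_distrib scaleR_cscale)
    hence "norm (?a - cin ?a z *s z) = 2 * norm (x - cin x z *s z)" by simp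
    moreover have "norm (cin ?a z - of_real (1 - u\<^sup>2)) = 2 * norm (cin x z)"
      unfolding a by (simp add: norm_mult)
    ultimately show "x \<in> {x. of_real (1 - u\<^sup>2) *s z + 2 *\<^sub>R x \<in> tent u z} \<longleftrightarrow> x \<in> tent_core u z"
      by (auto simp: tent_def tent_core_def)
  qed
  thus eq: "emeasure lborel (tent u z) = ennreal (2 ^ DIM(complex ^ 'N)) * emeasure lborel (tent_core u z)"
    using emeasure_lborel_affine[of 2 "tent u z" "of_real (1 - u\<^sup>2) *s z"] by simp
  have "emeasure lborel (tent u z) \<le> emeasure lborel (ball (0::complex ^ 'N) 1)"
    by (intro emeasure_mono tent_subset_ball assms) auto
  also have "\<dots> < \<infinity>" by (rule emeasure_lborel_ball_finite)
  finally show fin: "emeasure lborel (tent u z) \<noteq> \<infinity>" by simp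
  have "ball 0 (u\<^sup>2 / 4) \<subseteq> tent_core u z"
  proof
    fix x :: "complex ^ 'N" assume "x \<in> ball 0 (u\<^sup>2 / 4)"
    hence x: "norm x < u\<^sup>2 / 4" by simp
    have "u\<^sup>2 \<le> u" using u by (simp add: power2_eq_square mult_left_le)
    moreover have "norm (cin x z) \<le> norm x" using norm_cin_le[of x z] z by simp
    moreover have "(norm (x - cin x z *s z))\<^sup>2 \<le> (norm x)\<^sup>2"
      using norm_decompose[OF z, of x] zero_le_power2[of "norm (cin x z)"] by linarith
    hence "norm (x - cin x z *s z) \<le> norm x" by (rule power2_le_imp_le) simp
    ultimately show "x \<in> tent_core u z" using x by (auto simp: tent_core_def)
  qed
  hence "emeasure lborel (ball (0::complex ^ 'N) (u\<^sup>2 / 4)) \<le> emeasure lborel (tent_core u z)"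
    by (intro emeasure_mono) auto
  moreover have "emeasure lborel (ball (0::complex ^ 'N) (u\<^sup>2 / 4)) \<noteq> 0"
    using u unit_ball_vol_pos[of "real DIM(complex ^ 'N)"] by (simp add: emeasure_ball del: unit_ball_vol_pos)
  ultimately show nz: "emeasure lborel (tent_core u z) \<noteq> 0" by auto
  show "emeasure lborel (tent u z) \<noteq> 0" using nz by (simp add: eq)
  show "emeasure lborel (tent_core u z) \<noteq> \<infinity>"
    using fin unfolding eq by (auto simp: ennreal_mult_eq_top_iff)
qed

lemma tent_unitary:
  assumes V: "unitary_op V"
  shows "V a \<in> tent u (V z) \<longleftrightarrow> a \<in> tent u z"
proof -
  have lin: "Vector_Spaces.linear (*s) (*s) V" and iso: "\<And>x. norm (V x) = norm x"
    using V by (auto simp: unitary_op_def)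
  have "V a - cin a z *s V z = V (a - cin a z *s z)" by (simp add: clinearD[OF lin])
  thus ?thesis by (simp add: tent_def unitary_cin[OF V] iso)
qed

lemma emeasure_tent_const:
  fixes z z' :: "complex ^ 'N::finite"
  assumes "norm z = 1" "norm z' = 1"
  shows "emeasure lborel (tent u z) = emeasure lborel (tent u z')"
proof -
  obtain V where V: "unitary_op V" "V z = z'" using unitary_transitive[of z z'] assms by auto
  hence lin: "linear V" and iso: "\<And>x. norm (V x) = norm x"
    by (auto simp: unitary_op_def clinear_imp_linear)
  have "(\<integral>\<^sup>+a. indicator (tent u z') (V a) \<partial>lborel) = (\<integral>\<^sup>+a. indicator (tent u z') a \<partial>lborel)"
    by (rule nn_integral_lborel_isometry[OF lin iso]) measurable
  moreover have "indicator (tent u z') (V a) = (indicator (tent u z) a :: ennreal)" for a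
    using tent_unitary[OF V(1), of a u z] V(2) by (simp add: indicator_def)
  ultimately show ?thesis by simp
qed

text \<open>Sub-mean value property over a circled neighbourhood: average first over the circles
  \<open>\<theta> \<mapsto> e\<^sup>i\<^sup>\<theta> x\<close>, under which the neighbourhood is invariant.\<close>

lemma submean_tent_core:
  fixes g :: "complex ^ 'N::finite \<Rightarrow> complex"
  assumes g: "holo_on g (ball 0 1)" and z: "norm z = 1" and u: "0 < u" "u \<le> 1"
    and v: "cin v z = 0" "norm v \<le> u / 4"
  shows "ennreal (norm (g (of_real (1 - u\<^sup>2) *s z + v))) * emeasure lborel (tent_core u z)
      \<le> (\<integral>\<^sup>+a\<in>tent u z. ennreal (norm (g a)) \<partial>lborel)"
proof -
  interpret I: prob_space unit_interval by (rule prob_space_unit_interval)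
  interpret IL: pair_sigma_finite unit_interval "lborel :: (complex ^ 'N) measure" ..
  define b where "b = of_real (1 - u\<^sup>2) *s z + v"
  define G where "G a = (indicator (ball 0 1) a *\<^sub>R norm (g a) :: real)" for a
  have [measurable]: "G \<in> borel_measurable borel"
    unfolding G_def
    by (intro borel_measurable_continuous_on_indicator continuous_on_norm holo_on_continuous[OF g]) simp
  have bt: "b + x \<in> tent u z" if "x \<in> tent_core u z" for x
    unfolding b_def by (rule tent_core_translate[OF z v that])
  have G: "G a = norm (g a)" if "a \<in> tent u z" for a
    using that tent_subset_ball[OF z u] by (auto simp: G_def)
  have [measurable]: "circ \<in> borel_measurable unit_interval"
    by (rule measurable_restrict_space1) simp
  let ?K = "indicator (tent_core u z) :: _ \<Rightarrow> ennreal"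
  have "ennreal (norm (g b)) * emeasure lborel (tent_core u z) = (\<integral>\<^sup>+x. ennreal (norm (g b)) * ?K x \<partial>lborel)"
    by (simp add: nn_integral_cmult)
  also have "\<dots> \<le> (\<integral>\<^sup>+x. (\<integral>\<^sup>+\<theta>. ennreal (G (b + circ \<theta> *s x)) * ?K (circ \<theta> *s x) \<partial>unit_interval) \<partial>lborel)"
  proof (rule nn_integral_mono)
    fix x
    show "ennreal (norm (g b)) * ?K x \<le> (\<integral>\<^sup>+\<theta>. ennreal (G (b + circ \<theta> *s x)) * ?K (circ \<theta> *s x) \<partial>unit_interval)"
    proof (cases "x \<in> tent_core u z")
      case True
      have inball: "b + t *s x \<in> ball 0 1" if "norm t \<le> 1" for t
        using bt[OF tent_core_circled[OF True that]] tent_subset_ball[OF z u] by blast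
      have cont: "continuous_on {0..1} (\<lambda>\<theta>. g (b + circ \<theta> *s x))"
        by (intro continuous_on_compose2[OF holo_on_continuous[OF g]] continuous_intros)
          (use inball in auto)
      have "((\<lambda>\<theta>. g (b + circ \<theta> *s x)) has_integral g b) {0..1}"
        by (rule mean_value_circle(1)[OF g]) (use inball in auto)
      hence "ennreal (norm (g b)) \<le> (\<integral>\<^sup>+\<theta>. norm (g (b + circ \<theta> *s x)) \<partial>unit_interval)"
        using norm_integral_le_nn_integral[OF cont] by (simp add: integral_unique)
      also have "\<dots> = (\<integral>\<^sup>+\<theta>. ennreal (G (b + circ \<theta> *s x)) * ?K (circ \<theta> *s x) \<partial>unit_interval)"
        using tent_core_circled[OF True] by (intro nn_integral_cong) (simp add: G bt)
      finally show ?thesis using True by simp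
    qed simp
  qed
  also have "\<dots> = (\<integral>\<^sup>+\<theta>. (\<integral>\<^sup>+x. ennreal (G (b + circ \<theta> *s x)) * ?K (circ \<theta> *s x) \<partial>lborel) \<partial>unit_interval)"
    by (rule IL.Fubini') measurable
  also have "\<dots> = (\<integral>\<^sup>+\<theta>. (\<integral>\<^sup>+x. ennreal (G (b + x)) * ?K x \<partial>lborel) \<partial>unit_interval)"
  proof (rule nn_integral_cong)
    fix \<theta>
    have lin: "linear (\<lambda>x. circ \<theta> *s (x :: complex ^ 'N))"
      by (rule linearI) (simp_all add: vec_eq_iff algebra_simps)
    show "(\<integral>\<^sup>+x. ennreal (G (b + circ \<theta> *s x)) * ?K (circ \<theta> *s x) \<partial>lborel)
        = (\<integral>\<^sup>+x. ennreal (G (b + x)) * ?K x \<partial>lborel)"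
      by (rule nn_integral_lborel_isometry[OF lin]) (simp_all add: norm_cscale)
  qed
  also have "\<dots> = (\<integral>\<^sup>+x. ennreal (G (b + x)) * ?K x \<partial>lborel)" using I.emeasure_space_1 by simp
  also have "\<dots> = (\<integral>\<^sup>+x. ennreal (G (b + x)) * ?K (b + x - b) \<partial>lborel)" by simp
  also have "\<dots> = (\<integral>\<^sup>+a. ennreal (G a) * ?K (a - b) \<partial>lborel)"
    by (rule nn_integral_lborel_plus) measurable
  also have "\<dots> \<le> (\<integral>\<^sup>+a\<in>tent u z. ennreal (norm (g a)) \<partial>lborel)"
    using bt[of "a - b" for a] by (intro nn_integral_mono) (auto simp: indicator_def G)
  finally show ?thesis by (simp add: b_def)
qed

text \<open>For \<open>u = 0\<close> the tent is empty and the average is \<open>0 / 0 = 0\<close>.\<close>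

definition tent_average :: "(complex ^ 'N::finite \<Rightarrow> real) \<Rightarrow> real \<Rightarrow> complex ^ 'N \<Rightarrow> real" where
  "tent_average G u z =
     enn2real ((\<integral>\<^sup>+a\<in>tent u z. ennreal (G a) \<partial>lborel) / emeasure lborel (tent u z))"

lemma measurable_tent_average:
  fixes z :: "'a \<Rightarrow> complex ^ 'N::finite"
  assumes [measurable]: "u \<in> borel_measurable M" "z \<in> borel_measurable M" "G \<in> borel_measurable borel"
  shows "(\<lambda>x. tent_average G (u x) (z x)) \<in> borel_measurable M"
proof -
  have [measurable]: "Measurable.pred (M \<Otimes>\<^sub>M lborel) (\<lambda>(x, a). a \<in> tent (u x) (z x))"
    unfolding tent_def by measurable
  have [measurable]: "(\<lambda>(x, a). indicator (tent (u x) (z x)) a :: ennreal) \<in> borel_measurable (M \<Otimes>\<^sub>M lborel)"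
    unfolding indicator_def by measurable
  have "emeasure lborel (tent (u x) (z x)) = (\<integral>\<^sup>+a. indicator (tent (u x) (z x)) a \<partial>lborel)" for x
    by simp
  thus ?thesis unfolding tent_average_def by simp
qed

lemma tent_average_eq:
  fixes G :: "complex ^ 'N::finite \<Rightarrow> real"
  assumes z: "norm z = 1" and u: "0 < u" "u \<le> 1"
    and G: "\<And>a. norm a < 1 \<Longrightarrow> G a \<le> b"
  shows "ennreal (tent_average G u z) = (\<integral>\<^sup>+a\<in>tent u z. ennreal (G a) \<partial>lborel) / emeasure lborel (tent u z)"
proof -
  have "(\<integral>\<^sup>+a\<in>tent u z. ennreal (G a) \<partial>lborel) \<le> (\<integral>\<^sup>+a\<in>tent u z. ennreal b \<partial>lborel)"
    using tent_subset_ball[OF z u]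
    by (intro nn_integral_mono) (auto simp: indicator_def intro!: ennreal_leI G)
  also have "\<dots> = ennreal b * emeasure lborel (tent u z)"
    by (simp add: nn_integral_cmult)
  also have "\<dots> < \<top>" using emeasure_tent(2,3)[OF z u] by (simp add: ennreal_mult_less_top less_top)
  finally have "(\<integral>\<^sup>+a\<in>tent u z. ennreal (G a) \<partial>lborel) / emeasure lborel (tent u z) < \<top>"
    using emeasure_tent(2)[OF z u] by (metis ennreal_divide_eq_top_iff less_top)
  thus ?thesis unfolding tent_average_def by simp
qed

text \<open>The average over tents does not increase the mean of order \<open>p\<close>. By Jensen's inequality and
  Fubini this is an integral of \<open>G\<^sup>p\<close> over the ball against the weight \<open>\<sigma> {z. a \<in> tent u z}\<close>, and this weight is
  radial because tents are mapped to tents by unitary maps.\<close>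

lemma nn_integral_tent_average_le:
  fixes G :: "complex ^ 'N::finite \<Rightarrow> real"
  assumes [measurable]: "G \<in> borel_measurable borel" and G0: "\<And>a. 0 \<le> G a"
    and Gb: "\<And>a. norm a < 1 \<Longrightarrow> G a \<le> b" and u: "0 < u" "u \<le> 1" and p: "1 \<le> p"
    and C: "\<And>r. 0 < r \<Longrightarrow> r < 1 \<Longrightarrow> (\<integral>\<^sup>+\<zeta>. ennreal (G (r *\<^sub>R \<zeta>) powr p) \<partial>sphere_measure) \<le> C"
  shows "(\<integral>\<^sup>+\<zeta>. ennreal (tent_average G u \<zeta> powr p) \<partial>sphere_measure) \<le> C"
proof -
  interpret S: prob_space "sphere_measure :: (complex ^ 'N) measure" by (rule prob_space_sphere_measure)
  interpret SL: pair_sigma_finite "sphere_measure :: (complex ^ 'N) measure" "lborel :: (complex ^ 'N) measure" ..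
  obtain z\<^sub>0 :: "complex ^ 'N" where z\<^sub>0: "norm z\<^sub>0 = 1" using vector_choose_size[of 1] by auto
  define \<tau> where "\<tau> = emeasure lborel (tent u z\<^sub>0)"
  have \<tau>: "\<tau> \<noteq> 0" "\<tau> \<noteq> \<infinity>" using emeasure_tent[OF z\<^sub>0 u] by (auto simp: \<tau>_def)
  have tent: "emeasure lborel (tent u z) = \<tau>" if "norm z = 1" for z :: "complex ^ 'N"
    using emeasure_tent_const[OF that z\<^sub>0] by (simp add: \<tau>_def)
  have meas2: "(\<lambda>(\<zeta> :: complex ^ 'N, a). indicator (tent u \<zeta>) a :: ennreal) \<in> borel_measurable (sphere_measure \<Otimes>\<^sub>M lborel)"
    "(\<lambda>(\<zeta> :: complex ^ 'N, a). indicator (tent u \<zeta>) a :: ennreal) \<in> borel_measurable (borel \<Otimes>\<^sub>M borel)"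
  proof -
    have [measurable]: "Measurable.pred (borel \<Otimes>\<^sub>M borel) (\<lambda>(\<zeta>, a). a \<in> tent u (\<zeta> :: complex ^ 'N))"
      unfolding tent_def by measurable
    show *: "(\<lambda>(\<zeta> :: complex ^ 'N, a). indicator (tent u \<zeta>) a :: ennreal) \<in> borel_measurable (borel \<Otimes>\<^sub>M borel)"
      unfolding indicator_def by measurable
    have "(\<lambda>x. (fst x, snd x)) \<in> sphere_measure \<Otimes>\<^sub>M lborel \<rightarrow>\<^sub>M (borel :: (complex ^ 'N) measure) \<Otimes>\<^sub>M (borel :: (complex ^ 'N) measure)"
      using measurable_compose[OF measurable_fst measurable_id_sphere]
      by (intro measurable_Pair) (simp_all add: measurable_snd measurable_lborel1 cong: measurable_cong_sets)
    from measurable_compose[OF this *]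
    show "(\<lambda>(\<zeta> :: complex ^ 'N, a). indicator (tent u \<zeta>) a :: ennreal) \<in> borel_measurable (sphere_measure \<Otimes>\<^sub>M lborel)"
      by simp
  qed
  note [measurable] = meas2
  define m where "m a = (\<integral>\<^sup>+\<zeta>. indicator (tent u \<zeta>) a \<partial>sphere_measure)" for a :: "complex ^ 'N"
  have m [measurable]: "m \<in> borel_measurable borel"
  proof -
    have "(\<lambda>(a, \<zeta>). indicator (tent u \<zeta>) a :: ennreal) \<in> borel_measurable (lborel \<Otimes>\<^sub>M (sphere_measure :: (complex ^ 'N) measure))"
      using measurable_pair_swap[OF meas2(1)] by (simp add: split_beta)
    from S.borel_measurable_nn_integral[OF this] show ?thesis
      unfolding m_def by simp
  qed
  have sec: "(\<lambda>\<zeta>. indicator (tent u \<zeta>) a :: ennreal) \<in> borel_measurable borel" for a :: "complex ^ 'N"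
    using measurable_compose[OF measurable_Pair2'[of a] meas2(2)] by simp
  have radial: "m a = m b" if ab: "norm a = norm b" for a b :: "complex ^ 'N"
  proof -
    obtain V where V: "unitary_op V" "V a = b" using unitary_transitive[OF ab] by blast
    have "m b = (\<integral>\<^sup>+\<zeta>. indicator (tent u (V \<zeta>)) b \<partial>sphere_measure)"
      unfolding m_def by (rule nn_integral_sphere_unitary[OF V(1) sec, symmetric])
    also have "\<dots> = m a"
      unfolding m_def V(2)[symmetric] using tent_unitary[OF V(1)] by (simp add: indicator_def)
    finally show ?thesis by simp
  qed
  have "(\<integral>\<^sup>+\<zeta>. ennreal (tent_average G u \<zeta> powr p) \<partial>sphere_measure)
     \<le> (\<integral>\<^sup>+\<zeta>. (\<integral>\<^sup>+a. indicator (tent u \<zeta>) a * ennreal (G a powr p) \<partial>lborel) / \<tau> \<partial>sphere_measure)"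
  proof (rule nn_integral_mono)
    fix \<zeta> :: "complex ^ 'N" assume "\<zeta> \<in> space sphere_measure"
    hence z: "norm \<zeta> = 1" by simp
    have "ennreal (tent_average G u \<zeta>) = (\<integral>\<^sup>+a. G a \<partial>uniform_measure lborel (tent u \<zeta>))"
      using tent_average_eq[where G=G, OF z u Gb] by (subst nn_integral_uniform_measure) simp_all
    hence "ennreal (tent_average G u \<zeta> powr p) \<le> (\<integral>\<^sup>+a. ennreal (G a powr p) \<partial>uniform_measure lborel (tent u \<zeta>))"
      using emeasure_tent[OF z u] p G0
      by (intro powr_nn_integral_le prob_space_uniform_measure) (auto simp: tent_average_def cong: measurable_cong_sets)
    also have "\<dots> = (\<integral>\<^sup>+a. indicator (tent u \<zeta>) a * ennreal (G a powr p) \<partial>lborel) / \<tau>"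
      by (subst nn_integral_uniform_measure) (simp_all add: tent[OF z] mult.commute)
    finally show "ennreal (tent_average G u \<zeta> powr p)
        \<le> (\<integral>\<^sup>+a. indicator (tent u \<zeta>) a * ennreal (G a powr p) \<partial>lborel) / \<tau>" .
  qed
  also have "\<dots> = (\<integral>\<^sup>+\<zeta>. (\<integral>\<^sup>+a. indicator (tent u \<zeta>) a * ennreal (G a powr p) \<partial>lborel) \<partial>sphere_measure) / \<tau>"
    by (rule nn_integral_divide) measurable
  also have "(\<integral>\<^sup>+\<zeta>. (\<integral>\<^sup>+a. indicator (tent u \<zeta>) a * ennreal (G a powr p) \<partial>lborel) \<partial>sphere_measure)
      = (\<integral>\<^sup>+a. (\<integral>\<^sup>+\<zeta>. indicator (tent u \<zeta>) a * ennreal (G a powr p) \<partial>sphere_measure) \<partial>lborel)"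
    by (rule SL.Fubini'[symmetric]) measurable
  also have "\<dots> = (\<integral>\<^sup>+a. m a * ennreal (G a powr p) \<partial>lborel)"
    unfolding m_def by (intro nn_integral_cong nn_integral_multc measurable_from_borel_sphere sec)
  also have m0: "m a = m a * indicator (ball 0 1) a" for a
  proof (cases "norm a < 1")
    case False
    have "m a = (\<integral>\<^sup>+\<zeta>. 0 \<partial>(sphere_measure :: (complex ^ 'N) measure))"
      unfolding m_def
    proof (rule nn_integral_cong)
      fix \<zeta> :: "complex ^ 'N" assume "\<zeta> \<in> space sphere_measure"
      thus "indicator (tent u \<zeta>) a = (0::ennreal)"
        using tent_subset_ball[of \<zeta> u] u False by (auto simp: indicator_def)
    qed
    thus ?thesis using False by simp
  qed simp
  hence "(\<integral>\<^sup>+a. m a * ennreal (G a powr p) \<partial>lborel) = (\<integral>\<^sup>+a\<in>ball 0 1. m a * ennreal (G a powr p) \<partial>lborel)"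
    by (intro nn_integral_cong) (metis mult.commute mult.left_commute)
  also have "\<dots> \<le> C * (\<integral>\<^sup>+a\<in>ball 0 1. m a \<partial>lborel)"
    by (rule nn_integral_radial_weight_le[OF m _ radial C]) auto
  also have "(\<integral>\<^sup>+a\<in>ball 0 1. m a \<partial>lborel) = (\<integral>\<^sup>+a. m a \<partial>lborel)"
    using m0 by simp
  also have "\<dots> = (\<integral>\<^sup>+\<zeta>. (\<integral>\<^sup>+a. indicator (tent u (\<zeta> :: complex ^ 'N)) a \<partial>lborel) \<partial>sphere_measure)"
    unfolding m_def using SL.Fubini'[of "\<lambda>\<zeta> a. indicator (tent u \<zeta>) a"] meas2(1) by simp
  also have "\<dots> = (\<integral>\<^sup>+\<zeta>. \<tau> \<partial>(sphere_measure :: (complex ^ 'N) measure))"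
    by (intro nn_integral_cong) (simp add: tent)
  also have "\<dots> = \<tau>" using S.emeasure_space_1 by simp
  finally have "(\<integral>\<^sup>+\<zeta>. ennreal (tent_average G u \<zeta> powr p) \<partial>sphere_measure) \<le> C * \<tau> / \<tau>"
    by (simp add: divide_right_mono_ennreal)
  thus ?thesis using \<tau> by (simp add: ennreal_mult_divide_eq)
qed


section \<open>The full gradient is controlled by the radial derivative\<close>

lemma dirderiv_commute:
  assumes "holo_on f S" "open S" "a \<in> S"
  shows "dirderiv (dirderiv f v) h a = dirderiv (dirderiv f h) v a"
proof -
  have "(\<lambda>h. dirderiv (dirderiv f v) h a) = (\<lambda>h. dirderiv (dirderiv f h) v a)"
    by (rule has_derivative_unique[OF holo_on_has_derivative(1)[OF holo_on_dirderiv[OF assms(1,2)] assms(3)]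
        has_derivative_dirderiv(1)[OF assms]])
  thus ?thesis by (rule fun_cong)
qed

text \<open>The product rule for \<open>Rad f = (\<Sum>j. z\<^sub>j \<partial>\<^sub>j f)\<close>, together with the symmetry of second derivatives. At \<open>x = t z\<close>, the
  right-hand side is the derivative of \<open>t \<mapsto> t \<partial>\<^sub>w f (t z)\<close>.\<close>

lemma dirderiv_Rad:
  assumes f: "holo_on f S" and S: "open S" and x: "x \<in> S"
  shows "dirderiv (Rad f) w x = dirderiv f w x + dirderiv (dirderiv f w) x x"
proof -
  let ?E = "\<lambda>j. axis j (1::complex)"
  have "((\<lambda>y. \<Sum>j\<in>UNIV. y $ j * dirderiv f (?E j) y) has_derivative
      (\<lambda>h. \<Sum>j\<in>UNIV. x $ j * dirderiv (dirderiv f (?E j)) h x + h $ j * dirderiv f (?E j) x)) (at x)"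
    by (intro has_derivative_sum has_derivative_mult holo_on_has_derivative(1)[OF holo_on_dirderiv[OF f S] x]
        bounded_linear_imp_has_derivative bounded_linear_vec_nth)
  hence "(Rad f has_derivative
      (\<lambda>h. \<Sum>j\<in>UNIV. x $ j * dirderiv (dirderiv f (?E j)) h x + h $ j * dirderiv f (?E j) x)) (at x)"
    by (rule has_derivative_transform_within_open[OF _ S x])
      (simp add: Rad_eq[OF f] flip: dirderiv_sum_axis[OF f])
  from has_derivative_unique[OF holo_on_has_derivative(1)[OF holo_on_Rad[OF f S] x] this]
  have "dirderiv (Rad f) w x = (\<Sum>j\<in>UNIV. x $ j * dirderiv (dirderiv f (?E j)) w x + w $ j * dirderiv f (?E j) x)"
    by (rule fun_cong)
  also have "\<dots> = (\<Sum>j\<in>UNIV. x $ j * dirderiv (dirderiv f w) (?E j) x) + (\<Sum>j\<in>UNIV. w $ j * dirderiv f (?E j) x)"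
    by (simp add: sum.distrib dirderiv_commute[OF f S x, of "axis j 1" w for j])
  also have "\<dots> = dirderiv (dirderiv f w) x x + dirderiv f w x"
    by (simp flip: dirderiv_sum_axis[OF f x] dirderiv_sum_axis[OF holo_on_dirderiv[OF f S] x])
  finally show ?thesis by simp
qed

lemma continuous_on_dirderiv_joint:
  assumes f: "holo_on f S" and S: "open S" and "continuous_on T v" "continuous_on T x" "\<And>t. t \<in> T \<Longrightarrow> x t \<in> S"
  shows "continuous_on T (\<lambda>t. dirderiv f (v t) (x t))"
proof (rule continuous_on_eq)
  show "continuous_on T (\<lambda>t. \<Sum>j\<in>UNIV. v t $ j * dirderiv f (axis j 1) (x t))"
    using assms by (intro continuous_intros continuous_on_compose2[OF continuous_on_dirderiv[OF f S]]) auto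
  show "(\<Sum>j\<in>UNIV. v t $ j * dirderiv f (axis j 1) (x t)) = dirderiv f (v t) (x t)" if "t \<in> T" for t
    using dirderiv_sum_axis[OF f, of "x t" "v t"] assms(5)[OF that] by simp
qed

text \<open>Extended by zero, so that it is Borel measurable on the whole space.\<close>

definition ball_norm :: "(complex ^ 'N::finite \<Rightarrow> complex) \<Rightarrow> complex ^ 'N \<Rightarrow> real" where
  "ball_norm g a = indicator (ball 0 1) a *\<^sub>R norm (g a)"

text \<open>A complex line orthogonal to \<open>z\<close> stays in the tent over a disc of radius of the order \<open>u\<close>, so Cauchy's
  estimate loses only \<open>u\<close>, the square root of the distance to the sphere.\<close>

lemma tangential_derivative_le:
  fixes g :: "complex ^ 'N::finite \<Rightarrow> complex"
  assumes g: "holo_on g (ball 0 1)" and gb: "\<And>a. norm a < 1 \<Longrightarrow> norm (g a) \<le> b"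
    and z: "norm z = 1" and w: "cin w z = 0" "norm w \<le> \<kappa>" and \<kappa>: "0 < \<kappa>" and u: "0 < u" "u \<le> 1"
  shows "norm (dirderiv g w (of_real (1 - u\<^sup>2) *s z)) \<le> 4 * \<kappa> * 2 ^ DIM(complex ^ 'N) / u * tent_average (ball_norm g) u z"
proof -
  define c where "c = 2 ^ DIM(complex ^ 'N) * tent_average (ball_norm g) u z"
  have c0: "0 \<le> c" by (simp add: c_def tent_average_def)
  define \<rho> where "\<rho> = u / (4 * \<kappa>)"
  have \<rho>: "0 < \<rho>" using u \<kappa> by (simp add: \<rho>_def)
  let ?x = "of_real (1 - u\<^sup>2) *s z"
  have perp: "cin (t *s (of_real \<rho> *s w)) z = 0" "norm (t *s (of_real \<rho> *s w)) \<le> u / 4" if t: "norm t \<le> 1" for t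
  proof -
    show "cin (t *s (of_real \<rho> *s w)) z = 0" using w by (simp add: cin_scale_left)
    have "norm (t *s (of_real \<rho> *s w)) = norm t * (\<rho> * norm w)"
      using \<rho> by (simp add: norm_cscale norm_mult)
    also have "\<dots> \<le> 1 * (\<rho> * \<kappa>)" using t \<rho> w by (intro mult_mono mult_left_mono) auto
    also have "\<dots> = u / 4" using \<kappa> by (simp add: \<rho>_def)
    finally show "norm (t *s (of_real \<rho> *s w)) \<le> u / 4" .
  qed
  have in_tent: "?x + t *s (of_real \<rho> *s w) \<in> tent u z" if "norm t \<le> 1" for t
  proof -
    have "0 \<in> tent_core u z" using u by (simp add: tent_core_def)
    from tent_core_translate[OF z perp[OF that] this] show ?thesis by simp
  qed
  have inball: "?x + t *s (of_real \<rho> *s w) \<in> ball 0 1" if "norm t \<le> 1" for t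
    using in_tent[OF that] tent_subset_ball[OF z u] by blast
  have gc: "norm (g (?x + t *s (of_real \<rho> *s w))) \<le> c" if t: "norm t \<le> 1" for t
  proof -
    let ?T = "emeasure lborel (tent u z)" and ?C = "emeasure lborel (tent_core u z)"
    define y where "y = norm (g (?x + t *s (of_real \<rho> *s w)))"
    have T: "?T \<noteq> 0" "?T \<noteq> \<top>" using emeasure_tent(2,3)[OF z u] by auto
    have av: "ennreal (tent_average (ball_norm g) u z) = (\<integral>\<^sup>+a\<in>tent u z. ennreal (ball_norm g a) \<partial>lborel) / ?T"
      by (rule tent_average_eq[OF z u, of _ b]) (use gb in \<open>simp add: ball_norm_def\<close>)
    have "(\<integral>\<^sup>+a\<in>tent u z. ennreal (ball_norm g a) \<partial>lborel) = (\<integral>\<^sup>+a\<in>tent u z. ennreal (norm (g a)) \<partial>lborel)"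
      using tent_subset_ball[OF z u]
      by (intro nn_integral_cong) (auto simp: indicator_def ball_norm_def subset_eq)
    hence "ennreal (tent_average (ball_norm g) u z) * ?T = (\<integral>\<^sup>+a\<in>tent u z. ennreal (norm (g a)) \<partial>lborel)"
      unfolding av using T by (simp add: ennreal_divide_times less_top)
    moreover have "ennreal y * ?C \<le> (\<integral>\<^sup>+a\<in>tent u z. ennreal (norm (g a)) \<partial>lborel)"
      unfolding y_def by (rule submean_tent_core[OF g z u perp[OF t]])
    ultimately have "ennreal y * ?C \<le> ennreal (tent_average (ball_norm g) u z) * ?T" by simp
    also have "\<dots> = ennreal c * ?C"
      by (simp add: emeasure_tent(1)[OF z u] c_def tent_average_def ennreal_mult mult_ac)
    finally have "ennreal y \<le> ennreal c"
      using emeasure_tent(4,5)[OF z u] ennreal_mult_le_mult_iff[of ?C "ennreal y" "ennreal c"]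
      by (simp add: mult.commute)
    thus ?thesis using c0 by (simp add: y_def ennreal_le_iff)
  qed
  have "((\<lambda>\<theta>. g (?x + circ \<theta> *s (of_real \<rho> *s w)) / circ \<theta>) has_integral dirderiv g (of_real \<rho> *s w) ?x) {0..1}"
    by (rule mean_value_circle(2)[OF g open_ball inball])
  hence "((\<lambda>\<theta>. g (?x + circ \<theta> *s (of_real \<rho> *s w)) / circ \<theta>) has_integral dirderiv g (of_real \<rho> *s w) ?x) (cbox 0 1)"
    by simp
  from has_integral_bound[OF c0 this] gc
  have "norm (dirderiv g (of_real \<rho> *s w) ?x) \<le> c" by (simp add: norm_divide)
  moreover have "dirderiv g (of_real \<rho> *s w) ?x = of_real \<rho> * dirderiv g w ?x"
    using inball[of 0] by (intro dirderiv_linear(2)[OF g]) simp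
  ultimately have "\<rho> * norm (dirderiv g w ?x) \<le> c" using \<rho> by (simp add: norm_mult)
  hence "norm (dirderiv g w ?x) \<le> c / \<rho>" using \<rho> by (simp add: field_simps)
  also have "c / \<rho> = 4 * \<kappa> * 2 ^ DIM(complex ^ 'N) / u * tent_average (ball_norm g) u z"
    by (simp add: c_def \<rho>_def)
  finally show ?thesis .
qed

text \<open>The factor \<open>2 ^ DIM\<close> is the ratio of the volumes of a tent and its core; the \<open>8\<close> comes from Cauchy's estimate
  and the substitution \<open>t = 1 - u\<^sup>2\<close>.\<close>

definition grad_const :: "'N::finite itself \<Rightarrow> real" where
  "grad_const _ = 1 + 8 * 2 ^ DIM(complex ^ 'N)"

text \<open>The derivative along \<open>A \<zeta>\<close> splits into its part along \<open>\<zeta>\<close>, which is a bounded multiple of the radial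
  derivative, and its part along the tangential \<open>w\<close>. With \<open>t = 1 - u\<^sup>2\<close>, the latter is the integral of
  the tangential derivative of \<open>Rad F\<close> at \<open>t \<zeta>\<close>; the substitution supplies a factor \<open>2 u\<close>, which
  cancels the loss in Cauchy's estimate.\<close>

lemma mean_le_dirderiv_field:
  fixes F :: "complex ^ 'N::finite \<Rightarrow> complex" and A :: "complex ^ 'N \<Rightarrow> complex ^ 'N"
  assumes F: "holo_on F (ball 0 R)" and R: "1 < R" and p: "1 \<le> p"
    and A: "Vector_Spaces.linear (*s) (*s) A" "\<And>y. norm (A y) \<le> \<kappa> * norm y" and \<kappa>: "0 < \<kappa>"
    and c: "\<And>s. 0 < s \<Longrightarrow> s \<le> 1 \<Longrightarrow> mean_le p (\<lambda>\<zeta>. Rad F (s *\<^sub>R \<zeta>)) c"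
  shows "mean_le p (\<lambda>\<zeta>. dirderiv F (A \<zeta>) \<zeta>) (grad_const TYPE('N) * \<kappa> * c)"
proof -
  define g where "g = Rad F"
  have gR: "holo_on g (ball 0 R)" unfolding g_def by (rule holo_on_Rad[OF F open_ball])
  have g: "holo_on g (ball 0 1)" by (rule holo_on_subset[OF gR]) (use R in auto)
  have c0: "0 \<le> c" using c[of 1] by (simp add: mean_le_def)
  have contg: "continuous_on (cball 0 1) g"
    by (rule continuous_on_subset[OF holo_on_continuous[OF gR]]) (use R in auto)
  have "bounded (g ` cball 0 1)"
    by (intro compact_imp_bounded compact_continuous_image contg compact_cball)
  then obtain b where b: "\<And>a. norm a \<le> 1 \<Longrightarrow> norm (g a) \<le> b"
    unfolding bounded_iff by (metis image_eqI mem_cball_0)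
  define G where "G = ball_norm g"
  have Gm: "G \<in> borel_measurable borel"
    unfolding G_def ball_norm_def[abs_def]
    by (intro borel_measurable_continuous_on_indicator continuous_on_norm holo_on_continuous[OF g]) simp
  have G0: "0 \<le> G a" for a by (simp add: G_def ball_norm_def)
  have Gb: "G a \<le> b" if "norm a < 1" for a using b[of a] that by (simp add: G_def ball_norm_def)
  define W where "W \<zeta> = A \<zeta> - cin (A \<zeta>) \<zeta> *s \<zeta>" for \<zeta>
  have contA: "continuous_on T A" for T
    by (rule linear_continuous_on[OF clinear_bounded[OF A(1)]])
  have contW: "continuous_on T W" for T
    unfolding W_def by (intro continuous_intros contA)
  have W: "cin (W \<zeta>) \<zeta> = 0" "norm (W \<zeta>) \<le> \<kappa>" if z: "norm \<zeta> = 1" for \<zeta>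
  proof -
    show "cin (W \<zeta>) \<zeta> = 0" unfolding W_def by (rule cin_perp[OF z])
    have "(norm (W \<zeta>))\<^sup>2 \<le> (norm (A \<zeta>))\<^sup>2"
      using norm_decompose[OF z, of "A \<zeta>"] zero_le_power2[of "norm (cin (A \<zeta>) \<zeta>)"] unfolding W_def by linarith
    hence "norm (W \<zeta>) \<le> norm (A \<zeta>)" by (rule power2_le_imp_le) simp
    also have "\<dots> \<le> \<kappa>" using A(2)[of \<zeta>] z by simp
    finally show "norm (W \<zeta>) \<le> \<kappa>" .
  qed
  define C where "C = 8 * 2 ^ DIM(complex ^ 'N) * \<kappa>"
  have C: "0 \<le> C" using \<kappa> by (simp add: C_def)
  have tang: "mean_le p (\<lambda>\<zeta>. dirderiv F (W \<zeta>) \<zeta>) (C * c)"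
  proof (rule mean_le_integral[where P=unit_interval and u="tent_average G"])
    have "(\<lambda>x. tent_average G (fst x) (snd x)) \<in> borel_measurable (unit_interval \<Otimes>\<^sub>M sphere_measure)"
    proof (rule measurable_tent_average[OF _ _ Gm])
      have "(\<lambda>x. x) \<in> unit_interval \<rightarrow>\<^sub>M (borel :: real measure)"
        by (rule measurable_restrict_space1) simp
      from measurable_compose[OF measurable_fst this]
      show "fst \<in> unit_interval \<Otimes>\<^sub>M sphere_measure \<rightarrow>\<^sub>M (borel :: real measure)" .
      from measurable_compose[OF measurable_snd measurable_id_sphere]
      show "snd \<in> unit_interval \<Otimes>\<^sub>M sphere_measure \<rightarrow>\<^sub>M (borel :: (complex ^ 'N) measure)" .
    qed
    thus "(\<lambda>(u, \<zeta>). tent_average G u \<zeta>) \<in> borel_measurable (unit_interval \<Otimes>\<^sub>M sphere_measure)"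
      by (simp add: split_beta)
    show "(\<integral>\<^sup>+\<zeta>. ennreal (tent_average G u \<zeta> powr p) \<partial>sphere_measure) \<le> ennreal (c powr p)"
      if "u \<in> space unit_interval" for u
    proof (cases "u = 0")
      case True
      have "tent 0 z = {}" for z :: "complex ^ 'N" by (auto simp: tent_def not_less)
      thus ?thesis using True by (simp add: tent_average_def)
    next
      case False
      hence u: "0 < u" "u \<le> 1" using that by (auto simp: space_restrict_space)
      show ?thesis
      proof (rule nn_integral_tent_average_le[OF Gm G0 Gb u p])
        fix r :: real assume r: "0 < r" "r < 1"
        have "(\<integral>\<^sup>+\<zeta>. ennreal (G (r *\<^sub>R \<zeta>) powr p) \<partial>sphere_measure) = (\<integral>\<^sup>+\<zeta>. ennreal (norm (g (r *\<^sub>R \<zeta>)) powr p) \<partial>(sphere_measure :: (complex ^ 'N) measure))"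
          using r by (intro nn_integral_cong) (simp add: G_def ball_norm_def)
        also have "\<dots> \<le> ennreal (c powr p)" using c[of r] r by (simp add: mean_le_def g_def)
        finally show "(\<integral>\<^sup>+\<zeta>. ennreal (G (r *\<^sub>R \<zeta>) powr p) \<partial>sphere_measure) \<le> ennreal (c powr p)" .
      qed
    qed
    show "ennreal (norm (dirderiv F (W \<zeta>) \<zeta>)) \<le> ennreal C * (\<integral>\<^sup>+u. tent_average G u \<zeta> \<partial>unit_interval)"
      if z: "norm \<zeta> = 1" for \<zeta>
    proof -
      define \<phi> where "\<phi> t = t * dirderiv F (W \<zeta>) (0 + t *s \<zeta>)" for t
      define L where "L u = \<phi> (of_real (1 - u\<^sup>2))" for u :: real
      define L' where "L' u = (- 2 * u) *\<^sub>R dirderiv g (W \<zeta>) (of_real (1 - u\<^sup>2) *s \<zeta>)" for u :: real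
      have in_ball: "of_real (1 - u\<^sup>2) *s \<zeta> \<in> ball 0 R" if "u \<in> {0..1}" for u :: real
      proof -
        have "0 \<le> 1 - u\<^sup>2" "1 - u\<^sup>2 \<le> 1" using that by (auto simp: power_le_one)
        hence "norm (complex_of_real (1 - u\<^sup>2)) \<le> 1" by (simp only: norm_of_real)
        thus ?thesis using R z by (simp add: norm_cscale del: of_real_diff)
      qed
      have "ennreal (norm (L 1 - L 0)) \<le> (\<integral>\<^sup>+u. norm (L' u) \<partial>unit_interval)"
      proof (rule norm_diff_le_nn_integral)
        fix u :: real assume u: "u \<in> {0..1}"
        let ?t = "complex_of_real (1 - u\<^sup>2)"
        have x: "0 + ?t *s \<zeta> \<in> ball 0 R" using in_ball[OF u] by simp
        have "(\<phi> has_field_derivative 1 * dirderiv F (W \<zeta>) (0 + ?t *s \<zeta>)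
            + dirderiv (dirderiv F (W \<zeta>)) \<zeta> (0 + ?t *s \<zeta>) * ?t) (at ?t)"
          unfolding \<phi>_def
          by (rule DERIV_mult[OF DERIV_ident holo_on_line[OF holo_on_dirderiv[OF F open_ball] x]])
        also have "1 * dirderiv F (W \<zeta>) (0 + ?t *s \<zeta>) + dirderiv (dirderiv F (W \<zeta>)) \<zeta> (0 + ?t *s \<zeta>) * ?t
            = dirderiv g (W \<zeta>) (?t *s \<zeta>)"
          unfolding g_def using x dirderiv_Rad[OF F open_ball x, of "W \<zeta>"]
          by (simp add: dirderiv_linear(2)[OF holo_on_dirderiv[OF F open_ball] in_ball[OF u]] mult.commute del: of_real_diff)
        finally have "(\<phi> has_field_derivative dirderiv g (W \<zeta>) (?t *s \<zeta>)) (at ?t)" .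
        moreover have "((\<lambda>u. complex_of_real (1 - u\<^sup>2)) has_vector_derivative of_real (- 2 * u)) (at u within {0..1})"
          by (auto intro!: derivative_eq_intros simp: has_vector_derivative_def scaleR_conv_of_real)
        ultimately have "((\<phi> \<circ> (\<lambda>u. complex_of_real (1 - u\<^sup>2))) has_vector_derivative
            of_real (- 2 * u) * dirderiv g (W \<zeta>) (?t *s \<zeta>)) (at u within {0..1})"
          by (intro field_vector_diff_chain_within) (auto intro: has_field_derivative_at_within)
        thus "(L has_vector_derivative L' u) (at u within {0..1})"
          unfolding L_def L'_def comp_def by (simp add: scaleR_conv_of_real del: of_real_diff)
      next
        show "continuous_on {0..1} L'"
          unfolding L'_def
          by (intro continuous_intros continuous_on_dirderiv_joint[OF gR open_ball] in_ball)
      qed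
      moreover have "L 1 - L 0 = - dirderiv F (W \<zeta>) \<zeta>" by (simp add: L_def \<phi>_def)
      ultimately have "ennreal (norm (dirderiv F (W \<zeta>) \<zeta>)) \<le> (\<integral>\<^sup>+u. norm (L' u) \<partial>unit_interval)" by simp
      also have "\<dots> \<le> (\<integral>\<^sup>+u. ennreal C * ennreal (tent_average G u \<zeta>) \<partial>unit_interval)"
      proof (rule nn_integral_mono)
        fix u assume "u \<in> space unit_interval"
        hence u: "0 \<le> u" "u \<le> 1" by (auto simp: space_restrict_space)
        have "norm (L' u) \<le> C * tent_average G u \<zeta>"
        proof (cases "u = 0")
          case True thus ?thesis using C by (simp add: L'_def tent_average_def)
        next
          case False
          hence u': "0 < u" using u by simp
          have "norm (L' u) = 2 * u * norm (dirderiv g (W \<zeta>) (of_real (1 - u\<^sup>2) *s \<zeta>))"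
            using u by (simp add: L'_def del: of_real_diff)
          also have "\<dots> \<le> 2 * u * (4 * \<kappa> * 2 ^ DIM(complex ^ 'N) / u * tent_average (ball_norm g) u \<zeta>)"
            using b u by (intro mult_left_mono tangential_derivative_le[where b=b, OF g _ z W[OF z] \<kappa> u' u(2)]) auto
          also have "\<dots> = C * tent_average G u \<zeta>" using u' by (simp add: C_def G_def)
          finally show ?thesis .
        qed
        thus "ennreal (norm (L' u)) \<le> ennreal C * ennreal (tent_average G u \<zeta>)"
          using C by (simp add: ennreal_leI tent_average_def flip: ennreal_mult)
      qed
      also have "\<dots> = ennreal C * (\<integral>\<^sup>+u. tent_average G u \<zeta> \<partial>unit_interval)"
      proof (rule nn_integral_cmult)
        have "(\<lambda>u. tent_average G u \<zeta>) \<in> borel_measurable unit_interval"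
          by (rule measurable_tent_average[OF _ _ Gm]) (auto intro: measurable_restrict_space1)
        thus "(\<lambda>u. ennreal (tent_average G u \<zeta>)) \<in> borel_measurable unit_interval" by simp
      qed
      finally show ?thesis .
    qed
  qed (use c0 C p in \<open>auto simp: tent_average_def prob_space_unit_interval\<close>)
  have rad: "mean_le p (\<lambda>\<zeta>. of_real \<kappa> * g \<zeta>) (\<kappa> * c)"
  proof (rule mean_le_integral[where P=unit_interval and u="\<lambda>_ \<zeta>. norm (g \<zeta>)"])
    have "continuous_on (sphere 0 1) g" by (rule continuous_on_subset[OF contg]) auto
    hence [measurable]: "g \<in> borel_measurable sphere_measure" by (rule measurable_continuous_on_sphere)
    show "(\<lambda>(_, \<zeta>). norm (g \<zeta>)) \<in> borel_measurable (unit_interval \<Otimes>\<^sub>M sphere_measure)" by measurable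
    show "(\<integral>\<^sup>+\<zeta>. ennreal (norm (g \<zeta>) powr p) \<partial>sphere_measure) \<le> ennreal (c powr p)"
      using c[of 1] by (simp add: mean_le_def g_def)
    have "emeasure unit_interval (space unit_interval) = 1"
      using prob_space_unit_interval by (rule prob_space.emeasure_space_1)
    thus "ennreal (norm (of_real \<kappa> * g \<zeta>)) \<le> ennreal \<kappa> * (\<integral>\<^sup>+k. norm (g \<zeta>) \<partial>unit_interval)" for \<zeta>
      using \<kappa> by (simp add: norm_mult ennreal_mult)
  qed (use c0 \<kappa> p in \<open>auto simp: prob_space_unit_interval\<close>)
  have "mean_le p (\<lambda>\<zeta>. dirderiv F (A \<zeta>) \<zeta>) (\<kappa> * c + C * c)"
  proof (rule mean_le_add[OF rad tang p])
    show "(\<lambda>\<zeta>. of_real \<kappa> * g \<zeta>) \<in> borel_measurable sphere_measure"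
      by (intro measurable_continuous_on_sphere continuous_intros continuous_on_subset[OF contg]) auto
    show "(\<lambda>\<zeta>. dirderiv F (W \<zeta>) \<zeta>) \<in> borel_measurable sphere_measure"
      by (intro measurable_continuous_on_sphere continuous_on_dirderiv_joint[OF F open_ball] contW continuous_intros)
        (use R in auto)
    fix \<zeta> :: "complex ^ 'N" assume z: "norm \<zeta> = 1"
    hence zR: "\<zeta> \<in> ball 0 R" using R by simp
    have "A \<zeta> = cin (A \<zeta>) \<zeta> *s \<zeta> + W \<zeta>" by (simp add: W_def)
    hence "dirderiv F (A \<zeta>) \<zeta> = cin (A \<zeta>) \<zeta> * dirderiv F \<zeta> \<zeta> + dirderiv F (W \<zeta>) \<zeta>"
      by (metis dirderiv_linear[OF F zR])
    also have "dirderiv F \<zeta> \<zeta> = g \<zeta>" by (simp add: g_def Rad_eq[OF F zR])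
    finally have "norm (dirderiv F (A \<zeta>) \<zeta>) \<le> norm (cin (A \<zeta>) \<zeta>) * norm (g \<zeta>) + norm (dirderiv F (W \<zeta>) \<zeta>)"
      by (metis norm_mult norm_triangle_ineq)
    also have "norm (cin (A \<zeta>) \<zeta>) \<le> \<kappa>" using norm_cin_le[of "A \<zeta>" \<zeta>] A(2)[of \<zeta>] z by simp
    hence "norm (cin (A \<zeta>) \<zeta>) * norm (g \<zeta>) \<le> \<kappa> * norm (g \<zeta>)" by (rule mult_right_mono) simp
    finally show "norm (dirderiv F (A \<zeta>) \<zeta>) \<le> norm (of_real \<kappa> * g \<zeta>) + norm (dirderiv F (W \<zeta>) \<zeta>)"
      using \<kappa> by (simp add: norm_mult)
  qed
  thus ?thesis by (simp add: C_def grad_const_def algebra_simps)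
qed


section \<open>Differences in Hardy spaces\<close>

text \<open>The norm in \<open>H\<^sup>p\<close> is at most \<open>c\<close>.\<close>

definition hardy_le :: "real \<Rightarrow> (complex ^ 'N::finite \<Rightarrow> complex) \<Rightarrow> real \<Rightarrow> bool" where
  "hardy_le p f c \<longleftrightarrow> (\<forall>r. 0 < r \<longrightarrow> r < 1 \<longrightarrow> mean_le p (\<lambda>\<zeta>. f (r *\<^sub>R \<zeta>)) c)"

definition contraction :: "(complex ^ 'N::finite \<Rightarrow> complex ^ 'N) \<Rightarrow> bool" where
  "contraction U \<longleftrightarrow> Vector_Spaces.linear (*s) (*s) U \<and> (\<forall>z. norm (U z) \<le> norm z)"

lemma hardy_le_nonneg: "hardy_le p f c \<Longrightarrow> 0 \<le> c"
  unfolding hardy_le_def mean_le_def by (drule spec[of _ "1 / 2"]) simp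

lemma hardy_le_mono:
  assumes "hardy_le p g c" "c \<le> d" "0 \<le> p" "\<And>z. norm z < 1 \<Longrightarrow> norm (f z) \<le> norm (g z)"
  shows "hardy_le p f d"
  unfolding hardy_le_def
proof (intro allI impI)
  fix r :: real assume "0 < r" "r < 1"
  thus "mean_le p (\<lambda>\<zeta>. f (r *\<^sub>R \<zeta>)) d"
    using assms by - (rule mean_le_mono[where g="\<lambda>\<zeta>. g (r *\<^sub>R \<zeta>)" and c=c]; simp add: hardy_le_def)
qed

lemma hardy_le_cong:
  assumes "\<And>z. norm z < 1 \<Longrightarrow> f z = g z"
  shows "hardy_le p f c \<longleftrightarrow> hardy_le p g c"
  unfolding hardy_le_def using assms by (intro all_cong1 imp_cong refl mean_le_cong) auto

lemma measurable_sphere_holo: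
  assumes "holo_on f (ball 0 1)" "0 < r" "r < 1"
  shows "(\<lambda>\<zeta>. f (r *\<^sub>R \<zeta>)) \<in> borel_measurable sphere_measure"
  using assms
  by (intro measurable_continuous_on_sphere continuous_on_compose2[OF holo_on_continuous] continuous_intros) auto

lemma hardy_le_add:
  assumes "hardy_le p g b" "hardy_le p h c" "1 \<le> p" "holo_on g (ball 0 1)" "holo_on h (ball 0 1)"
    and "\<And>z. norm z < 1 \<Longrightarrow> norm (f z) \<le> norm (g z) + norm (h z)"
  shows "hardy_le p f (b + c)"
  unfolding hardy_le_def
proof (intro allI impI)
  fix r :: real assume "0 < r" "r < 1"
  hence "mean_le p (\<lambda>\<zeta>. g (r *\<^sub>R \<zeta>)) b" "mean_le p (\<lambda>\<zeta>. h (r *\<^sub>R \<zeta>)) c"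
    and "(\<lambda>\<zeta>. g (r *\<^sub>R \<zeta>)) \<in> borel_measurable sphere_measure"
      "(\<lambda>\<zeta>. h (r *\<^sub>R \<zeta>)) \<in> borel_measurable sphere_measure"
    using assms by (auto simp: hardy_le_def intro: measurable_sphere_holo)
  thus "mean_le p (\<lambda>\<zeta>. f (r *\<^sub>R \<zeta>)) (b + c)"
    by (rule mean_le_add[OF _ _ assms(3)]) (use assms(6) \<open>0 < r\<close> \<open>r < 1\<close> in simp)
qed

lemma hardy_le_limit:
  assumes "\<And>e. 0 < e \<Longrightarrow> hardy_le p f (c + e)" "0 \<le> c" "0 < p"
  shows "hardy_le p f c"
  unfolding hardy_le_def
proof (intro allI impI)
  fix r :: real assume "0 < r" "r < 1"
  thus "mean_le p (\<lambda>\<zeta>. f (r *\<^sub>R \<zeta>)) c"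
    using assms(1) by (intro mean_le_limit[OF _ assms(2,3)]) (simp add: hardy_le_def)
qed

lemma holo_on_dilate:
  assumes f: "holo_on f (ball 0 1)" and r: "0 < r"
  shows "holo_on (\<lambda>z. f (of_real r *s z)) (ball 0 (1 / r))"
proof (rule holo_on_compose_linear[OF f vec.linear_scale_self])
  fix z :: "complex ^ 'a" assume "z \<in> ball 0 (1 / r)"
  thus "of_real r *s z \<in> ball 0 1" using r by (simp add: norm_cscale field_simps)
qed

lemma mean_le_compose:
  assumes f: "holo_on f (ball 0 1)" and U: "contraction U" and p: "1 \<le> p" and r: "0 < r" "r < 1"
    and c: "mean_le p (\<lambda>\<zeta>. f (r *\<^sub>R \<zeta>)) c"
  shows "mean_le p (\<lambda>\<zeta>. f (U (r *\<^sub>R \<zeta>))) c"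
proof -
  have lin: "Vector_Spaces.linear (*s) (*s) U" using U by (simp add: contraction_def)
  have "(\<integral>\<^sup>+\<zeta>. ennreal (norm (f (of_real r *s U \<zeta>)) powr p) \<partial>sphere_measure)
      \<le> (\<integral>\<^sup>+\<zeta>. ennreal (norm (f (of_real r *s \<zeta>)) powr p) \<partial>sphere_measure)"
    using U r by (intro nn_integral_contraction_le[OF holo_on_dilate[OF f r(1)] _ p lin]) (auto simp: contraction_def)
  thus ?thesis using c by (auto simp: mean_le_def scaleR_cscale clinearD[OF lin])
qed

lemma hardy_le_compose:
  assumes "holo_on f (ball 0 1)" "contraction U" "1 \<le> p" "hardy_le p f c"
  shows "hardy_le p (\<lambda>z. f (U z)) c"
  unfolding hardy_le_def
proof (intro allI impI)
  fix r :: real assume r: "0 < r" "r < 1"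
  hence "mean_le p (\<lambda>\<zeta>. f (r *\<^sub>R \<zeta>)) c" using assms(4) by (simp add: hardy_le_def)
  thus "mean_le p (\<lambda>\<zeta>. f (U (r *\<^sub>R \<zeta>))) c" by (rule mean_le_compose[OF assms(1-3) r])
qed

lemma holo_on_contraction:
  assumes "holo_on f (ball 0 1)" "contraction U"
  shows "holo_on (\<lambda>z. f (U z)) (ball 0 1)"
  using assms(2)
  by (intro holo_on_compose_linear[OF assms(1)]) (auto simp: contraction_def intro: le_less_trans)

lemma contraction_scale: "0 \<le> r \<Longrightarrow> r \<le> 1 \<Longrightarrow> contraction (\<lambda>z. of_real r *s z)"
  by (simp add: contraction_def norm_cscale vec.linear_scale_self mult_left_le_one_le)

text \<open>The means increase with the radius, as a dilation is a contraction.\<close>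

lemma mean_le_smaller_radius:
  assumes f: "holo_on f (ball 0 1)" and p: "1 \<le> p" and r: "0 < r" "r \<le> s" "s < 1"
    and c: "mean_le p (\<lambda>\<zeta>. f (s *\<^sub>R \<zeta>)) c"
  shows "mean_le p (\<lambda>\<zeta>. f (r *\<^sub>R \<zeta>)) c"
proof -
  have "contraction (\<lambda>z :: complex ^ 'a. of_real (r / s) *s z)" using r by (intro contraction_scale) auto
  from mean_le_compose[OF f this p _ r(3) c] r show ?thesis by (simp add: scaleR_cscale)
qed

text \<open>On the sphere of radius \<open>r\<close> this is the preceding estimate for the dilate \<open>z \<mapsto> f (r z)\<close>, which is holomorphic
  beyond the closed ball.\<close>

lemma hardy_le_dirderiv_field:
  fixes f :: "complex ^ 'N::finite \<Rightarrow> complex" and A :: "complex ^ 'N \<Rightarrow> complex ^ 'N"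
  assumes f: "holo_on f (ball 0 1)" and p: "1 \<le> p"
    and A: "Vector_Spaces.linear (*s) (*s) A" "\<And>y. norm (A y) \<le> \<kappa> * norm y" and \<kappa>: "0 < \<kappa>"
    and c: "hardy_le p (Rad f) c"
  shows "hardy_le p (\<lambda>z. dirderiv f (A z) z) (grad_const TYPE('N) * \<kappa> * c)"
  unfolding hardy_le_def
proof (intro allI impI)
  fix r :: real assume r: "0 < r" "r < 1"
  define F where "F z = f (of_real r *s z)" for z
  have F: "holo_on F (ball 0 (1 / r))" unfolding F_def by (rule holo_on_dilate[OF f r(1)])
  have RadF: "Rad F (s *\<^sub>R \<zeta>) = Rad f ((r * s) *\<^sub>R \<zeta>)" for s \<zeta>
    unfolding F_def using Rad_compose[of "\<lambda>z. of_real r *s z" "s *\<^sub>R \<zeta>" f] by (simp add: scaleR_cscale mult.commute)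
  have "mean_le p (\<lambda>\<zeta>. dirderiv F (A \<zeta>) \<zeta>) (grad_const TYPE('N) * \<kappa> * c)"
  proof (rule mean_le_dirderiv_field[OF F _ p A \<kappa>])
    show "mean_le p (\<lambda>\<zeta>. Rad F (s *\<^sub>R \<zeta>)) c" if "0 < s" "s \<le> 1" for s
    proof -
      have "r * s \<le> r" "0 < r * s" using r that by (simp_all add: mult_left_le)
      hence "0 < r * s" "r * s < 1" using r by linarith+
      thus ?thesis unfolding RadF using c by (simp add: hardy_le_def)
    qed
  qed (use r in simp)
  moreover have "dirderiv F (A \<zeta>) \<zeta> = dirderiv f (A (r *\<^sub>R \<zeta>)) (r *\<^sub>R \<zeta>)" for \<zeta>
    by (simp add: dirderiv_def F_def scaleR_cscale clinearD[OF A(1)] vector_add_ldistrib mult.commute)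
  ultimately show "mean_le p (\<lambda>\<zeta>. dirderiv f (A (r *\<^sub>R \<zeta>)) (r *\<^sub>R \<zeta>)) (grad_const TYPE('N) * \<kappa> * c)"
    by simp
qed

lemma inverse_near_identity:
  fixes U :: "complex ^ 'N::finite \<Rightarrow> complex ^ 'N"
  assumes U: "Vector_Spaces.linear (*s) (*s) U" and near: "\<And>z. norm (U z - z) \<le> norm z / 2"
  obtains V where "Vector_Spaces.linear (*s) (*s) V" "\<And>z. V (U z) = z" "\<And>y. norm (V y) \<le> 2 * norm y"
proof -
  have half: "norm z \<le> 2 * norm (U z)" for z
    using near[of z] norm_triangle_ineq2[of z "U z"] by (simp add: norm_minus_commute)
  have lin: "linear U" by (rule clinear_imp_linear[OF U])
  have inj: "inj U"
    unfolding linear_injective_0[OF lin]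
  proof (intro allI impI)
    fix z assume "U z = 0" thus "z = 0" using half[of z] by simp
  qed
  have surj: "surj U" using lin inj linear_injective_imp_surjective by blast
  define V where "V = inv U"
  have VU: "V (U z) = z" for z using inj by (simp add: V_def)
  have UV: "U (V y) = y" for y using surj by (simp add: V_def surj_f_inv_f)
  have "Vector_Spaces.linear (*s) (*s) V"
  proof unfold_locales
    show "V (x + y) = V x + V y" for x y
      using VU[of "V x + V y"] by (simp add: clinearD[OF U] UV)
    show "V (c *s x) = c *s V x" for c x
      using VU[of "c *s V x"] by (simp add: clinearD[OF U] UV)
  qed
  moreover have "norm (V y) \<le> 2 * norm y" for y using half[of "V y"] by (simp add: UV)
  ultimately show ?thesis using that VU by blast
qed

text \<open>The factor \<open>2\<close> is the bound for the inverse of a map at distance \<open>1 / 2\<close> from the identity.\<close>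

definition diff_const :: "'N::finite itself \<Rightarrow> real" where
  "diff_const T = 2 * grad_const T"

lemma diff_const_pos: "0 < diff_const T"
  by (simp add: diff_const_def grad_const_def add_pos_pos)

lemma contraction_segment:
  assumes U: "contraction U" and s: "0 \<le> s" "s \<le> 1"
  shows "contraction (\<lambda>z. z + of_real s *s (U z - z))"
proof -
  have lin: "Vector_Spaces.linear (*s) (*s) U" using U by (simp add: contraction_def)
  have "Vector_Spaces.linear (*s) (*s) (\<lambda>z. z + of_real s *s (U z - z))"
    by unfold_locales (simp_all add: clinearD[OF lin] vec_eq_iff algebra_simps)
  moreover have "norm (z + of_real s *s (U z - z)) \<le> norm z" for z
  proof -
    have "z + of_real s *s (U z - z) = of_real (1 - s) *s z + of_real s *s U z"
      by (simp add: vec_eq_iff algebra_simps)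
    also have "norm \<dots> \<le> norm (of_real (1 - s) *s z) + norm (of_real s *s U z)"
      by (rule norm_triangle_ineq)
    also have "\<dots> = (1 - s) * norm z + s * norm (U z)"
      using s by (simp only: norm_cscale norm_of_real)
    also have "\<dots> \<le> (1 - s) * norm z + s * norm z"
      using U s by (intro add_left_mono mult_left_mono) (auto simp: contraction_def)
    finally show ?thesis by (simp add: algebra_simps)
  qed
  ultimately show ?thesis by (simp add: contraction_def)
qed

text \<open>Join \<open>z\<close> to \<open>U z\<close> by a segment. At the point \<open>y = U\<^sub>s z\<close> of this segment, the direction
  \<open>U z - z\<close> is \<open>A y\<close> with the small linear map \<open>A = (U - 1) U\<^sub>s\<^sup>-\<^sup>1\<close>.\<close>

lemma hardy_le_difference:
  fixes f :: "complex ^ 'N::finite \<Rightarrow> complex" and U :: "complex ^ 'N \<Rightarrow> complex ^ 'N"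
  assumes f: "holo_on f (ball 0 1)" and p: "1 \<le> p" and U: "contraction U"
    and near: "\<And>z. norm (U z - z) \<le> \<delta> * norm z" and \<delta>: "0 < \<delta>" "\<delta> \<le> 1 / 2"
    and c: "hardy_le p (Rad f) c"
  shows "hardy_le p (difference U f) (diff_const TYPE('N) * \<delta> * c)"
  unfolding hardy_le_def
proof (intro allI impI)
  fix r :: real assume r: "0 < r" "r < 1"
  have lin: "Vector_Spaces.linear (*s) (*s) U" and Ule: "norm (U z) \<le> norm z" for z
    using U by (auto simp: contraction_def)
  define D where "D = diff_const TYPE('N) * \<delta> * c"
  have c0: "0 \<le> c" using c by (rule hardy_le_nonneg)
  have D0: "0 \<le> D" using diff_const_pos[of "TYPE('N)"] c0 \<delta> by (simp add: D_def)
  define S where "S s z = z + of_real s *s (U z - z)" for s :: real and z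
  have S: "contraction (S s)" if "s \<in> {0..1}" for s
    using contraction_segment[OF U, of s] that by (simp add: S_def[abs_def])
  have Sball: "S s (r *\<^sub>R \<zeta>) \<in> ball 0 1" if "s \<in> {0..1}" "norm \<zeta> = 1" for s \<zeta>
    using S[OF that(1)] that r by (auto simp: contraction_def) (metis abs_of_pos le_less_trans mult_1_right norm_scaleR)
  define u where "u s \<zeta> = norm (dirderiv f (U (r *\<^sub>R \<zeta>) - r *\<^sub>R \<zeta>) (S s (r *\<^sub>R \<zeta>)))" for s \<zeta>
  have contU: "continuous_on T U" for T by (rule linear_continuous_on[OF clinear_bounded[OF lin]])
  have "mean_le p (\<lambda>\<zeta>. difference U f (r *\<^sub>R \<zeta>)) (1 * D)"
  proof (rule mean_le_integral[where P=unit_interval and u=u])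
    have "continuous_on ({0..1} \<times> sphere 0 1) (\<lambda>x. dirderiv f (U (r *\<^sub>R snd x) - r *\<^sub>R snd x) (S (fst x) (r *\<^sub>R snd x)))"
      unfolding S_def
      by (intro continuous_on_dirderiv_joint[OF f open_ball] continuous_intros
          continuous_on_compose2[OF contU[of UNIV]]) (use Sball in \<open>auto simp: S_def\<close>)
    from measurable_continuous_on_unit_sphere[OF continuous_on_norm[OF this]]
    show "(\<lambda>(s, \<zeta>). u s \<zeta>) \<in> borel_measurable (unit_interval \<Otimes>\<^sub>M sphere_measure)"
      by (simp add: u_def split_beta)
    show "(\<integral>\<^sup>+\<zeta>. ennreal (u s \<zeta> powr p) \<partial>sphere_measure) \<le> ennreal (D powr p)" if "s \<in> space unit_interval" for s
    proof -
      have s: "s \<in> {0..1}" using that by (simp add: space_restrict_space)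
      have "norm (S s z - z) \<le> norm z / 2" for z
      proof -
        have "S s z - z = of_real s *s (U z - z)" unfolding S_def by simp
        hence "norm (S s z - z) = s * norm (U z - z)" using s by (simp only: norm_cscale norm_of_real) simp
        also have "\<dots> \<le> 1 * (1 / 2 * norm z)"
          using s \<delta> by (intro mult_mono order_trans[OF near] mult_right_mono) auto
        finally show ?thesis by simp
      qed
      then obtain V where V: "Vector_Spaces.linear (*s) (*s) V" "\<And>z. V (S s z) = z" "\<And>y. norm (V y) \<le> 2 * norm y"
        using inverse_near_identity[of "S s"] S[OF s] by (auto simp: contraction_def)
      define A where "A y = U (V y) - V y" for y
      have linA: "Vector_Spaces.linear (*s) (*s) A"
        by unfold_locales
          (simp_all add: A_def clinearD[OF lin] clinearD[OF V(1)] vec_eq_iff algebra_simps)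
      have normA: "norm (A y) \<le> (2 * \<delta>) * norm y" for y
      proof -
        have "norm (A y) \<le> \<delta> * norm (V y)" unfolding A_def by (rule near)
        also have "\<dots> \<le> \<delta> * (2 * norm y)" using \<delta> V(3)[of y] by (intro mult_left_mono) auto
        finally show ?thesis by (simp add: mult_ac)
      qed
      have "hardy_le p (\<lambda>z. dirderiv f (A z) z) (grad_const TYPE('N) * (2 * \<delta>) * c)"
        by (rule hardy_le_dirderiv_field[OF f p linA normA _ c]) (use \<delta> in simp)
      hence "hardy_le p (\<lambda>z. dirderiv f (A (S s z)) (S s z)) (grad_const TYPE('N) * (2 * \<delta>) * c)"
        by (rule hardy_le_compose[OF holo_on_dirderiv_field[OF f open_ball linA] S[OF s] p])
      hence "mean_le p (\<lambda>\<zeta>. dirderiv f (U (r *\<^sub>R \<zeta>) - r *\<^sub>R \<zeta>) (S s (r *\<^sub>R \<zeta>))) D"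
        using r by (simp add: hardy_le_def A_def V(2) D_def diff_const_def mult_ac)
      thus ?thesis by (simp add: mean_le_def u_def)
    qed
    fix \<zeta> :: "complex ^ 'N" assume z: "norm \<zeta> = 1"
    define x v where "x = r *\<^sub>R \<zeta>" and "v = U x - x"
    have inb: "x + of_real s *s v \<in> ball 0 1" if "s \<in> {0..1}" for s
      using Sball[OF that z] by (simp add: S_def x_def v_def)
    have "ennreal (norm (f (x + of_real 1 *s v) - f (x + of_real 0 *s v)))
        \<le> (\<integral>\<^sup>+s. norm (dirderiv f v (x + of_real s *s v)) \<partial>unit_interval)"
    proof (rule norm_diff_le_nn_integral)
      show "((\<lambda>s. f (x + of_real s *s v)) has_vector_derivative dirderiv f v (x + of_real s *s v)) (at s within {0..1})"
        if "s \<in> {0..1}" for s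
        by (rule has_vector_derivative_real_field[OF holo_on_line[OF f inb[OF that]]])
      show "continuous_on {0..1} (\<lambda>s. dirderiv f v (x + of_real s *s v))"
        by (intro continuous_on_dirderiv_joint[OF f open_ball] continuous_intros inb)
    qed
    thus "ennreal (norm (difference U f (r *\<^sub>R \<zeta>))) \<le> ennreal 1 * (\<integral>\<^sup>+s. u s \<zeta> \<partial>unit_interval)"
      by (simp add: difference_def u_def S_def x_def v_def)
  qed (use D0 p in \<open>auto simp: u_def prob_space_unit_interval\<close>)
  thus "mean_le p (\<lambda>\<zeta>. difference U f (r *\<^sub>R \<zeta>)) (diff_const TYPE('N) * \<delta> * c)"
    by (simp add: D_def)
qed


subsection \<open>Iterated differences\<close>

abbreviation differences ::
  "(complex ^ 'N::finite \<Rightarrow> complex ^ 'N) list \<Rightarrow> (complex ^ 'N \<Rightarrow> complex) \<Rightarrow> complex ^ 'N \<Rightarrow> complex" where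
  "differences Us f \<equiv> foldr difference Us f"

lemma differences_replicate: "differences (replicate n U) f = (difference U ^^ n) f"
  by (induction n) auto

lemma holo_on_difference:
  "holo_on f (ball 0 1) \<Longrightarrow> contraction U \<Longrightarrow> holo_on (difference U f) (ball 0 1)"
  unfolding difference_def[abs_def] by (rule holo_on_diff[OF holo_on_contraction])

lemma holo_on_differences:
  "holo_on f (ball 0 1) \<Longrightarrow> \<forall>U\<in>set Us. contraction U \<Longrightarrow> holo_on (differences Us f) (ball 0 1)"
  by (induction Us) (auto intro: holo_on_difference)

lemma Rad_differences:
  assumes f: "holo_on f (ball 0 1)" and Us: "\<forall>U\<in>set Us. contraction U" and z: "norm z < 1"
  shows "Rad (differences Us f) z = differences Us (Rad f) z"
  using Us z
proof (induction Us arbitrary: z)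
  case (Cons U Us)
  define h where "h = differences Us f"
  have U: "contraction U" using Cons.prems by simp
  have h: "holo_on h (ball 0 1)" unfolding h_def using Cons.prems by (intro holo_on_differences f) auto
  have Uz: "norm (U z) < 1" using U Cons.prems(2) by (auto simp: contraction_def intro: le_less_trans)
  have "Rad (difference U h) z = Rad (\<lambda>z. h (U z)) z - Rad h z"
    unfolding difference_def[abs_def] using Cons.prems(2)
    by (intro Rad_diff[OF holo_on_contraction[OF h U] h]) auto
  also have "Rad (\<lambda>z. h (U z)) z = Rad h (U z)"
    using U by (intro Rad_compose) (simp add: contraction_def clinearD)
  finally have "Rad (difference U h) z = Rad h (U z) - Rad h z" .
  moreover have "Rad h (U z) = differences Us (Rad f) (U z)" "Rad h z = differences Us (Rad f) z"
    unfolding h_def using Cons.IH Uz Cons.prems by auto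
  ultimately have "Rad (difference U h) z = difference U (differences Us (Rad f)) z"
    by (simp only: difference_def)
  thus ?case by (simp add: h_def)
qed simp

text \<open>As \<open>Rad\<close> commutes with differences, the first order estimate can be iterated.\<close>

lemma hardy_le_differences:
  fixes f :: "complex ^ 'N::finite \<Rightarrow> complex"
  assumes "holo_on f (ball 0 1)" and p: "1 \<le> p"
    and "\<forall>U\<in>set Us. contraction U"
    and "\<forall>U\<in>set Us. \<forall>z. norm (U z - z) \<le> \<delta> * norm z" and \<delta>: "0 < \<delta>" "\<delta> \<le> 1 / 2"
    and "hardy_le p ((Rad ^^ length Us) f) c"
  shows "hardy_le p (differences Us f) ((diff_const TYPE('N) * \<delta>) ^ length Us * c)"
  using assms(1,3,4,7)
proof (induction Us arbitrary: f)
  case (Cons U Us)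
  have "hardy_le p (differences Us (Rad f)) ((diff_const TYPE('N) * \<delta>) ^ length Us * c)"
    using Cons.prems by (intro Cons.IH holo_on_Rad) (auto simp: funpow_swap1)
  hence "hardy_le p (Rad (differences Us f)) ((diff_const TYPE('N) * \<delta>) ^ length Us * c)"
    using Cons.prems by (subst hardy_le_cong[OF Rad_differences[where Us=Us and f=f]]) auto
  hence "hardy_le p (difference U (differences Us f)) (diff_const TYPE('N) * \<delta> * ((diff_const TYPE('N) * \<delta>) ^ length Us * c))"
    using Cons.prems by (intro hardy_le_difference holo_on_differences p \<delta>) auto
  thus ?case by (simp add: mult_ac)
qed simp

text \<open>Each difference at most doubles the norm, by the contraction property.\<close>

lemma hardy_le_differences_crude:
  assumes "holo_on f (ball 0 1)" and p: "1 \<le> p" and "\<forall>U\<in>set Us. contraction U"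
    and "hardy_le p f c"
  shows "hardy_le p (differences Us f) (2 ^ length Us * c)"
  using assms(3)
proof (induction Us)
  case (Cons U Us)
  define h where "h = differences Us f"
  have h: "holo_on h (ball 0 1)" unfolding h_def using Cons.prems by (intro holo_on_differences assms(1)) auto
  have hc: "hardy_le p h (2 ^ length Us * c)" unfolding h_def using Cons by auto
  have U: "contraction U" using Cons.prems by simp
  have "hardy_le p (difference U h) (2 ^ length Us * c + 2 ^ length Us * c)"
    by (rule hardy_le_add[OF hardy_le_compose[OF h U p hc] hc p holo_on_contraction[OF h U] h])
      (simp add: difference_def norm_triangle_ineq4)
  thus ?case by (simp add: h_def mult_ac)
qed (use assms in simp)


section \<open>Dyadic summation\<close>

text \<open>Dilations are parametrized additively, so that applying one twice doubles the parameter. They are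
  contractions at distance at most \<open>L\<close> from the identity, and a difference along a dilation is thus a special case
  of the differences treated so far.\<close>

abbreviation dilation :: "real \<Rightarrow> complex ^ 'N::finite \<Rightarrow> complex ^ 'N" where
  "dilation L z \<equiv> of_real (exp (- L)) *s z"

lemma dilation_twice: "dilation L (dilation L z) = dilation (2 * L) z"
  by (simp flip: of_real_mult exp_add)

lemma contraction_dilation: "0 \<le> L \<Longrightarrow> contraction (dilation L)"
  by (rule contraction_scale) auto

lemma dilation_near_identity:
  assumes "0 \<le> L" shows "norm (dilation L z - z) \<le> L * norm z"
proof -
  have "dilation L z - z = of_real (exp (- L) - 1) *s z"
    by (simp add: vec_eq_iff algebra_simps)
  hence "norm (dilation L z - z) = \<bar>exp (- L) - 1\<bar> * norm z"
    by (simp only: norm_cscale norm_of_real)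
  also have "\<bar>exp (- L) - 1\<bar> \<le> L" using assms exp_ge_add_one_self[of "- L"] by (simp add: abs_if)
  hence "\<bar>exp (- L) - 1\<bar> * norm z \<le> L * norm z" by (rule mult_right_mono) simp
  finally show ?thesis .
qed

lemma differences_scale:
  assumes "\<forall>U\<in>set Us. contraction U"
  shows "differences Us (\<lambda>z. f (c *s z)) = (\<lambda>z. differences Us f (c *s z))"
  using assms
proof (induction Us)
  case (Cons U Us)
  have "U (c *s z) = c *s U z" for z using Cons.prems by (auto simp: contraction_def clinearD)
  thus ?case using Cons by (simp add: difference_def[abs_def])
qed simp

lemma differences_minus:
  "differences Us (\<lambda>z. f z - g z) = (\<lambda>z. differences Us f z - differences Us g z)"
  by (induction Us) (simp_all add: difference_def[abs_def] algebra_simps)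

lemma differences_difference_dilation:
  assumes "\<forall>U\<in>set Us. contraction U"
  shows "differences Us (difference (dilation L) f)
    = (\<lambda>z. differences Us f (dilation L z) - differences Us f z)"
  unfolding difference_def[of "dilation L", abs_def] differences_minus differences_scale[OF assms] ..

lemma Rad_funpow_dilation:
  "(Rad ^^ n) (\<lambda>z. f (dilation L z)) = (\<lambda>z. (Rad ^^ n) f (dilation L z))"
  by (rule Rad_funpow_scale)

text \<open>Apply \<open>f(z) = f(e\<^sup>-\<^sup>L z) - (f(e\<^sup>-\<^sup>L z) - f(z))\<close> first to \<open>f\<close>, then to its difference along the dilation, and so
  on, \<open>k\<close> times in all. The \<open>i\<close>-th term at the smaller radius is an \<open>i\<close>-fold difference, of norm at most \<open>2\<^sup>i a\<close>, and
  these terms add up to at most \<open>3\<^sup>k a\<close>.\<close>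

lemma hardy_le_peel_dilations:
  assumes p: "1 \<le> p" and Us: "\<forall>U\<in>set Us. contraction U" and L: "0 \<le> L"
    and "holo_on f (ball 0 1)"
    and "hardy_le p (differences Us ((difference (dilation L) ^^ k) f)) b"
    and "hardy_le p (differences Us (\<lambda>z. f (dilation L z))) a"
  shows "hardy_le p (differences Us f) (b + 3 ^ k * a)"
  using assms(4-)
proof (induction k arbitrary: f a)
  case 0
  have "0 \<le> a" by (rule hardy_le_nonneg[OF 0(3)])
  thus ?case using 0(2) p by - (rule hardy_le_mono[where c=b and g="differences Us f"]; simp)
next
  case (Suc k)
  note f = Suc.prems(1)
  have D: "contraction (dilation L :: complex ^ 'a \<Rightarrow> _)" by (rule contraction_dilation[OF L])
  define f' where "f' = difference (dilation L) f"
  have f': "holo_on f' (ball 0 1)" unfolding f'_def by (rule holo_on_difference[OF f D])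
  have fD: "holo_on (\<lambda>z. f (dilation L z)) (ball 0 1)" by (rule holo_on_contraction[OF f D])
  have a: "0 \<le> a" by (rule hardy_le_nonneg[OF Suc.prems(3)])
  have "hardy_le p (difference (dilation L) (differences Us (\<lambda>z. f (dilation L z)))) (2 ^ length [dilation L :: complex ^ 'a \<Rightarrow> _] * a)"
    using hardy_le_differences_crude[OF holo_on_differences[OF fD Us] p _ Suc.prems(3), of "[dilation L]"] D by simp
  moreover have "difference (dilation L) (differences Us (\<lambda>z. f (dilation L z))) = differences Us (\<lambda>z. f' (dilation L z))"
  proof -
    have "(\<lambda>z. f' (dilation L z)) = difference (dilation L) (\<lambda>z. f (dilation L z))"
      by (rule ext) (simp only: difference_def f'_def)
    thus ?thesis
      unfolding differences_difference_dilation[OF Us] by (simp only:) (rule ext, simp only: difference_def differences_difference_dilation[OF Us])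
  qed
  ultimately have "hardy_le p (differences Us (\<lambda>z. f' (dilation L z))) (2 * a)" by simp
  moreover have "hardy_le p (differences Us ((difference (dilation L) ^^ k) f')) b"
    using Suc.prems(2) by (simp add: f'_def funpow_swap1)
  ultimately have "hardy_le p (differences Us f') (b + 3 ^ k * (2 * a))"
    using Suc.IH[OF f'] by blast
  from hardy_le_add[OF Suc.prems(3) this p holo_on_differences[OF fD Us] holo_on_differences[OF f' Us], of "differences Us f"]
  have "hardy_le p (differences Us f) (a + (b + 3 ^ k * (2 * a)))"
    unfolding f'_def differences_difference_dilation[OF Us] differences_scale[OF Us]
    using norm_triangle_ineq4[of "x :: complex" "x - y" for x y] by simp
  moreover have "a + (b + 3 ^ k * (2 * a)) \<le> b + 3 ^ Suc k * a"
  proof -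
    have "1 * a \<le> 3 ^ k * a" using a by (intro mult_right_mono) auto
    thus ?thesis by (simp add: mult_ac)
  qed
  ultimately show ?case
    using p by - (rule hardy_le_mono[where c="a + (b + 3 ^ k * (2 * a))" and g="differences Us f"]; simp)
qed

text \<open>Halving the step: as \<open>D\<^sub>2\<^sub>L h = D\<^sub>L h + (D\<^sub>L h)(e\<^sup>-\<^sup>L \<cdot>)\<close>, each of the \<open>n\<close> differences can be replaced by one with
  half the step, at the cost of a term at the radius \<open>e\<^sup>-\<^sup>L\<close>, where the smooth estimate applies.\<close>

lemma hardy_le_halve_step:
  fixes f :: "complex ^ 'N::finite \<Rightarrow> complex"
  assumes f: "holo_on f (ball 0 1)" and p: "1 \<le> p" and L: "0 < L" "L \<le> 1 / 4"
    and a: "hardy_le p ((Rad ^^ n) (\<lambda>z. f (dilation L z))) a"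
    and b: "hardy_le p ((difference (dilation L) ^^ n) f) b"
  shows "hardy_le p ((difference (dilation (2 * L)) ^^ n) f) (b + n * ((diff_const TYPE('N) * (2 * L)) ^ n * a))"
proof -
  define a' where "a' = (diff_const TYPE('N) * (2 * L)) ^ n * a"
  define Us where "Us m k = replicate m (dilation (2 * L)) @ replicate k (dilation L :: complex ^ 'N \<Rightarrow> _)" for m k
  have Us: "\<forall>U\<in>set (Us m k). contraction U" for m k
    using L by (auto simp: Us_def contraction_dilation simp del: of_real_exp split: if_splits)
  have near: "\<forall>U\<in>set (Us m k). \<forall>z. norm (U z - z) \<le> (2 * L) * norm z" for m k
  proof (intro ballI allI)
    fix U z assume "U \<in> set (Us m k)"
    hence "U = dilation (2 * L) \<or> U = dilation L" by (auto simp: Us_def split: if_splits)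
    thus "norm (U z - z) \<le> (2 * L) * norm z"
    proof
      assume U: "U = dilation (2 * L)"
      show ?thesis unfolding U by (rule dilation_near_identity) (use L in simp)
    next
      assume U: "U = dilation L"
      have "norm (U z - z) \<le> L * norm z" unfolding U by (rule dilation_near_identity) (use L in simp)
      also have "\<dots> \<le> (2 * L) * norm z" using L by (intro mult_right_mono) auto
      finally show ?thesis .
    qed
  qed
  have D: "contraction (dilation L :: complex ^ 'N \<Rightarrow> _)" using L by (intro contraction_dilation) simp
  have fD: "holo_on (\<lambda>z. f (dilation L z)) (ball 0 1)" by (rule holo_on_contraction[OF f D])
  have "hardy_le p (differences (Us m k) f) (b + m * a')" if "m + k = n" for m k
    using that
  proof (induction m arbitrary: k)
    case 0
    thus ?case using b by (simp add: Us_def differences_replicate)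
  next
    case (Suc m)
    define h where "h = differences (Us m k) f"
    define h1 where "h1 = differences (Us m (Suc k)) f"
    have "Us m (Suc k) = Us m k @ [dilation L]" by (simp add: Us_def replicate_append_same)
    hence h1: "h1 = (\<lambda>z. h (dilation L z) - h z)"
      unfolding h1_def h_def by (simp add: differences_difference_dilation[OF Us])
    have "hardy_le p h1 (b + m * a')" unfolding h1_def using Suc by (intro Suc.IH) simp
    moreover have "hardy_le p (\<lambda>z. h1 (dilation L z)) a'"
    proof -
      have len: "length (Us m (Suc k)) = n" using Suc.prems by (simp add: Us_def)
      have "hardy_le p (differences (Us m (Suc k)) (\<lambda>z. f (dilation L z))) a'"
        using hardy_le_differences[OF fD p Us near, of m "Suc k"] L a unfolding len a'_def by simp
      thus ?thesis unfolding h1_def differences_scale[OF Us] .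
    qed
    moreover have holo: "holo_on h1 (ball 0 1)" unfolding h1_def by (rule holo_on_differences[OF f Us])
    moreover have "norm (differences (Us (Suc m) k) f z) \<le> norm (h1 z) + norm (h1 (dilation L z))" for z
    proof -
      have "differences (Us (Suc m) k) f z = h (dilation (2 * L) z) - h z"
        by (simp add: Us_def h_def difference_def)
      also have "\<dots> = h1 z + h1 (dilation L z)"
        unfolding h1 dilation_twice by simp
      finally show ?thesis by (simp add: norm_triangle_ineq)
    qed
    ultimately have "hardy_le p (differences (Us (Suc m) k) f) (b + m * a' + a')"
      by (intro hardy_le_add[where g=h1 and h="\<lambda>z. h1 (dilation L z)" and b="b + m * a'" and c=a']
          p holo_on_contraction[OF holo D]) auto
    thus ?case by (simp add: algebra_simps)
  qed
  from this[of n 0] show ?thesis by (simp add: Us_def differences_replicate a'_def)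
qed

text \<open>All that the summation uses about the weight; \<open>q\<close> is the ratio of the geometric series.\<close>

locale dyadic_weight =
  fixes \<phi> :: "real \<Rightarrow> real" and q L\<^sub>0 :: real
  assumes \<phi>0: "\<And>L. 0 < L \<Longrightarrow> L \<le> L\<^sub>0 \<Longrightarrow> 0 \<le> \<phi> L"
    and half: "\<And>L. 0 < L \<Longrightarrow> L \<le> L\<^sub>0 \<Longrightarrow> \<phi> (L / 2) \<le> q * \<phi> L"
    and q: "0 \<le> q" "q < 1" and L\<^sub>0: "L\<^sub>0 \<le> 1 / 2"
begin

text \<open>Halving the step repeatedly gives a geometric series. The remainder tends to zero, since \<open>Rad\<^sup>n F\<close> has
  bounded means.\<close>

lemma hardy_le_radial_differences:
  fixes F :: "complex ^ 'N::finite \<Rightarrow> complex"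
  assumes F: "holo_on F (ball 0 1)" and p: "1 \<le> p" and n: "1 \<le> n" and B: "0 \<le> B"
    and RF: "\<And>L. 0 < L \<Longrightarrow> L \<le> L\<^sub>0 \<Longrightarrow> hardy_le p ((Rad ^^ n) (\<lambda>z. F (dilation L z))) (B * \<phi> L / L ^ n)"
    and c: "hardy_le p ((Rad ^^ n) F) c" and L: "0 < L" "L \<le> L\<^sub>0"
  shows "hardy_le p ((difference (dilation L) ^^ n) F) (n * (2 * diff_const TYPE('N)) ^ n * B / (1 - q) * \<phi> L)"
proof -
  define K where "K = diff_const TYPE('N)"
  have K: "0 < K" by (simp add: K_def diff_const_pos)
  define A where "A = n * (2 * K) ^ n * B"
  have A: "0 \<le> A" using K B by (simp add: A_def)
  define \<sigma> where "\<sigma> = 1 / (1 - q)"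
  have \<sigma>: "0 < \<sigma>" "q * (\<sigma> + 1) \<le> \<sigma>"
  proof -
    show "0 < \<sigma>" using q by (simp add: \<sigma>_def)
    have "\<sigma> * (1 - q) = 1" using q by (simp add: \<sigma>_def)
    thus "q * (\<sigma> + 1) \<le> \<sigma>" using q by (simp add: algebra_simps)
  qed
  have c0: "0 \<le> c" using c by (rule hardy_le_nonneg)
  have step: "hardy_le p ((difference (dilation L) ^^ n) F) (A * \<sigma> * \<phi> L + (K * (L / 2 ^ k)) ^ n * c)"
    if "0 < L" "L \<le> L\<^sub>0" for k L
    using that
  proof (induction k arbitrary: L)
    case 0
    have D: "contraction (dilation L :: complex ^ 'N \<Rightarrow> _)" using 0 by (intro contraction_dilation) simp
    have "hardy_le p (differences (replicate n (dilation L)) F) ((diff_const TYPE('N) * L) ^ length (replicate n (dilation L :: complex ^ 'N \<Rightarrow> _)) * c)"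
    proof (rule hardy_le_differences[OF F p _ _ 0(1)])
      show "L \<le> 1 / 2" using 0 L\<^sub>0 by simp
    qed (use D 0 c in \<open>auto simp del: of_real_exp intro: dilation_near_identity\<close>)
    hence "hardy_le p ((difference (dilation L) ^^ n) F) ((K * L) ^ n * c)"
      by (simp add: differences_replicate K_def)
    moreover have "0 \<le> A * \<sigma> * \<phi> L" using A \<sigma> \<phi>0[OF 0] by simp
    ultimately show ?case
      using p by - (rule hardy_le_mono[where c="(K * L) ^ n * c" and g="(difference (dilation L) ^^ n) F"]; simp)
  next
    case (Suc k)
    have h: "0 < L / 2" "L / 2 \<le> L\<^sub>0" "L / 2 \<le> 1 / 4" using Suc.prems L\<^sub>0 by auto
    define b where "b = A * \<sigma> * \<phi> (L / 2) + (K * (L / 2 / 2 ^ k)) ^ n * c"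
    have "hardy_le p ((difference (dilation (L / 2)) ^^ n) F) b"
      unfolding b_def by (rule Suc.IH[OF h(1,2)])
    from hardy_le_halve_step[OF F p h(1,3) RF[OF h(1,2)] this]
    have "hardy_le p ((difference (dilation L) ^^ n) F) (b + n * ((K * L) ^ n * (B * \<phi> (L / 2) / (L / 2) ^ n)))"
      by (simp add: K_def)
    also have "(K * L) ^ n * (B * \<phi> (L / 2) / (L / 2) ^ n) = (2 * K) ^ n * B * \<phi> (L / 2)"
      using Suc.prems by (simp add: power_mult_distrib power_divide)
    also have "b + n * ((2 * K) ^ n * B * \<phi> (L / 2)) = A * ((\<sigma> + 1) * \<phi> (L / 2)) + (K * (L / 2 ^ Suc k)) ^ n * c"
      by (simp add: b_def A_def algebra_simps)
    finally have "hardy_le p ((difference (dilation L) ^^ n) F)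
        (A * ((\<sigma> + 1) * \<phi> (L / 2)) + (K * (L / 2 ^ Suc k)) ^ n * c)" .
    moreover have "A * ((\<sigma> + 1) * \<phi> (L / 2)) \<le> A * \<sigma> * \<phi> L"
    proof -
      have "(\<sigma> + 1) * \<phi> (L / 2) \<le> (\<sigma> + 1) * (q * \<phi> L)"
        using \<sigma> half[OF Suc.prems] by (intro mult_left_mono) auto
      also have "\<dots> = q * (\<sigma> + 1) * \<phi> L" by simp
      also have "\<dots> \<le> \<sigma> * \<phi> L" using \<sigma> \<phi>0[OF Suc.prems] by (intro mult_right_mono)
      finally show ?thesis using A by (simp add: mult_left_mono mult.assoc)
    qed
    ultimately show ?case
      using p by - (rule hardy_le_mono[where c="A * ((\<sigma> + 1) * \<phi> (L / 2)) + (K * (L / 2 ^ Suc k)) ^ n * c"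
          and g="(difference (dilation L) ^^ n) F"]; simp)
  qed
  have "hardy_le p ((difference (dilation L) ^^ n) F) (A * \<sigma> * \<phi> L)"
  proof (rule hardy_le_limit)
    fix e :: real assume e: "0 < e"
    have "(\<lambda>k. (K * (L / 2 ^ k)) ^ n * c) \<longlonglongrightarrow> (K * 0) ^ n * c"
    proof (intro tendsto_intros)
      have "(\<lambda>k. L * (1 / 2) ^ k) \<longlonglongrightarrow> L * 0"
        by (intro tendsto_intros LIMSEQ_realpow_zero) auto
      thus "(\<lambda>k. L / 2 ^ k) \<longlonglongrightarrow> 0" by (simp add: power_divide)
    qed
    hence "(\<lambda>k. (K * (L / 2 ^ k)) ^ n * c) \<longlonglongrightarrow> 0" using n by (simp add: zero_power)
    hence "\<forall>\<^sub>F k in sequentially. (K * (L / 2 ^ k)) ^ n * c < e" using e by (rule order_tendstoD)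
    then obtain k where "(K * (L / 2 ^ k)) ^ n * c < e" by (auto simp: eventually_sequentially)
    thus "hardy_le p ((difference (dilation L) ^^ n) F) (A * \<sigma> * \<phi> L + e)"
      using step[OF L, of k] p
      by - (rule hardy_le_mono[where c="A * \<sigma> * \<phi> L + (K * (L / 2 ^ k)) ^ n * c" and g="(difference (dilation L) ^^ n) F"]; simp)
  qed (use A \<sigma> \<phi>0[OF L] p in auto)
  thus ?thesis by (simp add: A_def \<sigma>_def K_def)
qed


definition osc_const :: "nat \<Rightarrow> 'N::finite itself \<Rightarrow> real" where
  "osc_const n T = n * (2 * diff_const T) ^ n / (1 - q)"

text \<open>The a priori bound that makes the remainder vanish holds for the dilates of \<open>f\<close>. The sphere of radius \<open>\<rho>\<close>
  is reached as the one of radius \<open>r\<close> for the dilate by \<open>r\<close>, where \<open>r\<^sup>2 = \<rho>\<close>.\<close>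

lemma hardy_le_radial_differences_ball:
  fixes f :: "complex ^ 'N::finite \<Rightarrow> complex"
  assumes f: "holo_on f (ball 0 1)" and p: "1 \<le> p" and n: "1 \<le> n" and B: "0 \<le> B"
    and Rf: "\<And>L. 0 < L \<Longrightarrow> L \<le> L\<^sub>0 \<Longrightarrow> mean_le p (\<lambda>\<zeta>. (Rad ^^ n) f (exp (- L) *\<^sub>R \<zeta>)) (B * \<phi> L / L ^ n)"
    and L: "0 < L" "L \<le> L\<^sub>0"
  shows "hardy_le p ((difference (dilation L) ^^ n) f) (osc_const n TYPE('N) * B * \<phi> L)"
  unfolding hardy_le_def
proof (intro allI impI)
  fix \<rho> :: real assume \<rho>: "0 < \<rho>" "\<rho> < 1"
  define r where "r = sqrt \<rho>"
  have r: "0 < r" "r < 1" "r * r = \<rho>" using \<rho> by (simp_all add: r_def)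
  define F where "F z = f (of_real r *s z)" for z
  have F: "holo_on F (ball 0 1)"
    unfolding F_def by (rule holo_on_contraction[OF f contraction_scale]) (use r in auto)
  have Rf_holo: "holo_on ((Rad ^^ n) f) (ball 0 1)" by (rule holo_on_Rad_funpow[OF f open_ball])
  have RF: "(Rad ^^ n) F = (\<lambda>z. (Rad ^^ n) f (of_real r *s z))"
    unfolding F_def by (rule Rad_funpow_scale)
  have "hardy_le p ((Rad ^^ n) (\<lambda>z. F (dilation L z))) (B * \<phi> L / L ^ n)" if L: "0 < L" "L \<le> L\<^sub>0" for L
    unfolding hardy_le_def
  proof (intro allI impI)
    fix s :: real assume s: "0 < s" "s < 1"
    have "mean_le p (\<lambda>\<zeta>. (Rad ^^ n) f ((r * exp (- L) * s) *\<^sub>R \<zeta>)) (B * \<phi> L / L ^ n)"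
    proof (rule mean_le_smaller_radius[OF Rf_holo p _ _ _ Rf[OF L]])
      have "r * s \<le> 1" using r s by (simp add: mult_le_one)
      hence "(r * s) * exp (- L) \<le> 1 * exp (- L)" by (intro mult_right_mono) auto
      thus "r * exp (- L) * s \<le> exp (- L)" by (simp add: mult_ac)
    qed (use r s L in auto)
    moreover have "(Rad ^^ n) (\<lambda>z. F (dilation L z)) (s *\<^sub>R \<zeta>) = (Rad ^^ n) f ((r * exp (- L) * s) *\<^sub>R \<zeta>)" for \<zeta>
      unfolding Rad_funpow_dilation RF by (simp add: scaleR_cscale mult_ac)
    ultimately show "mean_le p (\<lambda>\<zeta>. (Rad ^^ n) (\<lambda>z. F (dilation L z)) (s *\<^sub>R \<zeta>)) (B * \<phi> L / L ^ n)" by simp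
  qed
  moreover obtain c where "hardy_le p ((Rad ^^ n) F) c"
  proof -
    have "bounded ((Rad ^^ n) f ` cball 0 r)"
      using r by (intro compact_imp_bounded compact_continuous_image compact_cball
          continuous_on_subset[OF holo_on_continuous[OF Rf_holo]]) auto
    then obtain c where c: "\<And>z. norm z \<le> r \<Longrightarrow> norm ((Rad ^^ n) f z) \<le> c"
      unfolding bounded_iff by (metis image_eqI mem_cball_0)
    have "0 \<le> c" using c[of 0] r norm_ge_zero[of "(Rad ^^ n) f 0"] by (simp del: norm_ge_zero)
    hence "hardy_le p ((Rad ^^ n) F) c"
      unfolding hardy_le_def RF using r p
      by (intro allI impI mean_le_bounded c) (auto simp: norm_cscale mult_left_le)
    thus ?thesis by (rule that)
  qed
  ultimately have "hardy_le p ((difference (dilation L) ^^ n) F) (n * (2 * diff_const TYPE('N)) ^ n * B / (1 - q) * \<phi> L)"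
    by (intro hardy_le_radial_differences[OF F p n B _ _ L])
  moreover have "n * (2 * diff_const TYPE('N)) ^ n * B / (1 - q) * \<phi> L = osc_const n TYPE('N) * B * \<phi> L"
    by (simp add: osc_const_def)
  moreover have "(difference (dilation L) ^^ n) F = (\<lambda>z. (difference (dilation L) ^^ n) f (of_real r *s z))"
  proof -
    have "contraction (dilation L :: complex ^ 'N \<Rightarrow> _)" using L by (intro contraction_dilation) simp
    thus ?thesis
      using differences_scale[of "replicate n (dilation L)" f "of_real r"]
      unfolding differences_replicate F_def by simp
  qed
  ultimately have "mean_le p (\<lambda>\<zeta>. (difference (dilation L) ^^ n) f (of_real r *s (r *\<^sub>R \<zeta>))) (osc_const n TYPE('N) * B * \<phi> L)"
    using r unfolding hardy_le_def by simp
  moreover have "of_real r *s (r *\<^sub>R \<zeta>) = \<rho> *\<^sub>R \<zeta>" for \<zeta> :: "complex ^ 'N"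
    by (simp add: scaleR_cscale flip: r(3))
  ultimately show "mean_le p (\<lambda>\<zeta>. (difference (dilation L) ^^ n) f (\<rho> *\<^sub>R \<zeta>)) (osc_const n TYPE('N) * B * \<phi> L)"
    by simp
qed

lemma osc_const_nonneg: "0 \<le> osc_const n T"
  using q diff_const_pos[of T] by (simp add: osc_const_def)

text \<open>Peeling off \<open>n\<close> dilation differences leaves values of \<open>f\<close> on a compact ball; this gives membership in the
  Hardy space.\<close>

lemma hardy_le_of_radial:
  fixes f :: "complex ^ 'N::finite \<Rightarrow> complex"
  assumes f: "holo_on f (ball 0 1)" and p: "1 \<le> p" and n: "1 \<le> n" and B: "0 \<le> B"
    and Rf: "\<And>L. 0 < L \<Longrightarrow> L \<le> L\<^sub>0 \<Longrightarrow> mean_le p (\<lambda>\<zeta>. (Rad ^^ n) f (exp (- L) *\<^sub>R \<zeta>)) (B * \<phi> L / L ^ n)"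
    and L: "0 < L" "L \<le> L\<^sub>0"
    and M: "0 \<le> M" "\<And>z. norm z \<le> exp (- L) \<Longrightarrow> norm (f z) \<le> M"
  shows "hardy_le p f (osc_const n TYPE('N) * B * \<phi> L + 3 ^ n * M)"
proof -
  have "hardy_le p (\<lambda>z. f (dilation L z)) M"
    unfolding hardy_le_def using p M
    by (intro allI impI mean_le_bounded) (auto simp: norm_cscale mult_left_le simp del: of_real_exp)
  thus ?thesis
    using hardy_le_peel_dilations[OF p, of "[]" L f n] hardy_le_radial_differences_ball[OF f p n B Rf L] f L by simp
qed

text \<open>Peeling off \<open>n\<close> dilation differences with step \<open>L\<close>, the size of \<open>U - 1\<close>, splits \<open>f\<close> into a rough part, whose
  norm is of the order \<open>\<phi> L\<close>, and smooth parts at the radius \<open>e\<^sup>-\<^sup>L\<close>. There each of the \<open>n\<close> differences along \<open>U\<close>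
  gains a factor \<open>L\<close>, and \<open>L\<^sup>n\<close> cancels the growth \<open>L\<^sup>-\<^sup>n\<close> of the radial derivative.\<close>

lemma hardy_le_differences_of_radial:
  fixes f :: "complex ^ 'N::finite \<Rightarrow> complex" and U :: "complex ^ 'N \<Rightarrow> complex ^ 'N"
  assumes f: "holo_on f (ball 0 1)" and p: "1 \<le> p" and n: "1 \<le> n" and B: "0 \<le> B"
    and Rf: "\<And>L. 0 < L \<Longrightarrow> L \<le> L\<^sub>0 \<Longrightarrow> mean_le p (\<lambda>\<zeta>. (Rad ^^ n) f (exp (- L) *\<^sub>R \<zeta>)) (B * \<phi> L / L ^ n)"
    and L: "0 < L" "L \<le> L\<^sub>0"
    and U: "contraction U" "\<And>z. norm (U z - z) \<le> L * norm z"
  shows "hardy_le p ((difference U ^^ n) f)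
    ((2 ^ n * osc_const n TYPE('N) + 3 ^ n * diff_const TYPE('N) ^ n) * B * \<phi> L)"
proof -
  let ?K = "diff_const TYPE('N)"
  define Us where "Us = replicate n U"
  have Us: "\<forall>U\<in>set Us. contraction U" "\<forall>U\<in>set Us. \<forall>z. norm (U z - z) \<le> L * norm z" "length Us = n"
    using U by (auto simp: Us_def)
  have D: "contraction (dilation L :: complex ^ 'N \<Rightarrow> _)" using L by (intro contraction_dilation) simp
  have Ds: "holo_on ((difference (dilation L) ^^ n) f) (ball 0 1)"
    using holo_on_differences[OF f, of "replicate n (dilation L)"] D by (simp add: differences_replicate)
  have b: "hardy_le p (differences Us ((difference (dilation L) ^^ n) f)) (2 ^ n * (osc_const n TYPE('N) * B * \<phi> L))"
    using hardy_le_differences_crude[OF Ds p Us(1) hardy_le_radial_differences_ball[OF f p n B Rf L]] by (simp add: Us)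
  have Rf_holo: "holo_on ((Rad ^^ n) f) (ball 0 1)" by (rule holo_on_Rad_funpow[OF f open_ball])
  have "hardy_le p ((Rad ^^ n) (\<lambda>z. f (dilation L z))) (B * \<phi> L / L ^ n)"
    unfolding hardy_le_def
  proof (intro allI impI)
    fix s :: real assume s: "0 < s" "s < 1"
    have "mean_le p (\<lambda>\<zeta>. (Rad ^^ n) f ((exp (- L) * s) *\<^sub>R \<zeta>)) (B * \<phi> L / L ^ n)"
      by (rule mean_le_smaller_radius[OF Rf_holo p _ _ _ Rf[OF L]]) (use s L in \<open>auto simp: mult_left_le\<close>)
    thus "mean_le p (\<lambda>\<zeta>. (Rad ^^ n) (\<lambda>z. f (dilation L z)) (s *\<^sub>R \<zeta>)) (B * \<phi> L / L ^ n)"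
      unfolding Rad_funpow_dilation by (simp add: scaleR_cscale)
  qed
  hence "hardy_le p (differences Us (\<lambda>z. f (dilation L z))) ((?K * L) ^ length Us * (B * \<phi> L / L ^ n))"
    using L L\<^sub>0 by (intro hardy_le_differences[OF holo_on_contraction[OF f D] p Us(1,2)]) (auto simp: Us(3))
  hence a: "hardy_le p (differences Us (\<lambda>z. f (dilation L z))) (?K ^ n * B * \<phi> L)"
    using L by (simp add: Us(3) power_mult_distrib mult.assoc)
  have "hardy_le p (differences Us f) (2 ^ n * (osc_const n TYPE('N) * B * \<phi> L) + 3 ^ n * (?K ^ n * B * \<phi> L))"
    by (rule hardy_le_peel_dilations[OF p Us(1) _ f b a]) (use L in simp)
  thus ?thesis by (simp add: Us_def differences_replicate algebra_simps)
qed

end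


section \<open>Means of infinite order\<close>

text \<open>A bound on the mean of order \<open>\<top>\<close> is the same as one bound for all finite orders, as the measure of the
  sphere is one. So the estimates for finite \<open>p\<close>, whose constants do not depend on \<open>p\<close>, also cover \<open>\<top>\<close>.\<close>

definition finite_orders :: "ennreal \<Rightarrow> real set" where
  "finite_orders p = (if p = \<top> then {1..} else {enn2real p})"

lemma finite_orders_ge_1:
  assumes "1 \<le> p" "q \<in> finite_orders p" shows "1 \<le> q"
proof (cases "p = \<top>")
  case False
  hence "ennreal 1 \<le> ennreal (enn2real p)" using assms by (simp add: less_top)
  hence "1 \<le> enn2real p" by (subst (asm) ennreal_le_iff) auto
  thus ?thesis using assms False by (simp add: finite_orders_def)
qed (use assms in \<open>auto simp: finite_orders_def\<close>)

lemma ennreal_powr_inverse_le_iff: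
  assumes "1 \<le> q" "0 \<le> c"
  shows "ennreal_powr x (1 / q) \<le> ennreal c \<longleftrightarrow> x \<le> ennreal (c powr q)"
proof (cases "x = \<top>")
  case True thus ?thesis by (simp add: ennreal_powr_def top_unique)
next
  case False
  then obtain y where y: "x = ennreal y" "0 \<le> y" by (cases x) auto
  have "y powr (1 / q) \<le> c \<longleftrightarrow> y \<le> c powr q"
  proof
    assume "y powr (1 / q) \<le> c"
    hence "(y powr (1 / q)) powr q \<le> c powr q" using assms by (intro powr_mono2) auto
    thus "y \<le> c powr q" using assms y by (simp add: powr_powr)
  next
    assume "y \<le> c powr q"
    hence "y powr (1 / q) \<le> (c powr q) powr (1 / q)" using assms y by (intro powr_mono2) auto
    thus "y powr (1 / q) \<le> c" using assms by (simp add: powr_powr)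
  qed
  thus ?thesis using False assms y by (simp add: ennreal_powr_def ennreal_le_iff)
qed

lemma int_mean_finite_le_iff:
  assumes "1 \<le> p" "p \<noteq> \<top>" "0 \<le> c"
  shows "int_mean p r g \<le> ennreal c \<longleftrightarrow> mean_le (enn2real p) (\<lambda>\<zeta>. g (r *\<^sub>R \<zeta>)) c"
proof -
  have "1 \<le> enn2real p" using finite_orders_ge_1[OF assms(1), of "enn2real p"] assms by (simp add: finite_orders_def)
  from ennreal_powr_inverse_le_iff[OF this assms(3)] show ?thesis
    using assms by (simp add: int_mean_def mean_le_def)
qed

lemma mean_le_of_int_mean:
  fixes g :: "complex ^ 'N::finite \<Rightarrow> complex"
  assumes p: "1 \<le> p" and c: "0 \<le> c" and le: "int_mean p r g \<le> ennreal c" and q: "q \<in> finite_orders p"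
  shows "mean_le q (\<lambda>\<zeta>. g (r *\<^sub>R \<zeta>)) c"
proof (cases "p = \<top>")
  case False
  from iffD1[OF int_mean_finite_le_iff[OF p this c] le] show ?thesis
    using q False by (simp add: finite_orders_def)
next
  case True
  interpret S: prob_space "sphere_measure :: (complex ^ 'N) measure" by (rule prob_space_sphere_measure)
  have q1: "1 \<le> q" by (rule finite_orders_ge_1[OF p q])
  have "AE \<zeta> in sphere_measure. ennreal (norm (g (r *\<^sub>R \<zeta>))) \<le> esssup sphere_measure (\<lambda>\<zeta>. ennreal (norm (g (r *\<^sub>R \<zeta>))))"
    by (rule esssup_AE)
  hence "AE \<zeta> in sphere_measure. ennreal (norm (g (r *\<^sub>R \<zeta>)) powr q) \<le> ennreal (c powr q)"
  proof eventually_elim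
    case (elim \<zeta>)
    hence "ennreal (norm (g (r *\<^sub>R \<zeta>))) \<le> ennreal c" using le True by (simp add: int_mean_def)
    thus ?case using c q1 by (intro ennreal_leI powr_mono2) (auto simp: ennreal_le_iff)
  qed
  hence "(\<integral>\<^sup>+\<zeta>. ennreal (norm (g (r *\<^sub>R \<zeta>)) powr q) \<partial>sphere_measure) \<le> (\<integral>\<^sup>+\<zeta>. ennreal (c powr q) \<partial>(sphere_measure :: (complex ^ 'N) measure))"
    by (rule nn_integral_mono_AE)
  also have "\<dots> = ennreal (c powr q)" using S.emeasure_space_1 by simp
  finally show ?thesis using c by (simp add: mean_le_def)
qed

text \<open>By Markov's inequality, the set where \<open>|h| > d\<close> has measure at most \<open>(c / d)\<^sup>q\<close>. For \<open>d > c\<close> this tends to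
  zero as \<open>q\<close> tends to infinity.\<close>

lemma AE_le_of_mean_le:
  fixes h :: "complex ^ 'N::finite \<Rightarrow> complex"
  assumes [measurable]: "h \<in> borel_measurable sphere_measure"
    and c: "\<And>q. 1 \<le> q \<Longrightarrow> mean_le q h c"
  shows "AE \<zeta> in sphere_measure. norm (h \<zeta>) \<le> c"
proof -
  have c0: "0 \<le> c" using c[of 1] by (simp add: mean_le_def)
  have "AE \<zeta> in sphere_measure. norm (h \<zeta>) \<le> c + inverse (real (Suc k))" for k
  proof -
    define d where "d = c + inverse (real (Suc k))"
    have d: "0 \<le> c" "c < d" using c0 by (simp_all add: d_def)
    define E where "E = {\<zeta> \<in> space sphere_measure. d < norm (h \<zeta>)}"
    have [measurable]: "E \<in> sets sphere_measure" unfolding E_def by measurable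
    have "emeasure sphere_measure E \<le> ennreal ((c / d) powr real (Suc m))" for m
    proof -
      let ?q = "real (Suc m)"
      have "ennreal (d powr ?q) * emeasure sphere_measure E = (\<integral>\<^sup>+\<zeta>. ennreal (d powr ?q) * indicator E \<zeta> \<partial>sphere_measure)"
        by (simp add: nn_integral_cmult)
      also have "\<dots> \<le> (\<integral>\<^sup>+\<zeta>. ennreal (norm (h \<zeta>) powr ?q) \<partial>sphere_measure)"
        using d by (intro nn_integral_mono) (auto simp: indicator_def E_def intro!: ennreal_leI powr_mono2)
      also have "\<dots> \<le> ennreal (c powr ?q)" using c[of ?q] by (simp add: mean_le_def)
      also have "\<dots> = ennreal (d powr ?q) * ennreal ((c / d) powr ?q)"
        using d by (simp add: powr_divide flip: ennreal_mult)
      finally show ?thesis using d by (subst (asm) ennreal_mult_le_mult_iff) auto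
    qed
    moreover have "(\<lambda>m. ennreal ((c / d) powr real (Suc m))) \<longlonglongrightarrow> 0"
    proof -
      have "(\<lambda>m. (c / d) ^ Suc m) \<longlonglongrightarrow> 0"
        using d by (intro LIMSEQ_Suc LIMSEQ_realpow_zero) auto
      moreover have "(c / d) ^ Suc m = (c / d) powr real (Suc m)" for m
        using d by (cases "c = 0") (simp_all add: powr_realpow[symmetric] del: power_Suc)
      ultimately show ?thesis using tendsto_ennrealI by fastforce
    qed
    ultimately have "emeasure sphere_measure E \<le> 0" by (intro LIMSEQ_le_const) auto
    hence "E \<in> null_sets sphere_measure" by (auto simp: null_sets_def)
    thus ?thesis by (rule AE_I'[of E]) (auto simp: E_def d_def not_le)
  qed
  hence "AE \<zeta> in sphere_measure. \<forall>k. norm (h \<zeta>) \<le> c + inverse (real (Suc k))"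
    by (simp add: AE_all_countable)
  thus ?thesis
  proof eventually_elim
    case (elim \<zeta>)
    have "(\<lambda>k. c + inverse (real (Suc k))) \<longlonglongrightarrow> c + 0"
      by (intro tendsto_intros LIMSEQ_inverse_real_of_nat)
    thus ?case using elim by (intro LIMSEQ_le_const[of _ c]) auto
  qed
qed

lemma hardy_norm_leI:
  fixes f :: "complex ^ 'N::finite \<Rightarrow> complex"
  assumes p: "1 \<le> p" and f: "holo_on f (ball 0 1)"
    and le: "\<And>q. q \<in> finite_orders p \<Longrightarrow> hardy_le q f c"
  shows "hardy_norm p f \<le> ennreal c"
  unfolding hardy_norm_def
proof (rule SUP_least)
  fix r :: real assume "r \<in> {0<..<1}"
  hence r: "0 < r" "r < 1" by auto
  have m: "mean_le q (\<lambda>\<zeta>. f (r *\<^sub>R \<zeta>)) c" if "q \<in> finite_orders p" for q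
    using le[OF that] r by (simp add: hardy_le_def)
  show "int_mean p r f \<le> ennreal c"
  proof (cases "p = \<top>")
    case False
    hence "mean_le (enn2real p) (\<lambda>\<zeta>. f (r *\<^sub>R \<zeta>)) c" by (intro m) (simp add: finite_orders_def)
    moreover from this have "0 \<le> c" by (simp add: mean_le_def)
    ultimately show ?thesis using int_mean_finite_le_iff[OF p False] by blast
  next
    case True
    have meas [measurable]: "(\<lambda>\<zeta>. f (r *\<^sub>R \<zeta>)) \<in> borel_measurable sphere_measure"
      by (rule measurable_sphere_holo[OF f r])
    have "AE \<zeta> in sphere_measure. norm (f (r *\<^sub>R \<zeta>)) \<le> c"
      by (rule AE_le_of_mean_le[OF meas]) (use m True in \<open>simp add: finite_orders_def\<close>)
    hence "AE \<zeta> in sphere_measure. ennreal (norm (f (r *\<^sub>R \<zeta>))) \<le> ennreal c"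
      by eventually_elim (rule ennreal_leI)
    thus ?thesis unfolding int_mean_def using True by (simp add: esssup_I)
  qed
qed


section \<open>Moduli of smoothness and the growth of the radial derivative\<close>

text \<open>If \<open>|U z| > |z|\<close>, then the multiple of \<open>z\<close> that \<open>U\<close> maps to the unit sphere lies in the open ball.\<close>

lemma contraction_ball_operator:
  assumes "U \<in> ball_operators" shows "contraction U"
proof -
  have lin: "Vector_Spaces.linear (*s) (*s) U" and ball: "U ` ball 0 1 \<subseteq> ball 0 1"
    using assms by (auto simp: ball_operators_def)
  have "norm (U z) \<le> norm z" for z
  proof (rule ccontr)
    assume "\<not> norm (U z) \<le> norm z"
    hence less: "norm z < norm (U z)" by simp
    hence pos: "0 < norm (U z)" using norm_ge_zero[of z] by linarith
    let ?t = "1 / norm (U z)"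
    have "of_real ?t *s z \<in> ball 0 1" using less pos by (simp add: norm_cscale norm_divide)
    hence "U (of_real ?t *s z) \<in> ball 0 1" using ball by blast
    thus False using pos by (simp add: clinearD[OF lin] norm_cscale norm_divide)
  qed
  thus ?thesis using lin by (simp add: contraction_def)
qed

lemma norm_le_onorm_minus_id:
  assumes "Vector_Spaces.linear (*s) (*s) (U :: complex ^ 'N::finite \<Rightarrow> complex ^ 'N)"
    and "onorm (\<lambda>z. U z - z) < \<delta>"
  shows "norm (U z - z) \<le> \<delta> * norm z"
proof -
  have "bounded_linear (\<lambda>z. U z - z)"
    by (intro bounded_linear_sub clinear_bounded[OF assms(1)] bounded_linear_ident)
  from onorm[OF this, of z] have "norm (U z - z) \<le> onorm (\<lambda>z. U z - z) * norm z" .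
  also have "\<dots> \<le> \<delta> * norm z" using assms(2) by (intro mult_right_mono) auto
  finally show ?thesis .
qed

text \<open>The growth of \<open>\<phi> x / x\<^sup>\<alpha>\<close> enters as \<open>\<phi> (L / 2) \<le> 2\<^sup>-\<^sup>\<alpha> \<phi> L\<close>, and the radius
  \<open>1 - x\<close> is replaced by \<open>e\<^sup>-\<^sup>L\<close>, for which \<open>L / 2 \<le> 1 - e\<^sup>-\<^sup>L \<le> L\<close>.\<close>

lemma modulus_plus_le:
  fixes \<phi> :: "real \<Rightarrow> real"
  assumes n: "n \<ge> 1" and p: "1 \<le> p"
    and pos: "\<And>x. x \<in> {0<..1} \<Longrightarrow> \<phi> x > 0"
    and mono: "mono_on {0<..1} \<phi>"
    and \<alpha>: "0 < \<alpha>" and mono_\<alpha>: "mono_on {0<..1} (\<lambda>x. \<phi> x / x powr \<alpha>)"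
  obtains C where "0 < C"
    "\<And>f c \<eta> \<delta>. holo_on (f :: complex ^ 'N::finite \<Rightarrow> complex) (ball 0 1) \<Longrightarrow> 0 < c \<Longrightarrow>
      (\<And>r. 1 - \<eta> < r \<Longrightarrow> r < 1 \<Longrightarrow> int_mean p r (radial_deriv n f) \<le> ennreal (c * (\<phi> (1 - r) / (1 - r) ^ n))) \<Longrightarrow>
      0 < \<delta> \<Longrightarrow> \<delta> < \<eta> \<Longrightarrow> \<delta> \<le> 1 / 2 \<Longrightarrow>
      modulus_plus n p \<delta> f \<le> ennreal (C * c * \<phi> \<delta>) \<and> hardy_norm p f < \<top>"
proof -
  define q where "q = (1 / 2 :: real) powr \<alpha>"
  have q: "0 \<le> q" "q < 1" using \<alpha> by (simp_all add: q_def powr_def ln_div)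
  have half: "\<phi> (L / 2) \<le> q * \<phi> L" if "0 < L" "L \<le> 1" for L
  proof -
    have "\<phi> (L / 2) / (L / 2) powr \<alpha> \<le> \<phi> L / L powr \<alpha>"
      using mono_onD[OF mono_\<alpha>, of "L / 2" L] that by auto
    hence "\<phi> (L / 2) / (L / 2) powr \<alpha> * (L / 2) powr \<alpha> \<le> \<phi> L / L powr \<alpha> * (L / 2) powr \<alpha>"
      by (rule mult_right_mono) simp
    moreover have "(L / 2) powr \<alpha> = L powr \<alpha> * q"
      using that by (simp add: q_def powr_mult[symmetric])
    ultimately show ?thesis using that by (simp add: q_def mult.commute)
  qed
  define C\<^sub>0 where "C\<^sub>0 = 2 ^ n * dyadic_weight.osc_const q n TYPE('N) + 3 ^ n * diff_const TYPE('N) ^ n"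
  show ?thesis
  proof
    have "dyadic_weight (\<lambda>_. 0) q (1 / 2)" by unfold_locales (use q in auto)
    hence "0 \<le> dyadic_weight.osc_const q n TYPE('N)" by (rule dyadic_weight.osc_const_nonneg)
    hence "0 < C\<^sub>0" using diff_const_pos[of "TYPE('N)"] by (simp add: C\<^sub>0_def add_nonneg_pos)
    thus "0 < 2 ^ n * C\<^sub>0" by simp
  next
    fix f :: "complex ^ 'N \<Rightarrow> complex" and c \<eta> \<delta> :: real
    assume f: "holo_on f (ball 0 1)" and c: "0 < c"
      and growth: "\<And>r. 1 - \<eta> < r \<Longrightarrow> r < 1 \<Longrightarrow> int_mean p r (radial_deriv n f) \<le> ennreal (c * (\<phi> (1 - r) / (1 - r) ^ n))"
      and \<delta>: "0 < \<delta>" "\<delta> < \<eta>" "\<delta> \<le> 1 / 2"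
    interpret W: dyadic_weight \<phi> q \<delta>
      by unfold_locales (use \<delta> q half pos in \<open>auto intro: less_imp_le\<close>)
    define B where "B = c * 2 ^ n"
    have B: "0 \<le> B" using c by (simp add: B_def)
    have Rf: "mean_le s (\<lambda>\<zeta>. (Rad ^^ n) f (exp (- L) *\<^sub>R \<zeta>)) (B * \<phi> L / L ^ n)"
      if s: "s \<in> finite_orders p" and L: "0 < L" "L \<le> \<delta>" for s L
    proof -
      define x where "x = 1 - exp (- L)"
      have x: "x \<le> L" "L / 2 \<le> x"
      proof -
        show "x \<le> L" using exp_ge_add_one_self[of "- L"] by (simp add: x_def)
        have "exp (- L) \<le> 1 / (1 + L)"
          using exp_ge_add_one_self[of L] L by (simp add: exp_minus field_simps)
        also have "\<dots> \<le> 1 - L / 2"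
        proof -
          have "1 \<le> (1 - L / 2) * (1 + L)" using L \<delta> by (simp add: algebra_simps power2_eq_square mult_left_le)
          thus ?thesis using L by (simp add: pos_divide_le_eq)
        qed
        finally show "L / 2 \<le> x" by (simp add: x_def)
      qed
      have x0: "0 < x" "x \<le> 1" using x L \<delta> by auto
      have "\<phi> x / x ^ n \<le> \<phi> L / (L / 2) ^ n"
      proof (rule frac_le)
        show "\<phi> x \<le> \<phi> L" using mono_onD[OF mono, of x L] x x0 L \<delta> by auto
        show "(L / 2) ^ n \<le> x ^ n" using x L by (intro power_mono) auto
      qed (use pos[of L] L \<delta> in \<open>auto intro: less_imp_le\<close>)
      hence "c * (\<phi> x / x ^ n) \<le> c * (\<phi> L / (L / 2) ^ n)"
        using c by (intro mult_left_mono) auto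
      also have "\<dots> = B * \<phi> L / L ^ n" by (simp add: B_def power_divide)
      finally have le: "c * (\<phi> x / x ^ n) \<le> B * \<phi> L / L ^ n" .
      have nonneg: "0 \<le> B * \<phi> L / L ^ n" using B pos[of L] L \<delta> by (auto intro!: divide_nonneg_pos mult_nonneg_nonneg less_imp_le[OF pos])
      have "int_mean p (exp (- L)) (radial_deriv n f) \<le> ennreal (c * (\<phi> x / x ^ n))"
        unfolding x_def by (rule growth) (use x L \<delta> in \<open>auto simp: x_def\<close>)
      hence "int_mean p (exp (- L)) (radial_deriv n f) \<le> ennreal (B * \<phi> L / L ^ n)"
        using ennreal_leI[OF le] by (rule order_trans)
      from mean_le_of_int_mean[OF p nonneg this s]
      show ?thesis
        by (rule mean_le_cong[THEN iffD1, rotated]) (use L n in \<open>simp add: radial_deriv_eq[OF f]\<close>)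
    qed
    have "modulus_plus n p \<delta> f \<le> ennreal (C\<^sub>0 * B * \<phi> \<delta>)"
      unfolding modulus_plus_def
    proof (rule SUP_least)
      fix U :: "complex ^ 'N \<Rightarrow> complex ^ 'N" assume "U \<in> {U \<in> ball_operators. onorm (\<lambda>z. U z - z) < \<delta>}"
      hence U: "contraction U" "onorm (\<lambda>z. U z - z) < \<delta>" by (auto intro: contraction_ball_operator)
      have near: "norm (U z - z) \<le> \<delta> * norm z" for z
        using norm_le_onorm_minus_id[OF _ U(2)] U(1) by (simp add: contraction_def)
      show "hardy_norm p ((difference U ^^ n) f) \<le> ennreal (C\<^sub>0 * B * \<phi> \<delta>)"
      proof (rule hardy_norm_leI[OF p])
        show "holo_on ((difference U ^^ n) f) (ball 0 1)"
          using holo_on_differences[OF f, of "replicate n U"] U(1) by (simp add: differences_replicate)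
        show "hardy_le s ((difference U ^^ n) f) (C\<^sub>0 * B * \<phi> \<delta>)" if s: "s \<in> finite_orders p" for s
          unfolding C\<^sub>0_def
          by (rule W.hardy_le_differences_of_radial[OF f finite_orders_ge_1[OF p s] n B Rf[OF s] \<delta>(1) order_refl U(1) near])
      qed
    qed
    moreover have "hardy_norm p f < \<top>"
    proof -
      have "cball 0 (exp (- \<delta>)) \<subseteq> ball (0 :: complex ^ 'N) 1"
        using \<delta> by (simp add: cball_subset_ball_iff)
      hence "bounded (f ` cball 0 (exp (- \<delta>)))"
        by (intro compact_imp_bounded compact_continuous_image compact_cball
            continuous_on_subset[OF holo_on_continuous[OF f]])
      then obtain M where M: "\<And>z. norm z \<le> exp (- \<delta>) \<Longrightarrow> norm (f z) \<le> M"
        unfolding bounded_iff by (metis image_eqI mem_cball_0)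
      have M0: "0 \<le> M" using M[of 0] by (simp) (meson norm_ge_zero order_trans)
      have "hardy_norm p f \<le> ennreal (W.osc_const n TYPE('N) * B * \<phi> \<delta> + 3 ^ n * M)"
        by (rule hardy_norm_leI[OF p f], rule W.hardy_le_of_radial[OF f _ n B Rf \<delta>(1) order_refl M0 M])
          (use finite_orders_ge_1[OF p] in auto)
      thus ?thesis by (rule le_less_trans) simp
    qed
    ultimately show "modulus_plus n p \<delta> f \<le> ennreal (2 ^ n * C\<^sub>0 * c * \<phi> \<delta>) \<and> hardy_norm p f < \<top>"
      by (simp add: B_def mult_ac)
  qed
qed

theorem corollary1p9:
  fixes n :: nat and p :: ennreal and \<phi> :: "real \<Rightarrow> real" and \<alpha> :: real
  assumes "n \<ge> 1" and "1 \<le> p"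
    and "\<And>x. x \<in> {0<..1} \<Longrightarrow> \<phi> x > 0"
    and "continuous_on {0<..1} \<phi>"
    and "mono_on {0<..1} \<phi>"
    and "0 < \<alpha>" and "\<alpha> < real n"
    and "mono_on {0<..1} (\<lambda>x. \<phi> x / x powr \<alpha>)"
  shows "(Lambda_bigo p n \<phi> :: (complex ^ 'N::finite \<Rightarrow> complex) set) \<subseteq> Lip_bigo p n \<phi> \<and>
         (Lambda_smallo p n \<phi> :: (complex ^ 'N \<Rightarrow> complex) set) \<subseteq> Lip_smallo p n \<phi>"
proof -
  obtain C where C: "0 < C"
    and bound: "\<And>f c \<eta> \<delta>. holo_on (f :: complex ^ 'N \<Rightarrow> complex) (ball 0 1) \<Longrightarrow> 0 < c \<Longrightarrow>
      (\<And>r. 1 - \<eta> < r \<Longrightarrow> r < 1 \<Longrightarrow> int_mean p r (radial_deriv n f) \<le> ennreal (c * (\<phi> (1 - r) / (1 - r) ^ n))) \<Longrightarrow>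
      0 < \<delta> \<Longrightarrow> \<delta> < \<eta> \<Longrightarrow> \<delta> \<le> 1 / 2 \<Longrightarrow>
      modulus_plus n p \<delta> f \<le> ennreal (C * c * \<phi> \<delta>) \<and> hardy_norm p f < \<top>"
    using modulus_plus_le[OF assms(1,2,3,5,6,8), where 'N='N] by blast
  have main: "(\<forall>\<^sub>F \<delta> in at_right 0. modulus_plus n p \<delta> f \<le> ennreal (C * c * \<phi> \<delta>)) \<and> hardy_norm p f < \<top>"
    if f: "holo_on f (ball 0 1)" and c: "0 < c"
      and ev: "\<forall>\<^sub>F r in at_left 1. int_mean p r (radial_deriv n f) \<le> ennreal (c * (\<phi> (1 - r) / (1 - r) ^ n))"
    for f :: "complex ^ 'N \<Rightarrow> complex" and c
  proof -
    obtain b where b: "b < 1" "\<And>r. b < r \<Longrightarrow> r < 1 \<Longrightarrow> int_mean p r (radial_deriv n f) \<le> ennreal (c * (\<phi> (1 - r) / (1 - r) ^ n))"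
      using ev eventually_at_left[of 0 "1::real"] by auto
    define d where "d = min (1 - b) (1 / 2)"
    have d: "0 < d" using b by (simp add: d_def)
    have *: "modulus_plus n p \<delta> f \<le> ennreal (C * c * \<phi> \<delta>) \<and> hardy_norm p f < \<top>" if "0 < \<delta>" "\<delta> < d" for \<delta>
      by (rule bound[OF f c, of "1 - b"]) (use b that in \<open>auto simp: d_def\<close>)
    hence "\<forall>\<^sub>F \<delta> in at_right 0. modulus_plus n p \<delta> f \<le> ennreal (C * c * \<phi> \<delta>)"
      using eventually_at_right[of 0 "1::real"] d by auto
    moreover have "hardy_norm p f < \<top>" using *[of "d / 2"] d by simp
    ultimately show ?thesis by blast
  qed
  show ?thesis
  proof (intro conjI subsetI)
    fix f :: "complex ^ 'N \<Rightarrow> complex" assume "f \<in> Lambda_bigo p n \<phi>"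
    then obtain c where f: "holo_on f (ball 0 1)" and c: "0 < c"
      and ev: "\<forall>\<^sub>F r in at_left 1. int_mean p r (radial_deriv n f) \<le> ennreal (c * (\<phi> (1 - r) / (1 - r) ^ n))"
      by (auto simp: Lambda_bigo_def ennreal_bigo_def holomorphic_ball_iff)
    from main[OF this] C c show "f \<in> Lip_bigo p n \<phi>"
      unfolding Lip_bigo_def hardy_space_def ennreal_bigo_def holomorphic_ball_iff
      using f by (auto intro!: exI[of _ "C * c"])
  next
    fix f :: "complex ^ 'N \<Rightarrow> complex" assume "f \<in> Lambda_smallo p n \<phi>"
    hence f: "holo_on f (ball 0 1)"
      and ev: "\<And>c. 0 < c \<Longrightarrow> \<forall>\<^sub>F r in at_left 1. int_mean p r (radial_deriv n f) \<le> ennreal (c * (\<phi> (1 - r) / (1 - r) ^ n))"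
      by (auto simp: Lambda_smallo_def ennreal_smallo_def holomorphic_ball_iff)
    have "\<forall>\<^sub>F \<delta> in at_right 0. modulus_plus n p \<delta> f \<le> ennreal (c * \<phi> \<delta>)" if "0 < c" for c
      using main[OF f _ ev, of "c / C"] that C by simp
    moreover have "hardy_norm p f < \<top>" using main[OF f _ ev, of 1] by simp
    ultimately show "f \<in> Lip_smallo p n \<phi>"
      unfolding Lip_smallo_def hardy_space_def ennreal_smallo_def holomorphic_ball_iff using f by auto
  qed
qed

end
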